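(* Let $1\le p<\infty$, $s\ge0$, $f\in M^{p,1}_s(\mathbf{R}^n)$, and let $K\subset\mathbf{R}^n$ be compact. Suppose that $F$ is an analytic function on a neighborhood of $f(K)=\{f(x)\mid x\in K\}$ in $\mathbf{C}$. Then there exists $g\in M^{p,1}_s(\mathbf{R}^n)$ such that $g(x)=F(f(x))$ for all $x\in K$.
   Context: $\langle \xi\rangle=(1+|\xi|^2)^{1/2}$. For $f\in\mathcal{S}'(\mathbf{R}^n)$ and a window $\phi\in\mathcal{S}(\mathbf{R}^n)\setminus\{0\}$, the short-time Fourier transform is $V_\phi f(x,\xi)=\int_{\mathbf{R}^n} f(t)\overline{\phi(t-x)}e^{-it\xi}\,dt$ (interpreted by duality). The modulation space $M^{p,1}_s(\mathbf{R}^n)$ consists of all $f\in\mathcal{S}'(\mathbf{R}^n)$ with $\|f\|_{M^{p,1}_s}=\int_{\mathbf{R}^n}\langle\xi\rangle^{s}\big(\int_{\mathbf{R}^n}|V_\phi f(x,\xi)|^p\,dx\big)^{1/p}d\xi<\infty$; different windows give equivalent norms. For $s\ge0$, $M^{p,1}_s(\mathbf{R}^n)\subset C(\mathbf{R}^n)$, so its elements are regarded as continuous functions and have pointwise values. *)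

theory Defs
  imports "HOL-Analysis.Analysis"
begin

definition jbracket :: "real ^ 'n \<Rightarrow> real" where
  "jbracket \<xi> = sqrt (1 + (norm \<xi>)\<^sup>2)"

text \<open>A list of coordinate indices plays the role of a multi-index: the entry \<open>k\<close> occurs
  in the list as often as one differentiates in the \<open>k\<close>-th coordinate.\<close>

fun partials :: "'n list \<Rightarrow> (real ^ 'n \<Rightarrow> complex) \<Rightarrow> real ^ 'n \<Rightarrow> complex" where
  "partials [] \<psi> = \<psi>"
| "partials (k # ks) \<psi> = (\<lambda>x. frechet_derivative (partials ks \<psi>) (at x) (axis k 1))"

definition schwartz :: "(real ^ 'n \<Rightarrow> complex) set" where
  "schwartz = {\<psi>. \<forall>ks. partials ks \<psi> differentiable_on UNIV \<and>
     (\<forall>N. bounded (range (\<lambda>x. jbracket x ^ N *\<^sub>R partials ks \<psi> x)))}"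

text \<open>The norms \<open>schwartz_norm N\<close> form an increasing family defining the usual Frechet
  topology of the Schwartz space.\<close>

definition schwartz_norm :: "nat \<Rightarrow> (real ^ 'n \<Rightarrow> complex) \<Rightarrow> real" where
  "schwartz_norm N \<psi> =
     (\<Sum>ks | length ks \<le> N. SUP x. jbracket x ^ N * norm (partials ks \<psi> x))"

text \<open>Tempered distributions are complex-linear (not conjugate-linear) functionals. They are
  rendered as functions on all of \<open>real ^ 'n \<Rightarrow> complex\<close>; only their values on
  Schwartz functions are meaningful.\<close>

definition tempered_distributions :: "((real ^ 'n \<Rightarrow> complex) \<Rightarrow> complex) set" where
  "tempered_distributions = {T.
     (\<forall>\<psi>\<in>schwartz. \<forall>\<eta>\<in>schwartz. T (\<lambda>t. \<psi> t + \<eta> t) = T \<psi> + T \<eta>) \<and>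
     (\<forall>c. \<forall>\<psi>\<in>schwartz. T (\<lambda>t. c * \<psi> t) = c * T \<psi>) \<and>
     (\<exists>C N. \<forall>\<psi>\<in>schwartz. norm (T \<psi>) \<le> C * schwartz_norm N \<psi>)}"

definition stft ::
  "(real ^ 'n \<Rightarrow> complex) \<Rightarrow> ((real ^ 'n \<Rightarrow> complex) \<Rightarrow> complex)
     \<Rightarrow> real ^ 'n \<Rightarrow> real ^ 'n \<Rightarrow> complex" where
  "stft \<phi> T x \<xi> = T (\<lambda>t. cnj (\<phi> (t - x)) * exp (- (\<i> * complex_of_real (t \<bullet> \<xi>))))"

definition ennpowr :: "ennreal \<Rightarrow> real \<Rightarrow> ennreal" where
  "ennpowr u a = (if u = \<infinity> then \<infinity> else ennreal (enn2real u powr a))"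

definition modulation_norm ::
  "(real ^ 'n \<Rightarrow> complex) \<Rightarrow> real \<Rightarrow> real
     \<Rightarrow> ((real ^ 'n \<Rightarrow> complex) \<Rightarrow> complex) \<Rightarrow> ennreal" where
  "modulation_norm \<phi> p s T =
     (\<integral>\<^sup>+ \<xi>. ennreal (jbracket \<xi> powr s) *
        ennpowr (\<integral>\<^sup>+ x. ennreal (norm (stft \<phi> T x \<xi>) powr p) \<partial>lborel) (1 / p) \<partial>lborel)"

definition modulation_distributions ::
  "(real ^ 'n \<Rightarrow> complex) \<Rightarrow> real \<Rightarrow> real
     \<Rightarrow> ((real ^ 'n \<Rightarrow> complex) \<Rightarrow> complex) set" where
  "modulation_distributions \<phi> p s =
     {T \<in> tempered_distributions. modulation_norm \<phi> p s T < \<infinity>}"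

definition represents ::
  "(real ^ 'n \<Rightarrow> complex) \<Rightarrow> ((real ^ 'n \<Rightarrow> complex) \<Rightarrow> complex) \<Rightarrow> bool" where
  "represents f T \<longleftrightarrow>
     (\<forall>\<psi>\<in>schwartz. integrable lborel (\<lambda>t. f t * \<psi> t) \<and> T \<psi> = (\<integral>t. f t * \<psi> t \<partial>lborel))"

text \<open>For \<open>s \<ge> 0\<close> every tempered distribution with finite modulation norm is (represented by)
  a unique bounded continuous function. The space is the set of these functions, so that its
  elements have pointwise values. The window \<open>\<phi>\<close> stays an explicit parameter; up to
  equivalence of norms nothing depends on it.\<close>

definition modulation_space ::
  "(real ^ 'n \<Rightarrow> complex) \<Rightarrow> real \<Rightarrow> real \<Rightarrow> (real ^ 'n \<Rightarrow> complex) set" where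
  "modulation_space \<phi> p s =
     {f. continuous_on UNIV f \<and> (\<exists>T\<in>modulation_distributions \<phi> p s. represents f T)}"

end

theory Submission
  imports Defs "HOL-Complex_Analysis.Complex_Analysis"
begin

text \<open>
  Near every point the space \<open>M\<^sup>p\<^sup>,\<^sup>1\<^sub>s\<close> coincides, whatever \<open>p\<close> is, with the algebra of functions that
  are Fourier integrals of densities integrable against \<open>weight s \<xi> = (1 + norm \<xi>) powr s\<close>. The theorem
  is thus a Wiener-Levy theorem for this algebra, \<open>fourier_algebra s\<close>, combined with a transfer in both
  directions.

  From the modulation space to the algebra: a finite mixed norm makes, for almost every \<open>x\<close> in a ball,
  the short-time Fourier transform at \<open>x\<close> integrable against the weight, because an \<open>L\<^sup>p\<close> norm dominates
  the \<open>L\<^sup>1\<close> norm on a ball. By Fourier inversion the function times the window shifted by \<open>x\<close> lies in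
  the algebra (\<open>modulation_space_windowed_in_fourier_algebra\<close>). The shifted window is itself in the
  algebra and can be chosen nonzero at a given point, so dividing by it locally gives the function.

  The Wiener-Levy theorem (\<open>wiener_levy_local\<close>): near \<open>x0\<close> the composition \<open>F \<circ> h\<close> is a Taylor series
  in \<open>h - h x0\<close>, which converges in the algebra once \<open>h - h x0\<close>, cut off near \<open>x0\<close>, has small norm.
  For large \<open>s\<close> shrinking the cutoff alone does not make the weighted norm small. The remedy
  is to dilate the shrinking ball to unit size first: the algebra is invariant under dilations,
  and in the new coordinates the norm tends to zero
  (\<open>weighted_translate_difference_small\<close>). The same theorem, applied to the function \<open>inverse\<close>, provides
  the local division used above.

  Gluing: bump functions of finite but arbitrarily high smoothness belong to the algebra, so finitely
  many local solutions on a cover of \<open>K\<close> are merged into one element of the algebra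
  (\<open>fourier_algebra_glue\<close>).

  From the algebra to the modulation space: a bump times an element \<open>fourier H\<close> of the algebra has a
  short-time Fourier transform bounded by an integrable function of \<open>x\<close> times a
  convolution of \<open>norm \<circ> H\<close> with a rapidly decaying function of \<open>\<xi>\<close>, and its mixed norm is finite
  (\<open>fourier_algebra_locally_in_modulation_space\<close>).

  Behind both transfers stand the decay of transforms of differentiable functions
  (\<open>fourier_Ck_bounded_decay\<close>) and Fourier inversion (\<open>fourier_inversion\<close>).
\<close>

section \<open>Polynomial weights\<close>

definition weight :: "real \<Rightarrow> 'a::real_normed_vector \<Rightarrow> real" where
  "weight a x = (1 + norm x) powr a"

lemma one_plus_norm_pos [simp]: "0 < 1 + norm x" "1 + norm x \<noteq> 0"
  by (simp_all add: add_pos_nonneg add_nonneg_eq_0_iff)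

lemma weight_pos [simp]: "0 < weight a x"
  by (simp add: weight_def)

lemma weight_nonneg [simp]: "0 \<le> weight a x"
  using weight_pos[of a x] by linarith

lemma weight_zero [simp]: "weight 0 x = 1"
  by (simp add: weight_def)

lemma weight_add: "weight (a + b) x = weight a x * weight b x"
  by (simp add: weight_def powr_add)

lemma weight_minus: "weight (- a) x = inverse (weight a x)"
  by (simp add: weight_def powr_minus)

lemma weight_mono: "a \<le> b \<Longrightarrow> weight a x \<le> weight b x"
  by (simp add: weight_def powr_mono)

lemma weight_ge_1: "0 \<le> a \<Longrightarrow> 1 \<le> weight a x"
  using weight_mono[of 0 a x] by simp

lemma weight_le_1: "a \<le> 0 \<Longrightarrow> weight a x \<le> 1"
  using weight_mono[of a 0 x] by simp

lemma weight_uminus [simp]: "weight a (- x) = weight a x"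
  by (simp add: weight_def)

lemma weight_minus_mult [simp]: "weight a x * weight (- a) x = 1" "weight (- a) x * weight a x = 1"
  using weight_add[of a "-a" x] by (auto simp: mult.commute)

lemma weight_mono_norm: "0 \<le> a \<Longrightarrow> norm x \<le> norm y \<Longrightarrow> weight a x \<le> weight a y"
  by (simp add: weight_def powr_mono2)

lemma weight_submult:
  assumes "0 \<le> a"
  shows "weight a (x + y) \<le> weight a x * weight a y"
proof -
  have "norm (x + y) \<le> norm x + norm y" "0 \<le> norm x * norm y"
    by (auto simp: norm_triangle_ineq)
  moreover have "(1 + norm x) * (1 + norm y) = 1 + norm x + norm y + norm x * norm y"
    by (simp add: algebra_simps)
  ultimately have "1 + norm (x + y) \<le> (1 + norm x) * (1 + norm y)"
    by linarith
  then show ?thesis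
    using assms by (simp add: weight_def powr_mult[symmetric] powr_mono2)
qed

lemma weight_neg_add:
  assumes "0 \<le> a"
  shows "weight (- a) (x + y) \<le> weight a y * weight (- a) x"
proof -
  have "weight a x \<le> weight a (x + y) * weight a y"
    using weight_submult[OF assms, of "x + y" "- y"] by simp
  then show ?thesis
    using weight_pos[of a x] weight_pos[of a "x + y"] by (simp add: weight_minus field_simps)
qed

lemma continuous_on_weight [continuous_intros]:
  "continuous_on A f \<Longrightarrow> continuous_on A (\<lambda>x. weight a (f x))"
  unfolding weight_def
  by (intro continuous_intros) (auto simp: add_nonneg_eq_0_iff)

lemma measurable_weight [measurable]: "weight a \<in> borel_measurable borel"
  by (intro borel_measurable_continuous_onI continuous_intros)

lemma nn_integral_inverse_one_plus_square:
  "(\<integral>\<^sup>+(x::real). ennreal (inverse (1 + x\<^sup>2)) \<partial>lborel) < \<infinity>"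
proof -
  let ?f = "\<lambda>x::real. inverse (1 + x\<^sup>2)"
  have *: "(\<integral>\<^sup>+x. ennreal (?f x) * indicator {0..} x \<partial>lborel) = ennreal (pi/2 - arctan 0)"
    by (intro nn_integral_FTC_atLeast DERIV_arctan tendsto_arctan_at_top) (auto simp: add_nonneg_nonneg)
  have "(\<integral>\<^sup>+x. ennreal (?f x) \<partial>lborel)
      \<le> (\<integral>\<^sup>+x. ennreal (?f x) * indicator {0..} x + ennreal (?f x) * indicator {0..} (-x) \<partial>lborel)"
    by (intro nn_integral_mono) (auto simp: indicator_def)
  also have "\<dots> = (\<integral>\<^sup>+x. ennreal (?f x) * indicator {0..} x \<partial>lborel)
      + (\<integral>\<^sup>+x. ennreal (?f x) * indicator {0..} (-x) \<partial>lborel)"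
    by (intro nn_integral_add) auto
  also have "(\<integral>\<^sup>+x. ennreal (?f x) * indicator {0..} (-x) \<partial>lborel) = (\<integral>\<^sup>+x. ennreal (?f x) * indicator {0..} x \<partial>lborel)"
    by (subst nn_integral_real_affine[where c="-1" and t=0]) auto
  finally show ?thesis
    unfolding * by (simp add: top.not_eq_extremum ennreal_plus[symmetric] del: ennreal_plus) 
       (metis ennreal_less_top ennreal_add_less_top order_le_less_trans)
qed

text \<open>Comparison with a product of one-dimensional integrals: every factor
  \<open>1 + (x \<bullet> b)\<^sup>2\<close> is at most \<open>(1 + norm x)\<^sup>2\<close>.\<close>

lemma integrable_weight:
  assumes "a \<le> - 2 * real DIM('a)"
  shows "integrable lborel (weight a :: 'a::euclidean_space \<Rightarrow> real)"
proof (rule integrableI_bounded)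
  have le: "weight a x \<le> (\<Prod>b\<in>Basis. inverse (1 + (x \<bullet> b)\<^sup>2))" for x :: 'a
  proof -
    have 1: "1 + (x \<bullet> b)\<^sup>2 \<le> (1 + norm x)\<^sup>2" if "b \<in> Basis" for b
    proof -
      have "(x \<bullet> b)\<^sup>2 \<le> (norm x)\<^sup>2"
        using Basis_le_norm[OF that, of x] by (metis abs_ge_zero power2_abs power_mono)
      then show ?thesis by (simp add: power2_eq_square algebra_simps) 
          (smt (verit) norm_ge_zero)
    qed
    have "(1 + norm x) powr (-2 * real DIM('a)) = inverse ((1 + norm x) powr real (2 * DIM('a)))"
      by (subst powr_minus[symmetric]) simp
    also have "\<dots> = inverse ((1 + norm x)\<^sup>2) ^ DIM('a)"
      by (subst powr_realpow) (simp_all add: power_mult power_inverse)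
    also have "\<dots> = (\<Prod>b\<in>(Basis::'a set). inverse ((1 + norm x)\<^sup>2))"
      by simp
    also have "\<dots> \<le> (\<Prod>b\<in>(Basis::'a set). inverse (1 + (x \<bullet> b)\<^sup>2))"
      using 1 by (intro prod_mono conjI le_imp_inverse_le) (auto simp: add_pos_nonneg)
    finally show ?thesis
      using weight_mono[OF assms, of x] by (simp add: weight_def)
  qed
  have "(\<integral>\<^sup>+(x::'a). ennreal (norm (weight a x)) \<partial>lborel)
      \<le> (\<integral>\<^sup>+(x::'a). ennreal (\<Prod>b\<in>Basis. inverse (1 + (x \<bullet> b)\<^sup>2)) \<partial>lborel)"
    using le by (intro nn_integral_mono ennreal_leI) auto
  also have "\<dots> = (\<integral>\<^sup>+(x::'a). (\<Prod>b\<in>Basis. ennreal (inverse (1 + (x \<bullet> b)\<^sup>2))) \<partial>lborel)"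
    by (intro nn_integral_cong prod_ennreal[symmetric]) (auto simp: add_nonneg_nonneg)
  also have "\<dots> = (\<Prod>b\<in>(Basis::'a set). \<integral>\<^sup>+x. ennreal (inverse (1 + x\<^sup>2)) \<partial>lborel)"
    by (rule nn_integral_lborel_prod) auto
  also have "\<dots> < \<infinity>"
    using nn_integral_inverse_one_plus_square
    by (simp add: power_less_top_ennreal)
  finally show "(\<integral>\<^sup>+(x::'a). ennreal (norm (weight a x)) \<partial>lborel) < \<infinity>" .
qed simp

section \<open>Affine changes of variables\<close>

lemma lborel_integrable_affine:
  fixes f :: "'a::euclidean_space \<Rightarrow> 'b::{banach, second_countable_topology}"
  assumes f: "integrable lborel f" and c: "c \<noteq> 0"
  shows "integrable lborel (\<lambda>x. f (t + c *\<^sub>R x))"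
proof -
  have [measurable]: "f \<in> borel_measurable borel" using f by auto
  have "(\<integral>\<^sup>+x. ennreal (norm (f x)) \<partial>lborel) = ennreal (\<bar>c\<bar> ^ DIM('a)) * (\<integral>\<^sup>+x. ennreal (norm (f (t + c *\<^sub>R x))) \<partial>lborel)"
    by (subst lborel_affine[OF c, of t])
     (simp add: nn_integral_density nn_integral_distr nn_integral_cmult)
  with f c show ?thesis
    unfolding integrable_iff_bounded by (auto simp: ennreal_mult_less_top)
qed

lemma lborel_integral_affine:
  fixes f :: "'a::euclidean_space \<Rightarrow> 'b::{banach, second_countable_topology}"
  assumes f: "f \<in> borel_measurable borel" and c: "c \<noteq> 0"
  shows "integral\<^sup>L lborel f = (\<bar>c\<bar> ^ DIM('a)) *\<^sub>R (\<integral>x. f (t + c *\<^sub>R x) \<partial>lborel)"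
  using f by (subst lborel_affine[OF c, of t]) (simp add: integral_density integral_distr)

lemma lborel_integrable_translate:
  fixes f :: "'a::euclidean_space \<Rightarrow> 'b::{banach, second_countable_topology}"
  shows "integrable lborel f \<Longrightarrow> integrable lborel (\<lambda>x. f (x - t))"
  using lborel_integrable_affine[of f 1 "-t"] by simp

lemma lborel_integral_translate:
  fixes f :: "'a::euclidean_space \<Rightarrow> 'b::{banach, second_countable_topology}"
  shows "f \<in> borel_measurable borel \<Longrightarrow> (\<integral>x. f (x - t) \<partial>lborel) = integral\<^sup>L lborel f"
  using lborel_integral_affine[of f 1 "-t"] by simp

lemma lborel_integrable_reflect:
  fixes f :: "'a::euclidean_space \<Rightarrow> 'b::{banach, second_countable_topology}"
  shows "integrable lborel f \<Longrightarrow> integrable lborel (\<lambda>x. f (t - x))"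
  using lborel_integrable_affine[of f "-1" t] by simp

lemma lborel_integral_reflect:
  fixes f :: "'a::euclidean_space \<Rightarrow> 'b::{banach, second_countable_topology}"
  shows "f \<in> borel_measurable borel \<Longrightarrow> (\<integral>x. f (t - x) \<partial>lborel) = integral\<^sup>L lborel f"
  using lborel_integral_affine[of f "-1" t] by simp

lemma integrable_pair_convolution:
  fixes f g :: "'a::euclidean_space \<Rightarrow> real"
  assumes f: "integrable lborel f" and g: "integrable lborel g"
  shows "integrable (lborel \<Otimes>\<^sub>M lborel) (\<lambda>(x, y). f x * g (y - c *\<^sub>R x))"
proof -
  have [measurable]: "f \<in> borel_measurable borel" "g \<in> borel_measurable borel" using f g by auto
  show ?thesis
  proof (rule lborel_pair.Fubini_integrable)
    have "(\<integral>y. norm (f x * g (y - c *\<^sub>R x)) \<partial>lborel) = \<bar>f x\<bar> * (\<integral>y. \<bar>g y\<bar> \<partial>lborel)" for x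
      by (simp add: abs_mult lborel_integral_translate[of "\<lambda>y. \<bar>g y\<bar>"])
    then show "integrable lborel (\<lambda>x. \<integral>y. norm (case (x, y) of (x, y) \<Rightarrow> f x * g (y - c *\<^sub>R x)) \<partial>lborel)"
      using f by simp
    show "AE x in lborel. integrable lborel (\<lambda>y. case (x, y) of (x, y) \<Rightarrow> f x * g (y - c *\<^sub>R x))"
      using g by (auto intro: lborel_integrable_translate)
  qed measurable
qed

lemma integrable_pair_product:
  fixes f :: "'a::euclidean_space \<Rightarrow> real" and g :: "'b::euclidean_space \<Rightarrow> real"
  assumes f: "integrable lborel f" and g: "integrable lborel g"
  shows "integrable (lborel \<Otimes>\<^sub>M lborel) (\<lambda>(x, y). f x * g y)"
proof -
  have [measurable]: "f \<in> borel_measurable borel" "g \<in> borel_measurable borel" using f g by auto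
  show ?thesis
    using f g by (intro lborel_pair.Fubini_integrable) (auto simp: abs_mult)
qed

section \<open>The Fourier integral\<close>

text \<open>The exponent is positive and there is no normalizing factor, so that one operator serves as
  transform and as synthesis: applied twice it reflects and multiplies by a constant, and the
  short-time Fourier transform at frequency \<open>\<xi>\<close> is its value at \<open>- \<xi>\<close>.\<close>

definition fourier :: "('a::euclidean_space \<Rightarrow> complex) \<Rightarrow> 'a \<Rightarrow> complex" where
  "fourier u \<xi> = (\<integral>t. u t * cis (t \<bullet> \<xi>) \<partial>lborel)"

lemma continuous_on_cis_inner [continuous_intros]:
  "continuous_on A f \<Longrightarrow> continuous_on A g \<Longrightarrow> continuous_on A (\<lambda>x. cis (f x \<bullet> g x))"
  by (intro continuous_on_cis continuous_intros)

lemma measurable_cis_inner [measurable (raw)]: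
  fixes f g :: "'a \<Rightarrow> 'b::euclidean_space"
  assumes [measurable]: "f \<in> borel_measurable M" "g \<in> borel_measurable M"
  shows "(\<lambda>x. cis (f x \<bullet> g x)) \<in> borel_measurable M"
proof -
  have [measurable]: "cis \<in> borel_measurable borel"
    by (intro borel_measurable_continuous_onI continuous_on_cis continuous_intros)
  show ?thesis by measurable
qed

lemma integrable_mult_cis:
  fixes u :: "'a::euclidean_space \<Rightarrow> complex"
  assumes "integrable lborel u"
  shows "integrable lborel (\<lambda>t. u t * cis (t \<bullet> \<xi>))"
proof -
  have [measurable]: "u \<in> borel_measurable borel" using assms by auto
  show ?thesis
    by (rule Bochner_Integration.integrable_bound[OF assms]) (auto simp: norm_mult)
qed

lemma norm_fourier_le: "norm (fourier u \<xi>) \<le> (\<integral>t. norm (u t) \<partial>lborel)"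
  unfolding fourier_def
  by (rule order_trans[OF integral_norm_bound]) (simp add: norm_mult)

lemma continuous_on_fourier:
  fixes u :: "'a::euclidean_space \<Rightarrow> complex"
  assumes u: "integrable lborel u"
  shows "continuous_on UNIV (fourier u)"
proof (rule continuous_on_sequentiallyI)
  fix X and x :: 'a assume X: "X \<longlonglongrightarrow> x"
  have [measurable]: "u \<in> borel_measurable borel" using u by auto
  show "(\<lambda>n. fourier u (X n)) \<longlonglongrightarrow> fourier u x"
    unfolding fourier_def
  proof (rule integral_dominated_convergence[where w="\<lambda>t. norm (u t)"])
    have "continuous_on UNIV cis"
      by (intro continuous_on_cis continuous_intros)
    then have "isCont cis (t \<bullet> x)" for t :: 'a
      by (simp add: continuous_on_eq_continuous_at)
    then show "AE t in lborel. (\<lambda>i. u t * cis (t \<bullet> X i)) \<longlonglongrightarrow> u t * cis (t \<bullet> x)"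
      using X by (intro always_eventually allI tendsto_mult tendsto_const isCont_tendsto_compose[of _ cis] tendsto_inner) auto
  qed (use u in \<open>auto simp: norm_mult\<close>)
qed

lemma measurable_fourier [measurable]:
  fixes u :: "'a::euclidean_space \<Rightarrow> complex"
  assumes "integrable lborel u"
  shows "fourier u \<in> borel_measurable borel"
  by (intro borel_measurable_continuous_onI continuous_on_fourier assms)

lemma fourier_multiplication_formula:
  fixes u v :: "'a::euclidean_space \<Rightarrow> complex"
  assumes u: "integrable lborel u" and v: "integrable lborel v"
  shows "(\<integral>\<xi>. fourier u \<xi> * v \<xi> \<partial>lborel) = (\<integral>t. u t * fourier v t \<partial>lborel)"
proof -
  have [measurable]: "u \<in> borel_measurable borel" "v \<in> borel_measurable borel" using u v by auto
  have "integrable (lborel \<Otimes>\<^sub>M lborel) (\<lambda>(t, \<xi>). u t * v \<xi> * cis (t \<bullet> \<xi>))"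
    by (rule Bochner_Integration.integrable_bound[OF integrable_pair_product[OF integrable_norm[OF u] integrable_norm[OF v]]])
      (auto simp: norm_mult)
  from lborel_pair.Fubini_integral[OF this]
  have "(\<integral>\<xi>. (\<integral>t. u t * v \<xi> * cis (t \<bullet> \<xi>) \<partial>lborel) \<partial>lborel) = (\<integral>t. (\<integral>\<xi>. u t * v \<xi> * cis (t \<bullet> \<xi>) \<partial>lborel) \<partial>lborel)" .
  moreover have "(\<integral>t. u t * v \<xi> * cis (t \<bullet> \<xi>) \<partial>lborel) = fourier u \<xi> * v \<xi>" for \<xi>
    unfolding fourier_def by (subst integral_mult_left_zero[symmetric]) (simp add: ac_simps)
  moreover have "(\<integral>\<xi>. u t * v \<xi> * cis (t \<bullet> \<xi>) \<partial>lborel) = u t * fourier v t" for t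
    unfolding fourier_def by (subst integral_mult_right_zero[symmetric]) (simp add: ac_simps inner_commute)
  ultimately show ?thesis by simp
qed

lemma fourier_modulate: "fourier (\<lambda>t. u t * cis (t \<bullet> \<eta>)) \<xi> = fourier u (\<xi> + \<eta>)"
  unfolding fourier_def by (simp add: inner_add_right cis_mult mult.assoc add.commute)

lemma fourier_affine:
  fixes u :: "'a::euclidean_space \<Rightarrow> complex"
  assumes [measurable]: "u \<in> borel_measurable borel" and c: "c \<noteq> 0"
  shows "fourier u \<xi> = (\<bar>c\<bar> ^ DIM('a)) *\<^sub>R (cis (a \<bullet> \<xi>) * fourier (\<lambda>t. u (a + c *\<^sub>R t)) (c *\<^sub>R \<xi>))"
  unfolding fourier_def
  by (subst lborel_integral_affine[OF _ c, of _ a], simp)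
    (simp add: inner_add_left cis_mult[symmetric] ac_simps flip: integral_mult_right_zero)

lemma fourier_translate:
  fixes u :: "'a::euclidean_space \<Rightarrow> complex"
  assumes [measurable]: "u \<in> borel_measurable borel"
  shows "fourier (\<lambda>t. u (t + a)) \<xi> = cis (- (a \<bullet> \<xi>)) * fourier u \<xi>"
  using fourier_affine[OF assms, of 1 \<xi> a]
  by (simp add: mult.assoc[symmetric] cis_mult add.commute)

section \<open>Decay of transforms of differentiable functions\<close>

text \<open>Differentiability up to order \<open>N\<close> along the lines in one direction \<open>e\<close>, with one function \<open>A\<close>
  majorizing all these derivatives. Integration by parts in direction \<open>e\<close> uses exactly this much,
  and keeping the majorant as a function lets products of a bump with a translated window carry a
  bound that decays in the translation.\<close>

fun Ck_bounded :: "nat \<Rightarrow> 'a::real_normed_vector \<Rightarrow> ('a \<Rightarrow> real) \<Rightarrow> ('a \<Rightarrow> complex) \<Rightarrow> bool" where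
  "Ck_bounded 0 e A u \<longleftrightarrow> continuous_on UNIV u \<and> (\<forall>t. norm (u t) \<le> A t)"
| "Ck_bounded (Suc N) e A u \<longleftrightarrow> continuous_on UNIV u \<and> (\<forall>t. norm (u t) \<le> A t) \<and>
     (\<exists>u'. (\<forall>t r. ((\<lambda>r. u (t + r *\<^sub>R e)) has_vector_derivative u' (t + r *\<^sub>R e)) (at r)) \<and>
           Ck_bounded N e A u')"

lemma Ck_bounded_imp_continuous: "Ck_bounded N e A u \<Longrightarrow> continuous_on UNIV u"
  by (cases N) auto

lemma Ck_bounded_imp_norm_le: "Ck_bounded N e A u \<Longrightarrow> norm (u t) \<le> A t"
  by (cases N) auto

lemma Ck_bounded_mono: "Ck_bounded N e A u \<Longrightarrow> (\<And>t. A t \<le> B t) \<Longrightarrow> Ck_bounded N e B u"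
proof (induction N arbitrary: u)
  case 0
  then show ?case by (auto intro: order_trans)
next
  case (Suc N)
  then show ?case by (simp, blast intro: order_trans)
qed

lemma Ck_bounded_SucD: "Ck_bounded (Suc N) e A u \<Longrightarrow> Ck_bounded N e A u"
proof (induction N arbitrary: u)
  case (Suc N)
  from Suc.prems obtain u' where
    "\<forall>t r. ((\<lambda>r. u (t + r *\<^sub>R e)) has_vector_derivative u' (t + r *\<^sub>R e)) (at r)" "Ck_bounded (Suc N) e A u'"
    by (subst (asm) Ck_bounded.simps) blast
  with Suc show ?case
    by (subst Ck_bounded.simps) (auto simp del: Ck_bounded.simps dest: Ck_bounded_imp_continuous Ck_bounded_imp_norm_le)
qed simp

lemma Ck_bounded_le: "Ck_bounded N e A u \<Longrightarrow> m \<le> N \<Longrightarrow> Ck_bounded m e A u"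
  by (rule inc_induct) (auto dest: Ck_bounded_SucD simp del: Ck_bounded.simps)

lemma Ck_bounded_add:
  "Ck_bounded N e A u \<Longrightarrow> Ck_bounded N e B v \<Longrightarrow> Ck_bounded N e (\<lambda>t. A t + B t) (\<lambda>t. u t + v t)"
proof (induction N arbitrary: u v)
  case 0
  then show ?case
    by (auto intro!: continuous_intros norm_triangle_le add_mono)
next
  case (Suc N)
  from Suc.prems obtain u' v' where
    u: "\<And>t r. ((\<lambda>r. u (t + r *\<^sub>R e)) has_vector_derivative u' (t + r *\<^sub>R e)) (at r)" "Ck_bounded N e A u'" and
    v: "\<And>t r. ((\<lambda>r. v (t + r *\<^sub>R e)) has_vector_derivative v' (t + r *\<^sub>R e)) (at r)" "Ck_bounded N e B v'"
    by auto
  show ?case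
    unfolding Ck_bounded.simps
  proof (intro conjI allI exI[of _ "\<lambda>t. u' t + v' t"])
    show "continuous_on UNIV (\<lambda>t. u t + v t)"
      using Suc.prems by (auto intro!: continuous_intros)
    show "norm (u t + v t) \<le> A t + B t" for t
      using Suc.prems by (auto intro!: norm_triangle_le add_mono)
    show "((\<lambda>r. u (t + r *\<^sub>R e) + v (t + r *\<^sub>R e)) has_vector_derivative u' (t + r *\<^sub>R e) + v' (t + r *\<^sub>R e)) (at r)" for t r
      using u v by (intro has_vector_derivative_add) auto
    show "Ck_bounded N e (\<lambda>t. A t + B t) (\<lambda>t. u' t + v' t)"
      using Suc.IH u v by auto
  qed
qed

text \<open>A product of two functions has \<open>2 ^ N\<close> terms in its \<open>N\<close>-th derivative, each bounded by
  the product of the bounds.\<close>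

lemma Ck_bounded_mult:
  "Ck_bounded N e A u \<Longrightarrow> Ck_bounded N e B v \<Longrightarrow> Ck_bounded N e (\<lambda>t. 2 ^ N * (A t * B t)) (\<lambda>t. u t * v t)"
proof (induction N arbitrary: u v)
  case 0
  then show ?case
    by (auto intro!: continuous_intros mult_mono simp: norm_mult intro: order_trans[OF norm_ge_zero])
next
  case (Suc N)
  from Suc.prems obtain u' v' where
    u: "\<And>t r. ((\<lambda>r. u (t + r *\<^sub>R e)) has_vector_derivative u' (t + r *\<^sub>R e)) (at r)" "Ck_bounded N e A u'" and
    v: "\<And>t r. ((\<lambda>r. v (t + r *\<^sub>R e)) has_vector_derivative v' (t + r *\<^sub>R e)) (at r)" "Ck_bounded N e B v'"
    by auto
  show ?case
    unfolding Ck_bounded.simps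
  proof (intro conjI allI exI[of _ "\<lambda>t. u t * v' t + u' t * v t"])
    show "continuous_on UNIV (\<lambda>t. u t * v t)"
      using Suc.prems by (auto intro!: continuous_intros)
    show "norm (u t * v t) \<le> 2 ^ Suc N * (A t * B t)" for t
    proof -
      have "norm (u t) \<le> A t" "norm (v t) \<le> B t"
        using Suc.prems by auto
      then have "norm (u t * v t) \<le> A t * B t" "0 \<le> A t * B t"
        by (auto simp: norm_mult intro!: mult_mono mult_nonneg_nonneg intro: order_trans[OF norm_ge_zero])
      then show ?thesis
        using mult_right_mono[of 1 "2 ^ Suc N" "A t * B t"] one_le_power[of "2::real" "Suc N"] by simp
    qed
    show "((\<lambda>r. u (t + r *\<^sub>R e) * v (t + r *\<^sub>R e)) has_vector_derivative
        u (t + r *\<^sub>R e) * v' (t + r *\<^sub>R e) + u' (t + r *\<^sub>R e) * v (t + r *\<^sub>R e)) (at r)" for t r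
      using u v by (intro has_vector_derivative_mult) auto
    have "Ck_bounded N e (\<lambda>t. 2 ^ N * (A t * B t) + 2 ^ N * (A t * B t)) (\<lambda>t. u t * v' t + u' t * v t)"
      using Suc.prems by (intro Ck_bounded_add Suc.IH u v) (auto dest: Ck_bounded_SucD simp del: Ck_bounded.simps)
    then show "Ck_bounded N e (\<lambda>t. 2 ^ Suc N * (A t * B t)) (\<lambda>t. u t * v' t + u' t * v t)"
      by (simp add: algebra_simps)
  qed
qed

lemma Ck_bounded_translate:
  "Ck_bounded N e A u \<Longrightarrow> Ck_bounded N e (\<lambda>t. A (t - x)) (\<lambda>t. u (t - x))"
proof (induction N arbitrary: u)
  case 0
  then show ?case
    by (auto intro!: continuous_intros continuous_on_compose2[of UNIV u])
next
  case (Suc N)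
  from Suc.prems obtain u' where
    u: "\<And>t r. ((\<lambda>r. u (t + r *\<^sub>R e)) has_vector_derivative u' (t + r *\<^sub>R e)) (at r)" "Ck_bounded N e A u'"
    by auto
  show ?case
    unfolding Ck_bounded.simps
  proof (intro conjI allI exI[of _ "\<lambda>t. u' (t - x)"])
    show "continuous_on UNIV (\<lambda>t. u (t - x))"
      using Suc.prems by (auto intro!: continuous_intros continuous_on_compose2[of UNIV u])
    show "((\<lambda>r. u (t + r *\<^sub>R e - x)) has_vector_derivative u' (t + r *\<^sub>R e - x)) (at r)" for t r
      using u(1)[of "t - x" r] by (simp add: algebra_simps)
  qed (use Suc.IH Suc.prems u in auto)
qed

lemma Ck_bounded_cnj: "Ck_bounded N e A u \<Longrightarrow> Ck_bounded N e A (\<lambda>t. cnj (u t))"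
proof (induction N arbitrary: u)
  case 0
  then show ?case
    by (auto intro!: continuous_intros)
next
  case (Suc N)
  from Suc.prems obtain u' where
    u: "\<And>t r. ((\<lambda>r. u (t + r *\<^sub>R e)) has_vector_derivative u' (t + r *\<^sub>R e)) (at r)" "Ck_bounded N e A u'"
    by auto
  show ?case
    unfolding Ck_bounded.simps
  proof (intro conjI allI exI[of _ "\<lambda>t. cnj (u' t)"])
    show "continuous_on UNIV (\<lambda>t. cnj (u t))"
      using Suc.prems by (auto intro!: continuous_intros)
    show "((\<lambda>r. cnj (u (t + r *\<^sub>R e))) has_vector_derivative cnj (u' (t + r *\<^sub>R e))) (at r)" for t r
      using u(1)[of t r] by (rule has_vector_derivative_cnj)
  qed (use Suc.IH Suc.prems u in auto)
qed

text \<open>Difference quotients along a sequence, the form in which derivatives meet dominated convergence.\<close>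

lemma has_vector_derivative_quotient_LIMSEQ:
  fixes f :: "real \<Rightarrow> 'a::real_normed_vector"
  assumes "(f has_vector_derivative D) (at 0)"
  shows "(\<lambda>j. real (Suc j) *\<^sub>R (f (inverse (real (Suc j))) - f 0)) \<longlonglongrightarrow> D"
proof -
  have "((\<lambda>h. norm (f (0 + h) - f 0 - h *\<^sub>R D) / norm h) \<longlongrightarrow> 0) (at 0)"
    using assms unfolding has_vector_derivative_def has_derivative_at by auto
  moreover have "filterlim (\<lambda>j. inverse (real (Suc j))) (at 0) sequentially"
    unfolding filterlim_at using LIMSEQ_inverse_real_of_nat by auto
  ultimately have "(\<lambda>j. norm (f (0 + inverse (real (Suc j))) - f 0 - inverse (real (Suc j)) *\<^sub>R D) / norm (inverse (real (Suc j)))) \<longlonglongrightarrow> 0"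
    by (rule filterlim_compose)
  moreover have "norm (f (0 + inverse (real (Suc j))) - f 0 - inverse (real (Suc j)) *\<^sub>R D) / norm (inverse (real (Suc j)))
      = norm (real (Suc j) *\<^sub>R (f (inverse (real (Suc j))) - f 0) - D)" for j
  proof -
    have "real (Suc j) *\<^sub>R (f (inverse (real (Suc j))) - f 0) - D
        = real (Suc j) *\<^sub>R (f (0 + inverse (real (Suc j))) - f 0 - inverse (real (Suc j)) *\<^sub>R D)"
      by (simp add: scaleR_diff_right)
    then show ?thesis by (simp add: divide_inverse mult.commute)
  qed
  ultimately have "(\<lambda>j. norm (real (Suc j) *\<^sub>R (f (inverse (real (Suc j))) - f 0) - D)) \<longlonglongrightarrow> 0"
    by simp
  then show ?thesis
    using Lim_null tendsto_norm_zero_iff by blast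
qed

lemma integrable_weight_bound:
  fixes u :: "'a::euclidean_space \<Rightarrow> complex"
  assumes "continuous_on UNIV u" "\<And>t. norm (u t) \<le> C * weight (- M) t" "2 * real DIM('a) \<le> M"
  shows "integrable lborel u"
proof (rule Bochner_Integration.integrable_bound)
  show "integrable lborel (\<lambda>t::'a. C * weight (- M) t)"
    using assms(3) by (intro integrable_mult_right integrable_weight) auto
  show "u \<in> borel_measurable lborel"
    using borel_measurable_continuous_onI[OF assms(1)] by simp
  show "AE t in lborel. norm (u t) \<le> norm (C * weight (- M) t)"
    using order_trans[OF assms(2) abs_ge_self] by simp
qed

text \<open>Integration by parts, carried out on difference quotients: translating \<open>u\<close> multiplies its
  transform by a unimodular factor, and the quotients converge dominatedly because \<open>weight (- M)\<close>
  varies by a bounded factor over distances at most one.\<close>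

lemma fourier_derivative:
  fixes u u' :: "'a::euclidean_space \<Rightarrow> complex"
  assumes u: "continuous_on UNIV u" "\<And>t. norm (u t) \<le> C * weight (- M) t"
    and u': "continuous_on UNIV u'" "\<And>t. norm (u' t) \<le> C * weight (- M) t"
    and der: "\<And>t r. ((\<lambda>r. u (t + r *\<^sub>R e)) has_vector_derivative u' (t + r *\<^sub>R e)) (at r)"
    and M: "2 * real DIM('a) \<le> M" and e: "norm e \<le> 1"
  shows "fourier u' \<xi> = - (\<i> * complex_of_real (e \<bullet> \<xi>)) * fourier u \<xi>"
proof -
  have iu: "integrable lborel u" and iu': "integrable lborel u'"
    using integrable_weight_bound u u' M by blast+
  then have [measurable]: "u \<in> borel_measurable borel" "u' \<in> borel_measurable borel" by auto
  have C: "0 \<le> C"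
    using order_trans[OF norm_ge_zero u(2)[of 0]] by (simp add: zero_le_mult_iff weight_def)
  define r where "r j = inverse (real (Suc j))" for j
  define s where "s j t = real (Suc j) *\<^sub>R (u (t + r j *\<^sub>R e) - u t) * cis (t \<bullet> \<xi>)" for j t
  have r: "0 < r j" "r j \<le> 1" "real (Suc j) * r j = 1" for j
    by (auto simp: r_def field_simps)
  have bound: "norm (s j t) \<le> C * (weight M (1::real) * weight (- M) t)" for j t
  proof -
    have "norm ((\<lambda>\<sigma>. u (t + \<sigma> *\<^sub>R e)) (r j) - (\<lambda>\<sigma>. u (t + \<sigma> *\<^sub>R e)) 0) \<le> (C * (weight M (1::real) * weight (- M) t)) * norm (r j - 0)"
    proof (rule differentiable_bound[of "{0..r j}"])
      fix \<sigma> assume \<sigma>: "\<sigma> \<in> {0..r j}"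
      show "((\<lambda>\<sigma>. u (t + \<sigma> *\<^sub>R e)) has_derivative (\<lambda>h. h *\<^sub>R u' (t + \<sigma> *\<^sub>R e))) (at \<sigma> within {0..r j})"
        using der[of t \<sigma>] unfolding has_vector_derivative_def by (rule has_derivative_at_withinI)
      have "norm (\<sigma> *\<^sub>R e) \<le> norm (1::real)"
        using \<sigma> r[of j] e by (auto intro!: mult_le_one)
      then have "weight M (\<sigma> *\<^sub>R e) \<le> weight M (1::real)"
        unfolding weight_def using M by (intro powr_mono2) auto
      then have "weight (- M) (t + \<sigma> *\<^sub>R e) \<le> weight M (1::real) * weight (- M) t"
        using weight_neg_add[of M t "\<sigma> *\<^sub>R e"] M by (meson order_trans mult_right_mono weight_nonneg of_nat_0_le_iff mult_nonneg_nonneg zero_le_numeral)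
      then have "norm (u' (t + \<sigma> *\<^sub>R e)) \<le> C * (weight M (1::real) * weight (- M) t)"
        using u'(2)[of "t + \<sigma> *\<^sub>R e"] C by (meson order_trans mult_left_mono)
      then show "onorm (\<lambda>h. h *\<^sub>R u' (t + \<sigma> *\<^sub>R e)) \<le> C * (weight M (1::real) * weight (- M) t)"
        by (intro onorm_le) (simp add: mult.commute mult_left_mono)
    qed (use r[of j] in auto)
    then have "real (Suc j) * norm (u (t + r j *\<^sub>R e) - u t) \<le> real (Suc j) * (C * (weight M (1::real) * weight (- M) t) * r j)"
      using r[of j] by (intro mult_left_mono) auto
    also have "\<dots> = (real (Suc j) * r j) * (C * (weight M (1::real) * weight (- M) t))"
      by (simp only: ac_simps)
    finally show ?thesis
      unfolding s_def r(3) by (simp add: norm_mult)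
  qed
  have lim1: "(\<lambda>j. integral\<^sup>L lborel (s j)) \<longlonglongrightarrow> (\<integral>t. u' t * cis (t \<bullet> \<xi>) \<partial>lborel)"
  proof (rule integral_dominated_convergence[where w="\<lambda>t. C * (weight M (1::real) * weight (- M) t)"])
    show "integrable lborel (\<lambda>t::'a. C * (weight M (1::real) * weight (- M) t))"
      using M by (intro integrable_mult_right integrable_weight) auto
    show "AE t in lborel. (\<lambda>j. s j t) \<longlonglongrightarrow> u' t * cis (t \<bullet> \<xi>)"
    proof (intro always_eventually allI)
      fix t
      show "(\<lambda>j. s j t) \<longlonglongrightarrow> u' t * cis (t \<bullet> \<xi>)"
        unfolding s_def r_def
        using has_vector_derivative_quotient_LIMSEQ[OF der[of t 0, simplified]]
        by (intro tendsto_mult tendsto_const) simp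
    qed
    show "s j \<in> borel_measurable lborel" for j unfolding s_def by measurable
  qed (use bound in auto)
  have eq: "integral\<^sup>L lborel (s j) = real (Suc j) *\<^sub>R (cis (- (e \<bullet> \<xi>) * r j) - cis (- (e \<bullet> \<xi>) * 0)) * fourier u \<xi>" for j
  proof -
    have i: "integrable lborel (\<lambda>t. u (t + r j *\<^sub>R e))"
      using lborel_integrable_translate[OF iu, of "- (r j *\<^sub>R e)"] by simp
    have "integral\<^sup>L lborel (s j) = (\<integral>t. real (Suc j) *\<^sub>R (u (t + r j *\<^sub>R e) * cis (t \<bullet> \<xi>) - u t * cis (t \<bullet> \<xi>)) \<partial>lborel)"
      unfolding s_def by (simp add: algebra_simps)
    also have "\<dots> = real (Suc j) *\<^sub>R (fourier (\<lambda>t. u (t + r j *\<^sub>R e)) \<xi> - fourier u \<xi>)"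
      unfolding fourier_def using integrable_mult_cis[OF i] integrable_mult_cis[OF iu] by simp
    also have "\<dots> = real (Suc j) *\<^sub>R (cis (- (e \<bullet> \<xi>) * r j) - cis (- (e \<bullet> \<xi>) * 0)) * fourier u \<xi>"
      by (subst fourier_translate) (simp_all add: algebra_simps)
    finally show ?thesis .
  qed
  have lim2: "(\<lambda>j. real (Suc j) *\<^sub>R (cis (- (e \<bullet> \<xi>) * r j) - cis (- (e \<bullet> \<xi>) * 0)) * fourier u \<xi>)
      \<longlonglongrightarrow> - (\<i> * complex_of_real (e \<bullet> \<xi>)) * fourier u \<xi>"
  proof (intro tendsto_mult tendsto_const)
    have "((\<lambda>x. cis (- (e \<bullet> \<xi>) * x)) has_vector_derivative - (\<i> * complex_of_real (e \<bullet> \<xi>))) (at 0)"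
    proof -
      define k where "k = \<i> * complex_of_real (e \<bullet> \<xi>)"
      have "((\<lambda>z. exp (- k * z)) has_field_derivative exp (- k * of_real 0) * (- k * 1)) (at (of_real 0))"
        by (intro DERIV_fun_exp DERIV_cmult DERIV_ident)
      from has_vector_derivative_real_field[OF this, of UNIV]
      have "((\<lambda>x. exp (- k * complex_of_real x)) has_vector_derivative - k) (at 0)"
        by simp
      moreover have "exp (- k * complex_of_real x) = cis (- (e \<bullet> \<xi>) * x)" for x
        by (simp add: cis_conv_exp k_def mult.assoc)
      ultimately show ?thesis
        by (simp only: k_def)
    qed
    from has_vector_derivative_quotient_LIMSEQ[OF this]
    show "(\<lambda>j. real (Suc j) *\<^sub>R (cis (- (e \<bullet> \<xi>) * r j) - cis (- (e \<bullet> \<xi>) * 0))) \<longlonglongrightarrow> - (\<i> * complex_of_real (e \<bullet> \<xi>))"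
      unfolding r_def .
  qed
  show ?thesis
    using LIMSEQ_unique[OF lim1[unfolded eq] lim2] by (simp add: fourier_def)
qed

lemma fourier_Ck_bounded_direction:
  fixes u :: "'a::euclidean_space \<Rightarrow> complex"
  assumes "Ck_bounded N e (\<lambda>t. C * weight (- M) t) u" and M: "2 * real DIM('a) \<le> M" and e: "norm e \<le> 1"
  shows "\<bar>e \<bullet> \<xi>\<bar> ^ N * norm (fourier u \<xi>) \<le> C * (\<integral>(t::'a). weight (- M) t \<partial>lborel)"
  using assms(1)
proof (induction N arbitrary: u)
  case 0
  have "norm (fourier u \<xi>) \<le> (\<integral>t. norm (u t) \<partial>lborel)"
    by (rule norm_fourier_le)
  also have "\<dots> \<le> (\<integral>(t::'a). C * weight (- M) t \<partial>lborel)"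
    using 0 M integrable_weight_bound[of u C M]
    by (intro integral_mono integrable_mult_right integrable_weight integrable_norm) auto
  finally show ?case using M by simp
next
  case (Suc N)
  from Suc.prems obtain u' where
    u: "\<And>t r. ((\<lambda>r. u (t + r *\<^sub>R e)) has_vector_derivative u' (t + r *\<^sub>R e)) (at r)"
      "Ck_bounded N e (\<lambda>t. C * weight (- M) t) u'"
    by auto
  have "fourier u' \<xi> = - (\<i> * complex_of_real (e \<bullet> \<xi>)) * fourier u \<xi>"
    using Suc.prems Ck_bounded_imp_continuous[OF u(2)] Ck_bounded_imp_norm_le[OF u(2)] u(1) M e
    by (intro fourier_derivative[where C=C and M=M]) auto
  then have "\<bar>e \<bullet> \<xi>\<bar> ^ Suc N * norm (fourier u \<xi>) = \<bar>e \<bullet> \<xi>\<bar> ^ N * norm (fourier u' \<xi>)"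
    by (simp add: norm_mult)
  then show ?case using Suc.IH[OF u(2)] by (simp only:)
qed

text \<open>Every \<open>\<xi>\<close> has a coordinate of size at least \<open>norm \<xi> / DIM('a)\<close>, and integrating by parts in that
  direction only gives the full decay. If that coordinate is below one, \<open>\<xi>\<close> is bounded and the
  trivial bound does.\<close>

lemma fourier_Ck_bounded_decay:
  fixes u :: "'a::euclidean_space \<Rightarrow> complex"
  assumes u: "\<And>e. e \<in> Basis \<Longrightarrow> Ck_bounded N e (\<lambda>t. C * weight (- M) t) u" and M: "2 * real DIM('a) \<le> M"
  shows "norm (fourier u \<xi>) \<le> (real DIM('a) + 1) ^ N * (C * (\<integral>(t::'a). weight (- M) t \<partial>lborel)) * weight (- real N) \<xi>"
proof -
  let ?n = "real DIM('a)" and ?I = "C * (\<integral>(t::'a). weight (- M) t \<partial>lborel)"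
  define m where "m = Max ((\<lambda>e. \<bar>e \<bullet> \<xi>\<bar>) ` (Basis :: 'a set))"
  have "m \<in> (\<lambda>e. \<bar>e \<bullet> \<xi>\<bar>) ` (Basis :: 'a set)"
    unfolding m_def by (rule Max_in) auto
  then obtain e :: 'a where e: "e \<in> Basis" "m = \<bar>e \<bullet> \<xi>\<bar>" by auto
  have "norm \<xi> \<le> (\<Sum>b\<in>Basis. \<bar>\<xi> \<bullet> b\<bar>)" by (rule norm_le_l1)
  also have "\<dots> \<le> (\<Sum>b\<in>(Basis::'a set). m)"
    unfolding m_def by (intro sum_mono Max_ge) (auto simp: inner_commute)
  finally have "norm \<xi> \<le> ?n * m" by simp
  moreover have "?n * m \<le> ?n * max 1 m" "1 \<le> max 1 m"
    by (auto intro: mult_left_mono)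
  ultimately have le: "1 + norm \<xi> \<le> (?n + 1) * max 1 m"
    unfolding distrib_right by linarith
  have "(1 + norm \<xi>) ^ N * norm (fourier u \<xi>) \<le> ((?n + 1) * max 1 m) ^ N * norm (fourier u \<xi>)"
    using le by (intro mult_right_mono power_mono) auto
  also have "\<dots> = (?n + 1) ^ N * ((max 1 m) ^ N * norm (fourier u \<xi>))"
    by (simp add: power_mult_distrib)
  also have "\<dots> \<le> (?n + 1) ^ N * ?I"
  proof (intro mult_left_mono)
    show "max 1 m ^ N * norm (fourier u \<xi>) \<le> ?I"
    proof (cases "1 \<le> m")
      case True
      then show ?thesis
        using fourier_Ck_bounded_direction[OF u[OF e(1)] M, of \<xi>] e by (simp add: max_def)
    next
      case False
      then show ?thesis
        using fourier_Ck_bounded_direction[OF Ck_bounded_le[OF u[OF e(1)], of 0] M, of \<xi>] e by (simp add: max_def)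
    qed
  qed auto
  finally have "weight (real N) \<xi> * norm (fourier u \<xi>) \<le> (?n + 1) ^ N * ?I"
    by (simp add: weight_def powr_realpow)
  then have "weight (- real N) \<xi> * (weight (real N) \<xi> * norm (fourier u \<xi>)) \<le> weight (- real N) \<xi> * ((?n + 1) ^ N * ?I)"
    by (intro mult_left_mono) auto
  then show ?thesis
    by (simp add: mult.assoc[symmetric]) (simp add: ac_simps)
qed

section \<open>A bump function\<close>

lemma real_polynomial_function_directional_derivative:
  fixes p :: "'a::real_normed_vector \<Rightarrow> real"
  assumes "real_polynomial_function p"
  shows "\<exists>p'. real_polynomial_function p' \<and>
    (\<forall>t r. ((\<lambda>r. p (t + r *\<^sub>R e)) has_real_derivative p' (t + r *\<^sub>R e)) (at r))"
  using assms
proof induction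
  case (linear f)
  have "((\<lambda>r. f (t + r *\<^sub>R e)) has_real_derivative f e) (at r)" for t r
  proof -
    have "f (t + r *\<^sub>R e) = f t + r * f e" for r
      using linear by (simp add: linear_simps)
    then show ?thesis by (auto intro!: derivative_eq_intros)
  qed
  then show ?case by (intro exI[of _ "\<lambda>_. f e"]) auto
next
  case (const c)
  show ?case by (intro exI[of _ "\<lambda>_. 0"]) auto
next
  case (add f g)
  then obtain f' g' where "real_polynomial_function f'" "real_polynomial_function g'"
    "\<And>t r. ((\<lambda>r. f (t + r *\<^sub>R e)) has_real_derivative f' (t + r *\<^sub>R e)) (at r)"
    "\<And>t r. ((\<lambda>r. g (t + r *\<^sub>R e)) has_real_derivative g' (t + r *\<^sub>R e)) (at r)" by blast
  then show ?case
    by (intro exI[of _ "\<lambda>t. f' t + g' t"]) (auto intro!: derivative_eq_intros)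
next
  case (mult f g)
  then obtain f' g' where "real_polynomial_function f'" "real_polynomial_function g'"
    "\<And>t r. ((\<lambda>r. f (t + r *\<^sub>R e)) has_real_derivative f' (t + r *\<^sub>R e)) (at r)"
    "\<And>t r. ((\<lambda>r. g (t + r *\<^sub>R e)) has_real_derivative g' (t + r *\<^sub>R e)) (at r)" by blast
  with mult.hyps show ?case
    by (intro exI[of _ "\<lambda>t. f' t * g t + g' t * f t"])
      (auto intro!: derivative_eq_intros real_polynomial_function.intros(3,4))
qed

lemma has_real_derivative_max_power:
  "((\<lambda>y::real. max 0 y ^ Suc (Suc n)) has_real_derivative real (Suc (Suc n)) * max 0 y ^ Suc n) (at y)"
proof -
  consider "y > 0" | "y < 0" | "y = 0" by linarith
  then show ?thesis
  proof cases
    case 1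
    have "((\<lambda>y. y ^ Suc (Suc n)) has_real_derivative real (Suc (Suc n)) * max 0 y ^ Suc n) (at y)"
      using 1 DERIV_pow[of "Suc (Suc n)" y] by simp
    then show ?thesis
      by (rule has_field_derivative_transform_within_open[of _ _ _ "{0<..}"]) (use 1 in auto)
  next
    case 2
    have "((\<lambda>y. 0) has_real_derivative real (Suc (Suc n)) * max 0 y ^ Suc n) (at y)"
      using 2 by simp
    then show ?thesis
      by (rule has_field_derivative_transform_within_open[of _ _ _ "{..<0}"]) (use 2 in auto)
  next
    case 3
    have le: "norm (max 0 h ^ Suc (Suc n) / h) \<le> \<bar>h\<bar>" if "\<bar>h\<bar> < 1" for h :: real
    proof (cases "0 < h")
      case True
      then have "max 0 h ^ Suc (Suc n) / h = h ^ Suc n" by simp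
      moreover have "h ^ Suc n \<le> h ^ 1"
        using True that by (intro power_decreasing) auto
      ultimately show ?thesis using True by simp
    qed auto
    have "((\<lambda>h::real. max 0 h ^ Suc (Suc n) / h) \<longlongrightarrow> 0) (at 0)"
    proof (rule Lim_null_comparison)
      show "\<forall>\<^sub>F h in at (0::real). norm (max 0 h ^ Suc (Suc n) / h) \<le> \<bar>h\<bar>"
        unfolding eventually_at using le by (intro exI[of _ 1]) auto
      show "(abs \<longlongrightarrow> (0::real)) (at 0)"
        by (rule tendsto_eq_intros | simp)+
    qed
    then show ?thesis using 3 by (simp add: DERIV_def)
  qed
qed

lemma compact_support_weight_bound:
  fixes g :: "'a::euclidean_space \<Rightarrow> 'b::real_normed_vector"
  assumes "continuous_on UNIV g" "\<And>x. norm x > R \<Longrightarrow> g x = 0"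
  shows "\<exists>C. \<forall>x. norm (g x) \<le> C * weight a x"
proof -
  have "compact ((\<lambda>x. weight (- a) x * norm (g x)) ` cball 0 R)"
    using continuous_on_subset[OF assms(1)] by (intro compact_continuous_image continuous_intros) auto
  then have "bounded ((\<lambda>x. weight (- a) x * norm (g x)) ` cball 0 R)"
    by (rule compact_imp_bounded)
  then obtain C where C: "0 < C" "\<And>x. x \<in> cball 0 R \<Longrightarrow> norm (weight (- a) x * norm (g x)) \<le> C"
    by (auto simp: bounded_pos)
  have "norm (g x) \<le> C * weight a x" for x
  proof (cases "norm x \<le> R")
    case True
    then have "weight a x * (weight (- a) x * norm (g x)) \<le> weight a x * C"
      using C(2)[of x] by (intro mult_left_mono) auto
    then show ?thesis by (simp add: mult.assoc[symmetric]) (simp add: mult.commute)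
  qed (use assms C in auto)
  then show ?thesis by blast
qed

lemma continuous_on_real_polynomial_function:
  "real_polynomial_function p \<Longrightarrow> continuous_on A p"
  by (meson continuous_at_imp_continuous_on continuous_real_polymonial_function)

text \<open>The functions \<open>p \<cdot> max 0 q ^ m\<close> with polynomial \<open>p\<close> are closed under directional derivatives at the
  cost of one power, because \<open>max 0 q ^ Suc m = q \<cdot> max 0 q ^ m\<close> lets the new polynomial factor absorb
  the remainder. Boundedness of the derivatives is then automatic from the compact support.\<close>

lemma Ck_bounded_truncated_polynomial:
  fixes p q :: "'a::euclidean_space \<Rightarrow> real"
  assumes "real_polynomial_function p" and q: "real_polynomial_function q" "\<And>x. norm x > R \<Longrightarrow> q x \<le> 0"
  shows "\<exists>C. Ck_bounded N e (\<lambda>t. C * weight (- M) t) (\<lambda>x. of_real (p x * max 0 (q x) ^ Suc N))"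
  using assms(1)
proof (induction N arbitrary: p)
  case 0
  have c: "continuous_on UNIV (\<lambda>x. complex_of_real (p x * max 0 (q x) ^ Suc 0))"
    using 0 q by (intro continuous_intros continuous_on_real_polynomial_function)
  have z: "complex_of_real (p x * max 0 (q x) ^ Suc 0) = 0" if "norm x > R" for x
    using q(2)[OF that] by (simp add: max_absorb1)
  from compact_support_weight_bound[OF c z, where a="- M"] obtain C where
    "\<forall>x. norm (complex_of_real (p x * max 0 (q x) ^ Suc 0)) \<le> C * weight (- M) x"
    by blast
  with c show ?case by (intro exI[of _ C]) simp
next
  case (Suc N)
  obtain p' where p': "real_polynomial_function p'"
    "\<And>t r. ((\<lambda>r. p (t + r *\<^sub>R e)) has_real_derivative p' (t + r *\<^sub>R e)) (at r)"
    using real_polynomial_function_directional_derivative[OF Suc.prems, of e] by blast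
  obtain q' where q': "real_polynomial_function q'"
    "\<And>t r. ((\<lambda>r. q (t + r *\<^sub>R e)) has_real_derivative q' (t + r *\<^sub>R e)) (at r)"
    using real_polynomial_function_directional_derivative[OF q(1), of e] by blast
  let ?m = "\<lambda>x. max 0 (q x)"
  \<comment> \<open>The polynomial factor left after extracting \<open>max 0 q ^ Suc N\<close> from the derivative.\<close>
  define p2 where "p2 x = p' x * q x + real (Suc (Suc N)) * p x * q' x" for x
  have "real_polynomial_function p2"
    unfolding p2_def using p' q' Suc.prems q by (intro real_polynomial_function.intros(2-4))
  from Suc.IH[OF this] obtain C1 where
    C1: "Ck_bounded N e (\<lambda>t. C1 * weight (- M) t) (\<lambda>x. of_real (p2 x * ?m x ^ Suc N))" by blast
  have c: "continuous_on UNIV (\<lambda>x. complex_of_real (p x * ?m x ^ Suc (Suc N)))"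
    using Suc.prems q by (intro continuous_intros continuous_on_real_polynomial_function)
  have z: "complex_of_real (p x * max 0 (q x) ^ Suc (Suc N)) = 0" if "norm x > R" for x
    using q(2)[OF that] by (simp add: max_absorb1)
  from compact_support_weight_bound[OF c z, where a="- M"] obtain C2 where
    C2: "\<And>x. norm (complex_of_real (p x * ?m x ^ Suc (Suc N))) \<le> C2 * weight (- M) x"
    by blast
  have der: "((\<lambda>r. complex_of_real (p (t + r *\<^sub>R e) * ?m (t + r *\<^sub>R e) ^ Suc (Suc N))) has_vector_derivative
      complex_of_real (p2 (t + r *\<^sub>R e) * ?m (t + r *\<^sub>R e) ^ Suc N)) (at r)" for t r
  proof -
    let ?x = "t + r *\<^sub>R e"
    have "((\<lambda>r. ?m (t + r *\<^sub>R e) ^ Suc (Suc N)) has_real_derivative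
        (real (Suc (Suc N)) * ?m ?x ^ Suc N) * q' ?x) (at r)"
      by (rule DERIV_chain2[OF has_real_derivative_max_power q'(2)])
    from DERIV_mult[OF p'(2) this]
    have "((\<lambda>r. p (t + r *\<^sub>R e) * ?m (t + r *\<^sub>R e) ^ Suc (Suc N)) has_real_derivative
        p' ?x * ?m ?x ^ Suc (Suc N) + (real (Suc (Suc N)) * ?m ?x ^ Suc N) * q' ?x * p ?x) (at r)" .
    moreover have "?m ?x ^ Suc (Suc N) = q ?x * ?m ?x ^ Suc N"
      by (auto simp: max_def)
    ultimately have "((\<lambda>r. p (t + r *\<^sub>R e) * ?m (t + r *\<^sub>R e) ^ Suc (Suc N)) has_real_derivative
        p2 ?x * ?m ?x ^ Suc N) (at r)"
      unfolding p2_def by (simp only: algebra_simps)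
    then show ?thesis
      by (intro has_vector_derivative_of_real) (simp add: has_real_derivative_iff_has_vector_derivative)
  qed
  have "Ck_bounded (Suc N) e (\<lambda>t. max C1 C2 * weight (- M) t) (\<lambda>x. of_real (p x * ?m x ^ Suc (Suc N)))"
    unfolding Ck_bounded.simps
  proof (intro conjI allI exI[of _ "\<lambda>x. complex_of_real (p2 x * ?m x ^ Suc N)"])
    show "Ck_bounded N e (\<lambda>t. max C1 C2 * weight (- M) t) (\<lambda>x. complex_of_real (p2 x * ?m x ^ Suc N))"
      by (rule Ck_bounded_mono[OF C1]) (auto intro: mult_right_mono)
    show "norm (complex_of_real (p x * ?m x ^ Suc (Suc N))) \<le> max C1 C2 * weight (- M) x" for x
      by (rule order_trans[OF C2]) (auto intro: mult_right_mono)
  qed (use c der in auto)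
  then show ?case by blast
qed

text \<open>The normalized antiderivative of a power of the positive part of \<open>y (1 - y)\<close>, which vanishes
  outside the unit interval.\<close>

lemma ex_smoothstep:
  "\<exists>S::real \<Rightarrow> real. \<exists>k. (\<forall>y. (S has_real_derivative k * max 0 (y * (1 - y)) ^ Suc N) (at y)) \<and>
     (\<forall>y\<le>0. S y = 0) \<and> (\<forall>y\<ge>1. S y = 1) \<and> (\<forall>y. 0 \<le> S y)"
proof -
  define g where "g y = max 0 (y * (1 - y)) ^ Suc N" for y :: real
  have "\<exists>G. \<forall>y::real. -\<infinity> < ereal y \<longrightarrow> ereal y < \<infinity> \<longrightarrow> (G has_vector_derivative g y) (at y)"
    unfolding g_def by (rule einterval_antiderivative) (auto intro!: continuous_intros)
  then obtain G where G: "\<And>y. (G has_real_derivative g y) (at y)"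
    by (auto simp: has_real_derivative_iff_has_vector_derivative)
  have g0: "0 \<le> g y" for y unfolding g_def by auto
  have mono: "G x \<le> G y" if "x \<le> y" for x y
    using that g0 G by (intro DERIV_nonneg_imp_nondecreasing[of x y G]) auto
  have le0: "G y = G 0" if "y \<le> 0" for y
  proof (cases "y < 0")
    case True
    from MVT2[OF this G] obtain z where "y < z" "z < 0" "G 0 - G y = (0 - y) * g z" by auto
    moreover from this have "z * (1 - z) \<le> 0" by (simp add: mult_nonpos_nonneg)
    ultimately show ?thesis by (simp add: g_def max_def)
  qed (use that in auto)
  have ge1: "G y = G 1" if "y \<ge> 1" for y
  proof (cases "y > 1")
    case True
    from MVT2[OF this G] obtain z where "1 < z" "z < y" "G y - G 1 = (y - 1) * g z" by auto
    moreover from this have "z * (1 - z) \<le> 0" by (simp add: mult_nonneg_nonpos)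
    ultimately show ?thesis by (simp add: g_def max_def)
  qed (use that in auto)
  have pos: "G 0 < G 1"
  proof -
    from MVT2[OF zero_less_one G] obtain z where "0 < z" "z < 1" "G 1 - G 0 = (1 - 0) * g z" by auto
    moreover from this have "0 < g z" unfolding g_def by (intro zero_less_power) (simp add: max_def)
    ultimately show ?thesis by simp
  qed
  show ?thesis
  proof (intro exI conjI allI impI)
    let ?S = "\<lambda>y. inverse (G 1 - G 0) * (G y - G 0)"
    show "(?S has_real_derivative inverse (G 1 - G 0) * max 0 (y * (1 - y)) ^ Suc N) (at y)" for y
      using G[of y] unfolding g_def by (auto intro!: derivative_eq_intros)
    show "?S y = 0" if "y \<le> 0" for y using le0[OF that] by simp
    show "?S y = 1" if "y \<ge> 1" for y using ge1[OF that] pos by simp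
    show "0 \<le> ?S y" for y
      using mono[of 0 y] le0[of y] pos by (cases "0 \<le> y") auto
  qed
qed

text \<open>The smooth step composed with \<open>2 - (norm x / R)\<^sup>2\<close>; its first derivative is a truncated polynomial,
  to which the preceding closure property applies. Finite smoothness of arbitrary order is all that
  decay of the transform to a prescribed order calls for.\<close>

lemma ex_bump:
  assumes R: "0 < R"
  shows "\<exists>(\<beta> :: 'a::euclidean_space \<Rightarrow> real) C. (\<forall>e. Ck_bounded N e (\<lambda>t. C e * weight (- M) t) (\<lambda>x. of_real (\<beta> x))) \<and>
     (\<forall>x. norm x \<le> R \<longrightarrow> \<beta> x = 1) \<and> (\<forall>x. 2 * R \<le> norm x \<longrightarrow> \<beta> x = 0) \<and>
     (\<forall>x. \<beta> (- x) = \<beta> x) \<and> (\<forall>x. 0 \<le> \<beta> x)"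
proof -
  obtain S :: "real \<Rightarrow> real" and k where
    S: "\<And>y. (S has_real_derivative k * max 0 (y * (1 - y)) ^ Suc N) (at y)"
      "\<And>y. y \<le> 0 \<Longrightarrow> S y = 0" "\<And>y. y \<ge> 1 \<Longrightarrow> S y = 1" "\<And>y. 0 \<le> S y"
    using ex_smoothstep[of N] by blast
  define y :: "'a \<Rightarrow> real" where "y x = 2 + (- inverse (R\<^sup>2)) * (\<Sum>b\<in>Basis. (x \<bullet> b) * (x \<bullet> b))" for x
  have y_norm: "y x = 2 - (norm x / R)\<^sup>2" for x
    unfolding y_def by (simp add: power_divide power2_norm_eq_inner euclidean_inner[of x x]) (simp add: divide_inverse mult.commute)
  have y: "real_polynomial_function y"
    unfolding y_def
    by (intro real_polynomial_function.intros(2-4) real_polynomial_function_sum real_polynomial_function.intros(1) bounded_linear_inner_left) auto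
  define q where "q x = y x * (1 + (-1) * y x)" for x
  have q: "real_polynomial_function q"
    unfolding q_def by (intro real_polynomial_function.intros(2-4) y)
  have far: "y x \<le> 0" if "2 * R \<le> norm x" for x
    using that R power_mono[of 2 "norm x / R" 2] by (simp add: y_norm pos_le_divide_eq)
  have near: "1 \<le> y x" if "norm x \<le> R" for x
    using that R power_mono[of "norm x / R" 1 2] by (simp add: y_norm)
  have q_far: "q x \<le> 0" if "norm x > 2 * R" for x
    using far[of x] that unfolding q_def by (intro mult_nonpos_nonneg) auto
  define \<beta> where "\<beta> x = S (y x)" for x
  have "\<exists>C. Ck_bounded N e (\<lambda>t. C * weight (- M) t) (\<lambda>x. of_real (\<beta> x))" for e
  proof -
    obtain y' where y': "real_polynomial_function y'"
      "\<And>t r. ((\<lambda>r. y (t + r *\<^sub>R e)) has_real_derivative y' (t + r *\<^sub>R e)) (at r)"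
      using real_polynomial_function_directional_derivative[OF y, of e] by blast
    have "real_polynomial_function (\<lambda>x. k * y' x)"
      by (intro real_polynomial_function.intros(2-4) y')
    from Ck_bounded_truncated_polynomial[OF this q q_far, where N=N and e=e and M=M] obtain C1 where
      C1: "Ck_bounded N e (\<lambda>t. C1 * weight (- M) t) (\<lambda>x. of_real ((k * y' x) * max 0 (q x) ^ Suc N))" by blast
    have S_cont: "continuous_on UNIV S"
      using S(1) by (meson DERIV_isCont continuous_at_imp_continuous_on)
    have c: "continuous_on UNIV (\<lambda>x. complex_of_real (\<beta> x))"
      unfolding \<beta>_def
      by (intro continuous_intros continuous_on_compose2[OF S_cont] continuous_on_real_polynomial_function y) auto
    have z: "complex_of_real (\<beta> x) = 0" if "norm x > 2 * R" for x
      using far[of x] that S(2) by (simp add: \<beta>_def)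
    from compact_support_weight_bound[OF c z, where a="- M"] obtain C2 where
      C2: "\<And>x. norm (complex_of_real (\<beta> x)) \<le> C2 * weight (- M) x"
      by blast
    have der: "((\<lambda>r. complex_of_real (\<beta> (t + r *\<^sub>R e))) has_vector_derivative
        complex_of_real ((k * y' (t + r *\<^sub>R e)) * max 0 (q (t + r *\<^sub>R e)) ^ Suc N)) (at r)" for t r
    proof -
      have "((\<lambda>r. \<beta> (t + r *\<^sub>R e)) has_real_derivative
          (k * max 0 (y (t + r *\<^sub>R e) * (1 - y (t + r *\<^sub>R e))) ^ Suc N) * y' (t + r *\<^sub>R e)) (at r)"
        unfolding \<beta>_def by (rule DERIV_chain2[OF S(1) y'(2)])
      then have "((\<lambda>r. \<beta> (t + r *\<^sub>R e)) has_real_derivative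
          (k * y' (t + r *\<^sub>R e)) * max 0 (q (t + r *\<^sub>R e)) ^ Suc N) (at r)"
        by (simp add: q_def algebra_simps)
      then show ?thesis
        by (intro has_vector_derivative_of_real) (simp add: has_real_derivative_iff_has_vector_derivative)
    qed
    have "Ck_bounded (Suc N) e (\<lambda>t. max C1 C2 * weight (- M) t) (\<lambda>x. of_real (\<beta> x))"
      unfolding Ck_bounded.simps
    proof (intro conjI allI exI[of _ "\<lambda>x. complex_of_real ((k * y' x) * max 0 (q x) ^ Suc N)"])
      show "Ck_bounded N e (\<lambda>t. max C1 C2 * weight (- M) t) (\<lambda>x. complex_of_real ((k * y' x) * max 0 (q x) ^ Suc N))"
        by (rule Ck_bounded_mono[OF C1]) (auto intro: mult_right_mono)
      show "norm (complex_of_real (\<beta> x)) \<le> max C1 C2 * weight (- M) x" for x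
        by (rule order_trans[OF C2]) (auto intro: mult_right_mono)
    qed (use c der in auto)
    then show ?thesis by (blast dest: Ck_bounded_SucD)
  qed
  then obtain C where "\<And>e. Ck_bounded N e (\<lambda>t. C e * weight (- M) t) (\<lambda>x. of_real (\<beta> x))"
    by metis
  moreover have "\<beta> x = 1" if "norm x \<le> R" for x
    using near[OF that] S(3) by (simp add: \<beta>_def)
  moreover have "\<beta> x = 0" if "2 * R \<le> norm x" for x
    using far[OF that] S(2) by (simp add: \<beta>_def)
  moreover have "\<beta> (- x) = \<beta> x" "0 \<le> \<beta> x" for x
    using S(4) by (simp_all add: \<beta>_def y_norm)
  ultimately show ?thesis by (intro exI[of _ \<beta>] exI[of _ C]) blast
qed

section \<open>Fourier inversion\<close>

lemma AE_lborel_meets_open: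
  fixes S :: "'a::euclidean_space set"
  assumes P: "AE x in lborel. P x" and S: "open S" "S \<noteq> {}"
  shows "\<exists>x\<in>S. P x"
proof (rule ccontr)
  assume no: "\<not> ?thesis"
  from P obtain N where N: "{x. \<not> P x} \<subseteq> N" "N \<in> null_sets lborel"
    by (auto elim!: AE_E simp: null_sets_def)
  from N(2) have "negligible N"
    by (simp add: negligible_iff_null_sets null_sets_completionI)
  then have "negligible S"
    by (rule negligible_subset) (use N(1) no in auto)
  with S show False
    using open_not_negligible by blast
qed

lemma fourier_dilate:
  fixes u :: "'a::euclidean_space \<Rightarrow> complex"
  assumes [measurable]: "u \<in> borel_measurable borel" and m: "0 < m"
  shows "fourier (\<lambda>t. u (t /\<^sub>R m)) z = (m ^ DIM('a)) *\<^sub>R fourier u (m *\<^sub>R z)"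
proof -
  have "fourier u (m *\<^sub>R z) = (\<bar>inverse m\<bar> ^ DIM('a)) *\<^sub>R fourier (\<lambda>t. u (t /\<^sub>R m)) z"
    using fourier_affine[OF assms(1), of "inverse m" "m *\<^sub>R z" 0] m by simp
  then show ?thesis
    using m by (simp add: power_inverse)
qed

text \<open>Since \<open>u\<close> is integrable and continuous but possibly unbounded, it is cut at the unit ball around
  \<open>x\<close>: inside, rescaling and dominated convergence apply; outside, the rescaled kernel is uniformly
  of order \<open>1 / Suc j\<close>.\<close>

lemma approximate_identity:
  fixes u k :: "'a::euclidean_space \<Rightarrow> complex"
  assumes u: "continuous_on UNIV u" "integrable lborel u"
    and k: "continuous_on UNIV k" "\<And>z. norm (k z) \<le> D * weight (- N) z" and N: "2 * real DIM('a) \<le> N"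
  shows "(\<lambda>j. \<integral>y. u y * ((real (Suc j) ^ DIM('a)) *\<^sub>R k (real (Suc j) *\<^sub>R (y - x))) \<partial>lborel)
     \<longlonglongrightarrow> u x * (\<integral>z. k z \<partial>lborel)"
proof -
  define K where "K j y = (real (Suc j) ^ DIM('a)) *\<^sub>R k (real (Suc j) *\<^sub>R (y - x))" for j y
  define v where "v y = indicator (cball x 1) y *\<^sub>R u y" for y
  have ik: "integrable lborel k"
    by (rule integrable_weight_bound[OF k N])
  have mk [measurable]: "k \<in> borel_measurable borel" and mu [measurable]: "u \<in> borel_measurable borel"
    using ik u by auto
  have mv [measurable]: "v \<in> borel_measurable borel"
    unfolding v_def by (intro borel_measurable_scaleR borel_measurable_indicator mu) simp
  have D: "0 \<le> D"
    using order_trans[OF norm_ge_zero k(2)[of 0]] by (simp add: zero_le_mult_iff weight_def)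
  have kD: "norm (k z) \<le> D" for z
    using order_trans[OF k(2)[of z], of D] mult_left_mono[OF weight_le_1[of "-N" z] D] N
    by (simp add: order_trans[OF _ N])
  obtain B where B: "\<And>y. norm (v y) \<le> B"
  proof -
    have "compact (u ` cball x 1)"
      by (intro compact_continuous_image continuous_on_subset[OF u(1)]) auto
    then obtain B where "\<And>y. y \<in> cball x 1 \<Longrightarrow> norm (u y) \<le> B" "0 < B"
      using compact_imp_bounded by (fastforce simp: bounded_pos)
    then show ?thesis
      by (intro that[of B]) (auto simp: v_def indicator_def)
  qed
  have intK: "integrable lborel (\<lambda>y. u y * K j y)" for j
  proof (rule Bochner_Integration.integrable_bound)
    show "integrable lborel (\<lambda>y. (real (Suc j) ^ DIM('a) * D) *\<^sub>R u y)"
      using u by simp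
    have "norm (u y) * norm (k z) \<le> D * norm (u y)" for y z
      using mult_left_mono[OF kD[of z], of "norm (u y)"] by (simp add: mult.commute)
    then show "AE y in lborel. norm (u y * K j y) \<le> norm ((real (Suc j) ^ DIM('a) * D) *\<^sub>R u y)"
      using D by (simp add: norm_mult K_def abs_mult)
  qed (simp add: K_def)
  have intvK: "integrable lborel (\<lambda>y. v y * K j y)" for j
    by (rule Bochner_Integration.integrable_bound[OF intK[of j]])
      (auto simp: K_def v_def indicator_def)

  have near: "(\<lambda>j. \<integral>y. v y * K j y \<partial>lborel) \<longlonglongrightarrow> u x * (\<integral>z. k z \<partial>lborel)"
  proof -
    have "(\<integral>y. v y * K j y \<partial>lborel) = (\<integral>w. v (x + inverse (real (Suc j)) *\<^sub>R w) * k w \<partial>lborel)" for j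
    proof -
      have "(\<integral>y. v y * K j y \<partial>lborel) = (\<bar>inverse (real (Suc j))\<bar> ^ DIM('a)) *\<^sub>R
          (\<integral>w. v (x + inverse (real (Suc j)) *\<^sub>R w) * K j (x + inverse (real (Suc j)) *\<^sub>R w) \<partial>lborel)"
        by (rule lborel_integral_affine) (simp_all add: K_def)
      also have "(\<lambda>w. v (x + inverse (real (Suc j)) *\<^sub>R w) * K j (x + inverse (real (Suc j)) *\<^sub>R w))
          = (\<lambda>w. (real (Suc j) ^ DIM('a)) *\<^sub>R (v (x + inverse (real (Suc j)) *\<^sub>R w) * k w))"
        by (simp add: K_def)
      finally show ?thesis
        by (simp add: power_inverse)
    qed
    moreover have "(\<lambda>j. \<integral>w. v (x + inverse (real (Suc j)) *\<^sub>R w) * k w \<partial>lborel) \<longlonglongrightarrow> (\<integral>w. u x * k w \<partial>lborel)"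
    proof (rule integral_dominated_convergence[where w="\<lambda>w. B * norm (k w)"])
      show "AE w in lborel. (\<lambda>j. v (x + inverse (real (Suc j)) *\<^sub>R w) * k w) \<longlonglongrightarrow> u x * k w"
      proof (intro always_eventually allI tendsto_mult tendsto_const)
        fix w
        have lim: "(\<lambda>j. x + inverse (real (Suc j)) *\<^sub>R w) \<longlonglongrightarrow> x + 0 *\<^sub>R w"
          by (intro tendsto_add tendsto_const tendsto_scaleR LIMSEQ_inverse_real_of_nat)
        then have "\<forall>\<^sub>F j in sequentially. x + inverse (real (Suc j)) *\<^sub>R w \<in> ball x 1"
          by (intro topological_tendstoD[OF lim]) auto
        then have "\<forall>\<^sub>F j in sequentially. u (x + inverse (real (Suc j)) *\<^sub>R w) = v (x + inverse (real (Suc j)) *\<^sub>R w)"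
          by eventually_elim (auto simp: v_def indicator_def)
        moreover have "(\<lambda>j. u (x + inverse (real (Suc j)) *\<^sub>R w)) \<longlonglongrightarrow> u x"
          using u(1) lim by (intro continuous_on_tendsto_compose[OF u(1)]) auto
        ultimately show "(\<lambda>j. v (x + inverse (real (Suc j)) *\<^sub>R w)) \<longlonglongrightarrow> u x"
          by (rule Lim_transform_eventually[rotated])
      qed
      show "AE w in lborel. norm (v (x + inverse (real (Suc j)) *\<^sub>R w) * k w) \<le> B * norm (k w)" for j
        by (intro always_eventually allI) (simp add: norm_mult mult_right_mono B)
    qed (use ik in auto)
    ultimately show ?thesis by simp
  qed

  have far: "(\<lambda>j. \<integral>y. (u y - v y) * K j y \<partial>lborel) \<longlonglongrightarrow> 0"
  proof (rule Lim_null_comparison)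
    show "(\<lambda>j. inverse (real (Suc j)) * (D * (\<integral>y. norm (u y) \<partial>lborel))) \<longlonglongrightarrow> 0"
      using tendsto_mult[OF LIMSEQ_inverse_real_of_nat tendsto_const] by simp
    show "\<forall>\<^sub>F j in sequentially. norm (\<integral>y. (u y - v y) * K j y \<partial>lborel)
        \<le> inverse (real (Suc j)) * (D * (\<integral>y. norm (u y) \<partial>lborel))"
    proof (intro always_eventually allI)
      fix j
      let ?m = "real (Suc j)"
      have "norm ((u y - v y) * K j y) \<le> inverse ?m * (D * norm (u y))" for y
      proof (cases "y \<in> cball x 1")
        case False
        then have "?m * 1 \<le> ?m * norm (y - x)"
          by (intro mult_left_mono) (auto simp: dist_norm norm_minus_commute)
        then have "?m \<le> 1 + norm (?m *\<^sub>R (y - x))"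
          unfolding norm_scaleR abs_of_nat mult_1_right by linarith
        then have "weight (- N) (?m *\<^sub>R (y - x)) \<le> ?m powr (- N)"
          unfolding weight_def using N by (intro powr_mono2') (auto intro: order_trans[rotated])
        moreover have "?m ^ DIM('a) * ?m powr (- N) \<le> inverse ?m"
        proof -
          have "?m ^ DIM('a) * ?m powr (- N) = ?m powr (real DIM('a) - N)"
            by (simp add: powr_realpow[symmetric] powr_add[symmetric])
          also have "\<dots> \<le> ?m powr (-1)"
          proof (rule powr_mono)
            have "1 \<le> real DIM('a)" using DIM_positive[where 'a='a] by linarith
            then show "real DIM('a) - N \<le> - 1" using N by linarith
          qed simp
          finally show ?thesis by (simp add: powr_minus)
        qed
        ultimately have "?m ^ DIM('a) * weight (- N) (?m *\<^sub>R (y - x)) \<le> inverse ?m"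
          by (meson mult_left_mono order_trans zero_le_power of_nat_0_le_iff)
        then have "(?m ^ DIM('a) * weight (- N) (?m *\<^sub>R (y - x))) * (D * norm (u y)) \<le> inverse ?m * (D * norm (u y))"
          using D by (intro mult_right_mono) auto
        moreover have "norm ((u y - v y) * K j y) \<le> norm (u y) * (?m ^ DIM('a) * (D * weight (- N) (?m *\<^sub>R (y - x))))"
          using False mult_left_mono[OF k(2)[of "?m *\<^sub>R (y - x)"], of "?m ^ DIM('a)"]
          unfolding K_def v_def norm_mult norm_scaleR
          by (intro mult_mono) auto
        ultimately show ?thesis by (simp only: ac_simps) 
      qed (use D in \<open>auto simp: v_def\<close>)
      then have "(\<integral>y. norm ((u y - v y) * K j y) \<partial>lborel) \<le> (\<integral>y. inverse ?m * (D * norm (u y)) \<partial>lborel)"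
        using u(2) intK intvK
        by (intro integral_mono integrable_norm integrable_mult_right) (auto simp: left_diff_distrib)
      then show "norm (\<integral>y. (u y - v y) * K j y \<partial>lborel) \<le> inverse ?m * (D * (\<integral>y. norm (u y) \<partial>lborel))"
        by (intro order_trans[OF integral_norm_bound]) simp
    qed
  qed
  have "(\<integral>y. v y * K j y \<partial>lborel) + (\<integral>y. (u y - v y) * K j y \<partial>lborel) = (\<integral>y. u y * K j y \<partial>lborel)" for j
    using intK intvK by (simp add: left_diff_distrib)
  with tendsto_add[OF near far] show ?thesis
    by (simp add: K_def)
qed

lemma ex_bump_fourier_decay:
  "\<exists>(\<beta> :: 'a::euclidean_space \<Rightarrow> real) D.
     (\<forall>x. norm x \<le> 1 \<longrightarrow> \<beta> x = 1) \<and> (\<forall>x. 2 \<le> norm x \<longrightarrow> \<beta> x = 0) \<and> (\<forall>x. \<beta> (- x) = \<beta> x) \<and> (\<forall>x. 0 \<le> \<beta> x) \<and>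
     continuous_on UNIV \<beta> \<and> integrable lborel \<beta> \<and> (\<exists>B. \<forall>x. \<beta> x \<le> B) \<and>
     (\<forall>\<xi>. norm (fourier (\<lambda>x. complex_of_real (\<beta> x)) \<xi>) \<le> D * weight (- real N) \<xi>)"
proof -
  let ?M = "2 * real DIM('a)"
  obtain \<beta> :: "'a \<Rightarrow> real" and C where
    Ck: "\<And>e. Ck_bounded N e (\<lambda>t. C e * weight (- ?M) t) (\<lambda>x. of_real (\<beta> x))" and
    \<beta>: "\<And>x. norm x \<le> 1 \<Longrightarrow> \<beta> x = 1" "\<And>x. 2 \<le> norm x \<Longrightarrow> \<beta> x = 0" "\<And>x. \<beta> (- x) = \<beta> x" "\<And>x. 0 \<le> \<beta> x"
    using ex_bump[of 1 N ?M] by auto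
  define C' where "C' = Max (C ` Basis)"
  have Ck': "Ck_bounded N e (\<lambda>t. C' * weight (- ?M) t) (\<lambda>x. of_real (\<beta> x))" if "e \<in> Basis" for e
    using that by (intro Ck_bounded_mono[OF Ck[of e]] mult_right_mono) (auto simp: C'_def)
  have c: "continuous_on UNIV (\<lambda>x. complex_of_real (\<beta> x))"
    using Ck_bounded_imp_continuous[OF Ck] .
  have cr: "continuous_on UNIV \<beta>"
    using continuous_on_Re[OF c] by simp
  have i: "integrable lborel (\<lambda>x. complex_of_real (\<beta> x))"
    by (rule integrable_weight_bound[OF c Ck_bounded_imp_norm_le[OF Ck[of 0]]]) simp
  have ir: "integrable lborel \<beta>"
    using integrable_Re[OF i] by simp
  have bd: "\<beta> x \<le> C 0" for x
  proof -
    have "\<bar>\<beta> x\<bar> \<le> C 0 * weight (- ?M) x"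
      using Ck_bounded_imp_norm_le[OF Ck[of 0], of x] by simp
    moreover have "0 \<le> C 0"
      using Ck_bounded_imp_norm_le[OF Ck[of 0], of 0] by (simp add: weight_def \<beta>)
    then have "C 0 * weight (- ?M) x \<le> C 0"
      by (intro mult_left_le weight_le_1) auto
    ultimately show ?thesis by linarith
  qed
  show ?thesis
    using \<beta> cr ir bd fourier_Ck_bounded_decay[OF Ck' order_refl]
    by (intro exI[of _ \<beta>] exI[of _ "(real DIM('a) + 1) ^ N * (C' * (\<integral>(t::'a). weight (- ?M) t \<partial>lborel))"]) auto
qed

text \<open>Inserting the dilated bump \<open>b\<close> into the double integral turns it into an approximate identity
  whose mass \<open>c\<close> is the integral of the transform of \<open>b\<close>. The actual value of \<open>c\<close> is \<open>(2 * pi) ^ DIM('a)\<close>,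
  and its nonvanishing follows without computing any transform: if \<open>c\<close> vanished,
  the double transform of \<open>b\<close> would be zero, so the multiplication formula would give
  \<open>\<integral> (fourier b)\<^sup>2 = 0\<close>. As \<open>b\<close> is real and even, \<open>fourier b\<close> is real, hence zero, contradicting
  \<open>fourier b 0 = \<integral> b > 0\<close>.\<close>

lemma fourier_inversion:
  obtains c where "c \<noteq> 0"
    and "\<And>(u :: 'a::euclidean_space \<Rightarrow> complex) t. continuous_on UNIV u \<Longrightarrow> integrable lborel u \<Longrightarrow>
           integrable lborel (fourier u) \<Longrightarrow> fourier (fourier u) t = c * u (- t)"
proof -
  define N where "N = 2 * DIM('a)"
  obtain \<beta> :: "'a \<Rightarrow> real" and D B where
    \<beta>: "\<And>x. norm x \<le> 1 \<Longrightarrow> \<beta> x = 1" "\<And>x. \<beta> (- x) = \<beta> x" "\<And>x. 0 \<le> \<beta> x" "continuous_on UNIV \<beta>" "integrable lborel \<beta>"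
      "\<And>x. \<beta> x \<le> B"
    and decay: "\<And>\<xi>. norm (fourier (\<lambda>x. complex_of_real (\<beta> x)) \<xi>) \<le> D * weight (- real N) \<xi>"
    using ex_bump_fourier_decay[where 'a='a and N=N] by metis
  define b where "b x = complex_of_real (\<beta> x)" for x
  have b_int: "integrable lborel b" unfolding b_def using \<beta> by simp
  have b_cont: "continuous_on UNIV b" unfolding b_def using \<beta> by (intro continuous_intros)
  have [measurable]: "b \<in> borel_measurable borel" using b_int by auto
  have Fb_cont: "continuous_on UNIV (fourier b)" by (rule continuous_on_fourier[OF b_int])
  have N: "2 * real DIM('a) \<le> real N" by (simp add: N_def)
  have decay: "norm (fourier b \<xi>) \<le> D * weight (- real N) \<xi>" for \<xi>
    using decay[of \<xi>] by (simp add: b_def[abs_def])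
  have Fb_int: "integrable lborel (fourier b)"
    by (rule integrable_weight_bound[OF Fb_cont decay N])
  define c where "c = integral\<^sup>L lborel (fourier b)"
  have inv: "fourier (fourier u) t = c * u (- t)"
    if u: "continuous_on UNIV u" "integrable lborel u" "integrable lborel (fourier u)" for u :: "'a \<Rightarrow> complex" and t
  proof -
    have [measurable]: "u \<in> borel_measurable borel" "fourier u \<in> borel_measurable borel" using u by auto
    have lim: "(\<lambda>j. \<integral>\<xi>. fourier u \<xi> * (b (\<xi> /\<^sub>R real (Suc j)) * cis (\<xi> \<bullet> t)) \<partial>lborel) \<longlonglongrightarrow> (\<integral>\<xi>. fourier u \<xi> * (1 * cis (\<xi> \<bullet> t)) \<partial>lborel)"
    proof (rule integral_dominated_convergence[where w="\<lambda>\<xi>. B * norm (fourier u \<xi>)"])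
      show "AE \<xi> in lborel. (\<lambda>j. fourier u \<xi> * (b (\<xi> /\<^sub>R real (Suc j)) * cis (\<xi> \<bullet> t))) \<longlonglongrightarrow> fourier u \<xi> * (1 * cis (\<xi> \<bullet> t))"
      proof (intro always_eventually allI tendsto_mult tendsto_const)
        fix \<xi> :: 'a
        have lim: "(\<lambda>j. \<xi> /\<^sub>R real (Suc j)) \<longlonglongrightarrow> 0 *\<^sub>R \<xi>"
          by (intro tendsto_scaleR tendsto_const LIMSEQ_inverse_real_of_nat)
        have "(\<lambda>j. b (\<xi> /\<^sub>R real (Suc j))) \<longlonglongrightarrow> b (0 *\<^sub>R \<xi>)"
          by (intro continuous_on_tendsto_compose[OF b_cont lim]) auto
        then show "(\<lambda>j. b (\<xi> /\<^sub>R real (Suc j))) \<longlonglongrightarrow> 1" by (simp add: b_def \<beta>)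
      qed
      show "AE \<xi> in lborel. norm (fourier u \<xi> * (b (\<xi> /\<^sub>R real (Suc j)) * cis (\<xi> \<bullet> t))) \<le> B * norm (fourier u \<xi>)" for j
        using \<beta>(3,6) by (simp add: norm_mult b_def mult.commute[of B] mult_left_mono)
    qed (use u in auto)
    have eq: "(\<integral>\<xi>. fourier u \<xi> * (b (\<xi> /\<^sub>R real (Suc j)) * cis (\<xi> \<bullet> t)) \<partial>lborel)
        = (\<integral>y. u y * ((real (Suc j) ^ DIM('a)) *\<^sub>R fourier b (real (Suc j) *\<^sub>R (y - (- t)))) \<partial>lborel)" for j
    proof -
      have "integrable lborel (\<lambda>\<xi>. b (\<xi> /\<^sub>R real (Suc j)))"
        using lborel_integrable_affine[OF b_int, of "inverse (real (Suc j))" 0] by simp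
      then have "(\<integral>\<xi>. fourier u \<xi> * (b (\<xi> /\<^sub>R real (Suc j)) * cis (\<xi> \<bullet> t)) \<partial>lborel)
          = (\<integral>y. u y * fourier (\<lambda>\<xi>. b (\<xi> /\<^sub>R real (Suc j)) * cis (\<xi> \<bullet> t)) y \<partial>lborel)"
        by (intro fourier_multiplication_formula u integrable_mult_cis)
      also have "\<dots> = (\<integral>y. u y * ((real (Suc j) ^ DIM('a)) *\<^sub>R fourier b (real (Suc j) *\<^sub>R (y - (- t)))) \<partial>lborel)"
        by (simp only: fourier_modulate) (subst fourier_dilate, simp_all)
      finally show ?thesis .
    qed
    from LIMSEQ_unique[OF lim[unfolded eq] approximate_identity[OF u(1,2) Fb_cont decay N, of "- t"]]
    show ?thesis
      unfolding c_def fourier_def[of "fourier u"] by (simp add: mult.commute)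
  qed
  have "c \<noteq> 0"
  proof
    assume c: "c = 0"
    have "fourier (fourier b) t = 0" for t
      using inv[OF b_cont b_int Fb_int, of t] c by simp
    then have "(\<integral>t. fourier b t * fourier b t \<partial>lborel) = 0"
      using fourier_multiplication_formula[OF Fb_int b_int] by simp
    moreover have "fourier b t * fourier b t = complex_of_real ((norm (fourier b t))\<^sup>2)" for t
    proof -
      have "cnj (fourier b t) = (\<integral>x. cnj (b x * cis (x \<bullet> t)) \<partial>lborel)"
        unfolding fourier_def by (rule Bochner_Integration.integral_cnj[symmetric])
      also have "\<dots> = (\<integral>x. (\<lambda>x. b x * cis (x \<bullet> t)) (0 - x) \<partial>lborel)"
        by (simp add: b_def \<beta> cis_cnj)
      also have "\<dots> = fourier b t"
        unfolding fourier_def by (rule lborel_integral_reflect) simp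
      finally show ?thesis
        by (metis complex_norm_square)
    qed
    ultimately have "(\<integral>t. (norm (fourier b t))\<^sup>2 \<partial>lborel) = 0"
      by (simp del: of_real_power)
    moreover have "integrable lborel (\<lambda>t. (norm (fourier b t))\<^sup>2)"
    proof (rule Bochner_Integration.integrable_bound[OF Fb_int[THEN integrable_norm, THEN integrable_mult_left, of "integral\<^sup>L lborel \<beta>"]])
      have "norm (fourier b t) \<le> integral\<^sup>L lborel \<beta>" for t
        using norm_fourier_le[of b t] \<beta>(3) by (simp add: b_def[abs_def])
      then show "AE t in lborel. norm ((norm (fourier b t))\<^sup>2) \<le> norm (norm (fourier b t) * integral\<^sup>L lborel \<beta>)"
        using \<beta>(3) by (auto simp: power2_eq_square abs_mult intro!: mult_left_mono order_trans[OF _ abs_ge_self])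
    qed (use Fb_int in measurable)
    ultimately have "AE t in lborel. (norm (fourier b t))\<^sup>2 = 0"
      by (subst (asm) integral_nonneg_eq_0_iff_AE) auto
    then have AE0: "AE t in lborel. fourier b t = 0" by simp
    have "open {t. fourier b t \<noteq> 0}"
      using Fb_cont by (intro open_Collect_neq continuous_intros) auto
    with AE_lborel_meets_open[OF AE0] have "{t. fourier b t \<noteq> 0} = {}" by blast
    then have "fourier b 0 = 0" by auto
    then have "integral\<^sup>L lborel \<beta> = 0"
      by (simp add: fourier_def b_def[abs_def])
    then have "AE x in lborel. \<beta> x = 0"
      using \<beta> by (subst (asm) integral_nonneg_eq_0_iff_AE) auto
    from AE_lborel_meets_open[OF this open_ball, of 0 1] show False
      using \<beta>(1) by force
  qed
  with inv show ?thesis by (rule that[rotated]) 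
qed

section \<open>The weighted Fourier algebra\<close>

text \<open>The Beurling algebra of the weight \<open>weight s\<close>, its norm, and the algebra of functions (under
  pointwise multiplication) that are transforms of its elements.\<close>

definition weighted_L1 :: "real \<Rightarrow> ('a::euclidean_space \<Rightarrow> complex) set" where
  "weighted_L1 s = {H. H \<in> borel_measurable borel \<and> integrable lborel (\<lambda>\<xi>. weight s \<xi> * norm (H \<xi>))}"

definition wnorm :: "real \<Rightarrow> ('a::euclidean_space \<Rightarrow> complex) \<Rightarrow> real" where
  "wnorm s H = (\<integral>\<xi>. weight s \<xi> * norm (H \<xi>) \<partial>lborel)"

definition fourier_algebra :: "real \<Rightarrow> ('a::euclidean_space \<Rightarrow> complex) set" where
  "fourier_algebra s = fourier ` weighted_L1 s"

lemma fourier_algebraI: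
  assumes "H \<in> weighted_L1 s" "\<And>x. fourier H x = h x"
  shows "h \<in> fourier_algebra s"
proof -
  have "h = fourier H" using assms(2) by (intro ext) simp
  with assms(1) show ?thesis by (simp add: fourier_algebra_def)
qed

lemma wnorm_nonneg: "0 \<le> wnorm s H"
  unfolding wnorm_def by (rule Bochner_Integration.integral_nonneg) simp

lemma weighted_L1_measurable: "H \<in> weighted_L1 s \<Longrightarrow> H \<in> borel_measurable borel"
  by (simp add: weighted_L1_def)

lemma weighted_L1_imp_integrable:
  assumes "H \<in> weighted_L1 s" "0 \<le> s"
  shows "integrable lborel H"
proof (rule Bochner_Integration.integrable_bound)
  show "integrable lborel (\<lambda>\<xi>. weight s \<xi> * norm (H \<xi>))" "H \<in> borel_measurable lborel"
    using assms by (auto simp: weighted_L1_def)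
  have "norm (H \<xi>) \<le> weight s \<xi> * norm (H \<xi>)" for \<xi>
    using mult_right_mono[OF weight_ge_1[OF assms(2), of \<xi>], of "norm (H \<xi>)"] by simp
  then show "AE \<xi> in lborel. norm (H \<xi>) \<le> norm (weight s \<xi> * norm (H \<xi>))"
    by (simp add: abs_mult)
qed

lemma norm_fourier_le_wnorm:
  assumes "H \<in> weighted_L1 s" "0 \<le> s"
  shows "norm (fourier H x) \<le> wnorm s H"
proof -
  have "norm (fourier H x) \<le> (\<integral>\<xi>. norm (H \<xi>) \<partial>lborel)"
    by (rule norm_fourier_le)
  also have "\<dots> \<le> wnorm s H"
    unfolding wnorm_def
  proof (rule integral_mono)
    show "norm (H \<xi>) \<le> weight s \<xi> * norm (H \<xi>)" for \<xi>
      using mult_right_mono[OF weight_ge_1[OF assms(2), of \<xi>], of "norm (H \<xi>)"] by simp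
  qed (use assms weighted_L1_imp_integrable in \<open>auto simp: weighted_L1_def\<close>)
  finally show ?thesis .
qed

lemma weighted_L1_bound:
  assumes "H \<in> borel_measurable borel" "\<And>\<xi>. norm (H \<xi>) \<le> D * weight (- N) \<xi>" "s + 2 * real DIM('a) \<le> N"
  shows "(H :: 'a::euclidean_space \<Rightarrow> complex) \<in> weighted_L1 s"
  unfolding weighted_L1_def
proof (intro CollectI conjI)
  show "integrable lborel (\<lambda>\<xi>. weight s \<xi> * norm (H \<xi>))"
  proof (rule Bochner_Integration.integrable_bound)
    show "integrable lborel (\<lambda>\<xi>::'a. D * weight (s - N) \<xi>)"
      using assms(3) by (intro integrable_mult_right integrable_weight) auto
    have "weight s \<xi> * norm (H \<xi>) \<le> D * weight (s - N) \<xi>" for \<xi>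
      using mult_left_mono[OF assms(2)[of \<xi>], of "weight s \<xi>"] weight_add[of s "-N" \<xi>] by (simp add: ac_simps)
    then show "AE \<xi> in lborel. norm (weight s \<xi> * norm (H \<xi>)) \<le> norm (D * weight (s - N) \<xi>)"
      by (intro always_eventually allI) (simp add: order_trans[OF _ abs_ge_self])
  qed (use assms(1) in measurable)
qed (rule assms(1))

lemma weighted_L1_add:
  assumes "H \<in> weighted_L1 s" "G \<in> weighted_L1 s"
  shows "(\<lambda>\<xi>. H \<xi> + G \<xi>) \<in> weighted_L1 s"
proof -
  have [measurable]: "H \<in> borel_measurable borel" "G \<in> borel_measurable borel"
    using assms by (auto simp: weighted_L1_def)
  have "integrable lborel (\<lambda>\<xi>. weight s \<xi> * norm (H \<xi> + G \<xi>))"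
  proof (rule Bochner_Integration.integrable_bound)
    show "integrable lborel (\<lambda>\<xi>. weight s \<xi> * norm (H \<xi>) + weight s \<xi> * norm (G \<xi>))"
      using assms by (auto simp: weighted_L1_def)
    show "AE \<xi> in lborel. norm (weight s \<xi> * norm (H \<xi> + G \<xi>)) \<le> norm (weight s \<xi> * norm (H \<xi>) + weight s \<xi> * norm (G \<xi>))"
      by (intro always_eventually allI)
        (simp add: distrib_left[symmetric] abs_mult mult_left_mono norm_triangle_ineq)
  qed measurable
  then show ?thesis by (simp add: weighted_L1_def)
qed

lemma weighted_L1_cmult:
  assumes "H \<in> weighted_L1 s"
  shows "(\<lambda>\<xi>. c * H \<xi>) \<in> weighted_L1 s"
  using assms integrable_mult_right[of "norm c" lborel "\<lambda>\<xi>. weight s \<xi> * norm (H \<xi>)"]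
  by (auto simp: weighted_L1_def norm_mult ac_simps)

lemma fourier_cmult: "fourier (\<lambda>\<xi>. c * H \<xi>) x = c * fourier H x"
  unfolding fourier_def by (simp add: mult.assoc)

lemma fourier_algebra_add:
  assumes "0 \<le> s" "h \<in> fourier_algebra s" "k \<in> fourier_algebra s"
  shows "(\<lambda>x. h x + k x) \<in> fourier_algebra s"
proof -
  from assms obtain H G where HG: "H \<in> weighted_L1 s" "G \<in> weighted_L1 s" "h = fourier H" "k = fourier G"
    by (auto simp: fourier_algebra_def)
  have "fourier (\<lambda>\<xi>. H \<xi> + G \<xi>) x = h x + k x" for x
    using integrable_mult_cis[OF weighted_L1_imp_integrable[OF HG(1) assms(1)]]
      integrable_mult_cis[OF weighted_L1_imp_integrable[OF HG(2) assms(1)]]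
    unfolding HG(3,4) fourier_def by (simp add: distrib_right)
  then show ?thesis
    by (rule fourier_algebraI[OF weighted_L1_add[OF HG(1,2)]])
qed

lemma fourier_algebra_cmult:
  assumes "h \<in> fourier_algebra s"
  shows "(\<lambda>x. c * h x) \<in> fourier_algebra s"
proof -
  from assms obtain H where H: "H \<in> weighted_L1 s" "h = fourier H"
    by (auto simp: fourier_algebra_def)
  then show ?thesis
    by (intro fourier_algebraI[OF weighted_L1_cmult]) (simp_all add: fourier_cmult)
qed

lemma fourier_algebra_diff:
  assumes "0 \<le> s" "h \<in> fourier_algebra s" "k \<in> fourier_algebra s"
  shows "(\<lambda>x. h x - k x) \<in> fourier_algebra s"
  using fourier_algebra_add[OF assms(1,2) fourier_algebra_cmult[OF assms(3), of "-1"]] by simp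

lemma fourier_algebra_zero: "(\<lambda>_. 0) \<in> fourier_algebra s"
  by (rule fourier_algebraI[of "\<lambda>_. 0"]) (simp_all add: weighted_L1_def fourier_def)

lemma continuous_on_fourier_algebra:
  "0 \<le> s \<Longrightarrow> h \<in> fourier_algebra s \<Longrightarrow> continuous_on UNIV h"
  by (auto simp: fourier_algebra_def intro!: continuous_on_fourier weighted_L1_imp_integrable)

text \<open>The weights \<open>weight s t\<close> and \<open>weight s (\<epsilon> *\<^sub>R t)\<close> are comparable, so the algebra as a set (though not
  its norm) is invariant under dilations.\<close>

lemma fourier_algebra_affine:
  fixes h :: "'a::euclidean_space \<Rightarrow> complex"
  assumes "0 \<le> s" "h \<in> fourier_algebra s" and \<epsilon>: "0 < \<epsilon>"
  shows "(\<lambda>x. h ((x - x0) /\<^sub>R \<epsilon>)) \<in> fourier_algebra s"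
proof -
  from assms obtain H where H: "H \<in> weighted_L1 s" "h = fourier H"
    by (auto simp: fourier_algebra_def)
  have [measurable]: "H \<in> borel_measurable borel" using H by (simp add: weighted_L1_def)
  define G where "G t = complex_of_real (\<epsilon> ^ DIM('a)) * (H (\<epsilon> *\<^sub>R t) * cis (t \<bullet> (- x0)))" for t
  have "fourier G x = h ((x - x0) /\<^sub>R \<epsilon>)" for x
  proof -
    have "fourier (\<lambda>t. H (t /\<^sub>R inverse \<epsilon>)) (x - x0) = inverse \<epsilon> ^ DIM('a) *\<^sub>R fourier H (inverse \<epsilon> *\<^sub>R (x - x0))"
      using \<epsilon> by (intro fourier_dilate) auto
    then show ?thesis
      unfolding G_def fourier_cmult fourier_modulate H(2)
      using \<epsilon> by (simp add: scaleR_conv_of_real field_simps)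
  qed
  moreover have "G \<in> weighted_L1 s"
    unfolding weighted_L1_def
  proof (intro CollectI conjI)
    show [measurable]: "G \<in> borel_measurable borel" unfolding G_def by measurable
    define K where "K = max 1 (inverse \<epsilon>) powr s"
    have K: "weight s t \<le> K * weight s (\<epsilon> *\<^sub>R t)" for t :: 'a
    proof -
      have "norm t = inverse \<epsilon> * (\<epsilon> * norm t)" using \<epsilon> by simp
      also have "\<dots> \<le> max 1 (inverse \<epsilon>) * (\<epsilon> * norm t)"
        using \<epsilon> by (intro mult_right_mono) auto
      finally have "1 + norm t \<le> max 1 (inverse \<epsilon>) * (1 + norm (\<epsilon> *\<^sub>R t))"
        using \<epsilon> by (simp add: distrib_left add_mono)
      then show ?thesis
        unfolding weight_def K_def using assms(1) \<epsilon>
        by (simp add: powr_mult[symmetric] powr_mono2)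
    qed
    show "integrable lborel (\<lambda>t. weight s t * norm (G t))"
    proof (rule Bochner_Integration.integrable_bound)
      have "integrable lborel (\<lambda>t. weight s (0 + \<epsilon> *\<^sub>R t) * norm (H (0 + \<epsilon> *\<^sub>R t)))"
        using H \<epsilon> by (intro lborel_integrable_affine[of "\<lambda>t. weight s t * norm (H t)"]) (auto simp: weighted_L1_def)
      then show "integrable lborel (\<lambda>t. K * \<epsilon> ^ DIM('a) * (weight s (\<epsilon> *\<^sub>R t) * norm (H (\<epsilon> *\<^sub>R t))))"
        by simp
      show "AE t in lborel. norm (weight s t * norm (G t)) \<le> norm (K * \<epsilon> ^ DIM('a) * (weight s (\<epsilon> *\<^sub>R t) * norm (H (\<epsilon> *\<^sub>R t))))"
      proof (intro always_eventually allI)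
        fix t
        have "weight s t * norm (G t) = weight s t * (\<epsilon> ^ DIM('a) * norm (H (\<epsilon> *\<^sub>R t)))"
          using \<epsilon> by (simp add: G_def norm_mult norm_power)
        also have "\<dots> \<le> (K * weight s (\<epsilon> *\<^sub>R t)) * (\<epsilon> ^ DIM('a) * norm (H (\<epsilon> *\<^sub>R t)))"
          using \<epsilon> by (intro mult_right_mono K) auto
        also have "\<dots> = K * \<epsilon> ^ DIM('a) * (weight s (\<epsilon> *\<^sub>R t) * norm (H (\<epsilon> *\<^sub>R t)))"
          by (simp only: ac_simps)
        finally have "weight s t * norm (G t) \<le> K * \<epsilon> ^ DIM('a) * (weight s (\<epsilon> *\<^sub>R t) * norm (H (\<epsilon> *\<^sub>R t)))" .
        then show "norm (weight s t * norm (G t)) \<le> norm (K * \<epsilon> ^ DIM('a) * (weight s (\<epsilon> *\<^sub>R t) * norm (H (\<epsilon> *\<^sub>R t))))"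
          unfolding real_norm_def by (simp only: abs_mult[of "weight s t"] abs_of_nonneg[OF weight_nonneg] abs_norm_cancel order_trans[OF _ abs_ge_self])
      qed
    qed measurable
  qed
  ultimately show ?thesis by (intro fourier_algebraI)
qed

definition convolution :: "('a::euclidean_space \<Rightarrow> complex) \<Rightarrow> ('a \<Rightarrow> complex) \<Rightarrow> 'a \<Rightarrow> complex" where
  "convolution H G \<xi> = (\<integral>\<eta>. H \<eta> * G (\<xi> - \<eta>) \<partial>lborel)"

text \<open>Young's inequality with weight: submultiplicativity of \<open>weight s\<close> distributes it over the two
  factors of the convolution integral.\<close>

lemma
  fixes H G :: "'a::euclidean_space \<Rightarrow> complex"
  assumes s: "0 \<le> s" and H: "H \<in> weighted_L1 s" and G: "G \<in> weighted_L1 s"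
  shows convolution_weighted_L1: "convolution H G \<in> weighted_L1 s"
    and wnorm_convolution_le: "wnorm s (convolution H G) \<le> wnorm s H * wnorm s G"
    and fourier_convolution: "fourier (convolution H G) x = fourier H x * fourier G x"
proof -
  have [measurable]: "H \<in> borel_measurable borel" "G \<in> borel_measurable borel"
    using H G by (auto simp: weighted_L1_def)
  have iH: "integrable lborel H" and iG: "integrable lborel G"
    using H G s weighted_L1_imp_integrable by auto
  let ?H = "\<lambda>\<eta>. weight s \<eta> * norm (H \<eta>)" and ?G = "\<lambda>\<eta>. weight s \<eta> * norm (G \<eta>)"
  have iwH: "integrable lborel ?H" and iwG: "integrable lborel ?G"
    using H G by (auto simp: weighted_L1_def)
  have pair: "integrable (lborel \<Otimes>\<^sub>M lborel) (\<lambda>(\<eta>, \<xi>). ?H \<eta> * ?G (\<xi> - \<eta>))"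
    using integrable_pair_convolution[OF iwH iwG, of 1] by simp
  have [measurable]: "convolution H G \<in> borel_measurable borel"
    unfolding convolution_def[abs_def] by measurable
  have le: "AE \<xi> in lborel. weight s \<xi> * norm (convolution H G \<xi>) \<le> (\<integral>\<eta>. ?H \<eta> * ?G (\<xi> - \<eta>) \<partial>lborel)"
    using lborel_pair.AE_integrable_snd[OF pair]
  proof eventually_elim
    case (elim \<xi>)
    have "weight s \<xi> * norm (convolution H G \<xi>) \<le> weight s \<xi> * (\<integral>\<eta>. norm (H \<eta> * G (\<xi> - \<eta>)) \<partial>lborel)"
      unfolding convolution_def by (intro mult_left_mono integral_norm_bound) auto
    also have "\<dots> = (\<integral>\<eta>. weight s \<xi> * norm (H \<eta> * G (\<xi> - \<eta>)) \<partial>lborel)"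
      by simp
    also have "\<dots> \<le> (\<integral>\<eta>. ?H \<eta> * ?G (\<xi> - \<eta>) \<partial>lborel)"
    proof (rule integral_mono')
      show "weight s \<xi> * norm (H \<eta> * G (\<xi> - \<eta>)) \<le> ?H \<eta> * ?G (\<xi> - \<eta>)" for \<eta>
        using mult_right_mono[OF weight_submult[OF s, of \<eta> "\<xi> - \<eta>"], of "norm (H \<eta> * G (\<xi> - \<eta>))"]
        by (simp add: norm_mult ac_simps)
    qed (use elim in auto)
    finally show ?case .
  qed
  have iR: "integrable lborel (\<lambda>\<xi>. \<integral>\<eta>. ?H \<eta> * ?G (\<xi> - \<eta>) \<partial>lborel)"
    by (rule lborel_pair.integrable_snd[OF pair])
  have iconv: "integrable lborel (\<lambda>\<xi>. weight s \<xi> * norm (convolution H G \<xi>))"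
  proof (rule Bochner_Integration.integrable_bound[OF iR])
    show "AE \<xi> in lborel. norm (weight s \<xi> * norm (convolution H G \<xi>)) \<le> norm (\<integral>\<eta>. ?H \<eta> * ?G (\<xi> - \<eta>) \<partial>lborel)"
      using le by eventually_elim (auto simp: abs_mult intro: order_trans[OF _ abs_ge_self])
  qed measurable
  then show mem: "convolution H G \<in> weighted_L1 s"
    by (simp add: weighted_L1_def)
  have "wnorm s (convolution H G) \<le> (\<integral>\<xi>. (\<integral>\<eta>. ?H \<eta> * ?G (\<xi> - \<eta>) \<partial>lborel) \<partial>lborel)"
    unfolding wnorm_def by (rule integral_mono_AE[OF iconv iR le])
  also have "\<dots> = (\<integral>\<eta>. (\<integral>\<xi>. ?H \<eta> * ?G (\<xi> - \<eta>) \<partial>lborel) \<partial>lborel)"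
    by (rule lborel_pair.Fubini_integral[OF pair])
  also have "\<dots> = wnorm s H * wnorm s G"
    unfolding wnorm_def by (simp add: lborel_integral_translate[of ?G])
  finally show "wnorm s (convolution H G) \<le> wnorm s H * wnorm s G" .
  have "integrable (lborel \<Otimes>\<^sub>M lborel) (\<lambda>(\<eta>, \<xi>). H \<eta> * G (\<xi> - \<eta>) * cis (\<xi> \<bullet> x))"
    using integrable_pair_convolution[OF integrable_norm[OF iH] integrable_norm[OF iG], of 1]
    by (rule Bochner_Integration.integrable_bound) (auto simp: norm_mult)
  from lborel_pair.Fubini_integral[OF this]
  have "fourier (convolution H G) x = (\<integral>\<eta>. (\<integral>\<xi>. H \<eta> * G (\<xi> - \<eta>) * cis (\<xi> \<bullet> x) \<partial>lborel) \<partial>lborel)"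
    unfolding fourier_def convolution_def by simp
  also have "\<dots> = (\<integral>\<eta>. H \<eta> * (cis (\<eta> \<bullet> x) * fourier G x) \<partial>lborel)"
  proof (rule Bochner_Integration.integral_cong[OF refl])
    fix \<eta>
    show "(\<integral>\<xi>. H \<eta> * G (\<xi> - \<eta>) * cis (\<xi> \<bullet> x) \<partial>lborel) = H \<eta> * (cis (\<eta> \<bullet> x) * fourier G x)"
      using fourier_translate[of G "- \<eta>" x] by (simp add: fourier_def mult.assoc)
  qed
  also have "\<dots> = fourier H x * fourier G x"
    unfolding fourier_def[of H] by (simp add: mult.assoc[symmetric])
  finally show "fourier (convolution H G) x = fourier H x * fourier G x" .
qed

lemma fourier_algebra_mult:
  assumes "0 \<le> s" "h \<in> fourier_algebra s" "k \<in> fourier_algebra s"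
  shows "(\<lambda>x. h x * k x) \<in> fourier_algebra s"
proof -
  from assms obtain H G where HG: "H \<in> weighted_L1 s" "G \<in> weighted_L1 s" "h = fourier H" "k = fourier G"
    by (auto simp: fourier_algebra_def)
  then show ?thesis
    by (intro fourier_algebraI[OF convolution_weighted_L1[OF assms(1) HG(1,2)]])
      (simp add: fourier_convolution[OF assms(1) HG(1,2)])
qed

text \<open>Fourier inversion turned into a membership criterion.\<close>

lemma fourier_algebra_if_fourier_weighted_L1:
  fixes u :: "'a::euclidean_space \<Rightarrow> complex"
  assumes s: "0 \<le> s" and u: "continuous_on UNIV u" "integrable lborel u" "fourier u \<in> weighted_L1 s"
  shows "u \<in> fourier_algebra s"
proof -
  have iF: "integrable lborel (fourier u)"
    using weighted_L1_imp_integrable u(3) s by blast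
  then have [measurable]: "fourier u \<in> borel_measurable borel" by auto
  obtain c where c: "c \<noteq> 0" and inv: "\<And>t. fourier (fourier u) t = c * u (- t)"
    using fourier_inversion[where 'a='a] u iF by metis
  define H where "H \<xi> = inverse c * fourier u (- \<xi>)" for \<xi>
  have "integrable lborel (\<lambda>\<xi>. weight s (0 - \<xi>) * norm (fourier u (0 - \<xi>)))"
    using u(3) by (intro lborel_integrable_reflect[of "\<lambda>\<xi>. weight s \<xi> * norm (fourier u \<xi>)"]) (simp add: weighted_L1_def)
  then have "(\<lambda>\<xi>. fourier u (- \<xi>)) \<in> weighted_L1 s"
    by (simp add: weighted_L1_def)
  then have "H \<in> weighted_L1 s"
    unfolding H_def by (rule weighted_L1_cmult)
  moreover have "fourier H t = u t" for t
  proof -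
    have "fourier (\<lambda>\<xi>. fourier u (- \<xi>)) t = (\<integral>\<xi>. (\<lambda>\<xi>. fourier u \<xi> * cis (\<xi> \<bullet> (- t))) (0 - \<xi>) \<partial>lborel)"
      by (simp add: fourier_def)
    also have "\<dots> = fourier (fourier u) (- t)"
      unfolding fourier_def[of "fourier u"] by (rule lborel_integral_reflect) measurable
    finally show ?thesis
      unfolding H_def fourier_cmult using c inv by simp
  qed
  ultimately show ?thesis by (intro fourier_algebraI)
qed

section \<open>A local Wiener-Levy theorem\<close>

lemma AE_summable_of_summable_integral:
  fixes f :: "nat \<Rightarrow> 'a \<Rightarrow> real"
  assumes "\<And>i. integrable M (f i)" "\<And>i x. 0 \<le> f i x" "summable (\<lambda>i. \<integral>x. f i x \<partial>M)"
  shows "AE x in M. summable (\<lambda>i. f i x)"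
proof -
  have [measurable]: "f i \<in> borel_measurable M" for i using assms(1) by auto
  have "(\<integral>\<^sup>+x. (\<Sum>i. ennreal (f i x)) \<partial>M) = (\<Sum>i. \<integral>\<^sup>+x. ennreal (f i x) \<partial>M)"
    by (intro nn_integral_suminf) simp
  also have "\<dots> = (\<Sum>i. ennreal (\<integral>x. f i x \<partial>M))"
    by (intro arg_cong[where f=suminf] ext nn_integral_eq_integral) (simp_all add: assms)
  also have "\<dots> \<noteq> \<infinity>"
    unfolding infinity_ennreal_def
    by (rule ennreal_suminf_neq_top[OF assms(3)]) (simp add: assms(2) Bochner_Integration.integral_nonneg)
  finally have "AE x in M. (\<Sum>i. ennreal (f i x)) \<noteq> \<infinity>"
    by (intro nn_integral_PInf_AE) auto
  then show ?thesis
    by eventually_elim (use assms(2) summable_suminf_not_top in auto)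
qed

text \<open>A power series evaluated at an element of the algebra, through the series of convolution powers.
  The constant term is left out because \<open>L\<^sup>1\<close> has no unit for convolution.\<close>

lemma weighted_L1_power_series:
  fixes H :: "'a::euclidean_space \<Rightarrow> complex" and a :: "nat \<Rightarrow> complex"
  assumes s: "0 \<le> s" and H: "H \<in> weighted_L1 s" and a: "summable (\<lambda>m. norm (a m) * wnorm s H ^ m)"
  shows "\<exists>G\<in>weighted_L1 s. \<forall>x. (\<lambda>m. a (Suc m) * fourier H x ^ Suc m) sums fourier G x"
proof -
  \<comment> \<open>\<open>P m\<close> is the convolution power of exponent \<open>Suc m\<close>.\<close>
  define P where "P = rec_nat H (\<lambda>_. convolution H)"
  have P_0: "P 0 = H" and P_Suc: "P (Suc m) = convolution H (P m)" for m
    by (simp_all add: P_def)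
  have P: "P m \<in> weighted_L1 s \<and> wnorm s (P m) \<le> wnorm s H ^ Suc m \<and> (\<forall>x. fourier (P m) x = fourier H x ^ Suc m)" for m
  proof (induction m)
    case 0
    then show ?case using H by (simp add: P_0)
  next
    case (Suc m)
    have "wnorm s (P (Suc m)) \<le> wnorm s H * wnorm s (P m)"
      unfolding P_Suc using Suc by (intro wnorm_convolution_le s H) auto
    also have "\<dots> \<le> wnorm s H * wnorm s H ^ Suc m"
      using Suc by (intro mult_left_mono wnorm_nonneg) auto
    finally show ?case
      using Suc by (simp add: P_Suc convolution_weighted_L1[OF s H] fourier_convolution[OF s H])
  qed
  define T where "T m \<xi> = a (Suc m) * P m \<xi>" for m \<xi>
  have T: "T m \<in> weighted_L1 s" for m
    unfolding T_def using P by (intro weighted_L1_cmult) auto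
  have T_meas [measurable]: "T m \<in> borel_measurable borel" for m
    using T by (rule weighted_L1_measurable)
  have "wnorm s (T m) = norm (a (Suc m)) * wnorm s (P m)" for m
    unfolding wnorm_def T_def by (simp add: norm_mult mult.left_commute[of "weight _ _"])
  then have T_le: "wnorm s (T m) \<le> norm (a (Suc m)) * wnorm s H ^ Suc m" for m
    using P by (auto intro: mult_left_mono)
  have sum_wnorm: "summable (\<lambda>m. wnorm s (T m))"
  proof (rule summable_comparison_test)
    show "summable (\<lambda>m. norm (a (Suc m)) * wnorm s H ^ Suc m)"
      using a by (simp only: summable_Suc_iff[of "\<lambda>m. norm (a m) * wnorm s H ^ m"])
    show "\<exists>N. \<forall>n\<ge>N. norm (wnorm s (T n)) \<le> norm (a (Suc n)) * wnorm s H ^ Suc n"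
      using T_le wnorm_nonneg[of s "T _"] by (intro exI[of _ 0]) simp
  qed
  have iT: "integrable lborel (\<lambda>\<xi>. weight s \<xi> * norm (T m \<xi>))" for m
    using T by (simp add: weighted_L1_def)
  have AE_w: "AE \<xi> in lborel. summable (\<lambda>m. weight s \<xi> * norm (T m \<xi>))"
    using iT sum_wnorm by (intro AE_summable_of_summable_integral) (auto simp: wnorm_def)
  have AE_n: "AE \<xi> in lborel. summable (\<lambda>m. norm (T m \<xi>))"
    using AE_w
  proof eventually_elim
    case (elim \<xi>)
    then show ?case
      by (subst (asm) summable_cmult_iff) (use weight_pos[of s \<xi>] in auto)
  qed
  define G where "G \<xi> = (\<Sum>m. T m \<xi>)" for \<xi>
  have [measurable]: "G \<in> borel_measurable borel"
    unfolding G_def by measurable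
  have "integrable lborel (\<lambda>\<xi>. \<Sum>m. weight s \<xi> * norm (T m \<xi>))"
    using iT sum_wnorm AE_w by (intro integrable_suminf) (auto simp: wnorm_def abs_mult)
  then have "integrable lborel (\<lambda>\<xi>. weight s \<xi> * norm (G \<xi>))"
  proof (rule Bochner_Integration.integrable_bound)
    show "AE \<xi> in lborel. norm (weight s \<xi> * norm (G \<xi>)) \<le> norm (\<Sum>m. weight s \<xi> * norm (T m \<xi>))"
      using AE_n
    proof eventually_elim
      case (elim \<xi>)
      have "weight s \<xi> * norm (G \<xi>) \<le> weight s \<xi> * (\<Sum>m. norm (T m \<xi>))"
        unfolding G_def by (intro mult_left_mono summable_norm elim) auto
      also have "\<dots> = (\<Sum>m. weight s \<xi> * norm (T m \<xi>))"
        by (rule suminf_mult[OF elim, symmetric])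
      finally show ?case by (simp add: abs_mult)
    qed
  qed measurable
  then have "G \<in> weighted_L1 s" by (simp add: weighted_L1_def)
  moreover have "(\<lambda>m. a (Suc m) * fourier H x ^ Suc m) sums fourier G x" for x
  proof -
    have iTm: "integrable lborel (T m)" for m
      by (rule weighted_L1_imp_integrable[OF T s])
    have sum_n: "summable (\<lambda>m. \<integral>\<xi>. norm (T m \<xi> * cis (\<xi> \<bullet> x)) \<partial>lborel)"
    proof (rule summable_comparison_test[OF _ sum_wnorm], intro exI[of _ 0] allI impI)
      fix m
      have "(\<integral>\<xi>. norm (T m \<xi>) \<partial>lborel) \<le> wnorm s (T m)"
        unfolding wnorm_def
      proof (rule integral_mono)
        show "norm (T m \<xi>) \<le> weight s \<xi> * norm (T m \<xi>)" for \<xi>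
          using mult_right_mono[OF weight_ge_1[OF s, of \<xi>], of "norm (T m \<xi>)"] by simp
      qed (use iT iTm in auto)
      then show "norm (\<integral>\<xi>. norm (T m \<xi> * cis (\<xi> \<bullet> x)) \<partial>lborel) \<le> wnorm s (T m)"
        by (simp add: norm_mult)
    qed
    have "(\<lambda>m. \<integral>\<xi>. T m \<xi> * cis (\<xi> \<bullet> x) \<partial>lborel) sums (\<integral>\<xi>. (\<Sum>m. T m \<xi> * cis (\<xi> \<bullet> x)) \<partial>lborel)"
      using sum_n AE_n by (intro sums_integral integrable_mult_cis iTm) (auto simp: norm_mult)
    moreover have "(\<integral>\<xi>. (\<Sum>m. T m \<xi> * cis (\<xi> \<bullet> x)) \<partial>lborel) = fourier G x"
      unfolding fourier_def G_def
    proof (rule integral_cong_AE)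
      show "AE \<xi> in lborel. (\<Sum>m. T m \<xi> * cis (\<xi> \<bullet> x)) = (\<Sum>m. T m \<xi>) * cis (\<xi> \<bullet> x)"
        using AE_n by eventually_elim (rule suminf_mult2[symmetric], rule summable_norm_cancel)
    qed measurable
    moreover have "(\<integral>\<xi>. T m \<xi> * cis (\<xi> \<bullet> x) \<partial>lborel) = a (Suc m) * fourier H x ^ Suc m" for m
    proof -
      have "(\<integral>\<xi>. T m \<xi> * cis (\<xi> \<bullet> x) \<partial>lborel) = fourier (T m) x" by (simp add: fourier_def)
      also have "\<dots> = a (Suc m) * fourier (P m) x" unfolding T_def by (rule fourier_cmult)
      finally show ?thesis using P by simp
    qed
    ultimately show ?thesis by simp
  qed
  ultimately show ?thesis by blast
qed

text \<open>The heart of the local Wiener-Levy theorem. With \<open>b = fourier B\<close> and \<open>h = fourier H\<close>, the function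
  \<open>U j\<close> represents \<open>b y \<cdot> (h (y / Suc j) - h 0)\<close>: the localization of \<open>h - h 0\<close> to a small ball, seen
  in coordinates in which that ball has a fixed size. In the original coordinates the weighted norm of
  this localization need not tend to zero when \<open>s\<close> is large. After dilation the frequencies \<open>\<xi>\<close> of
  \<open>h\<close> are compressed to \<open>\<xi> / Suc j\<close>, and the norm is at most the average over \<open>\<xi>\<close> of the weighted
  \<open>L\<^sup>1\<close> distance between \<open>B\<close> and its translate by \<open>\<xi> / Suc j\<close>. That distance is bounded by
  a multiple of \<open>weight s \<xi>\<close> and tends to zero for each \<open>\<xi>\<close>.\<close>

lemma weighted_translate_difference_small:
  fixes B H :: "'a::euclidean_space \<Rightarrow> complex"
  assumes s: "0 \<le> s" and H: "H \<in> weighted_L1 s"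
    and B: "continuous_on UNIV B" "\<And>\<zeta>. norm (B \<zeta>) \<le> D * weight (- N) \<zeta>" and N: "s + 2 * real DIM('a) \<le> N"
  defines "U \<equiv> \<lambda>j \<zeta>. \<integral>\<xi>. H \<xi> * (B (\<zeta> - inverse (real (Suc j)) *\<^sub>R \<xi>) - B \<zeta>) \<partial>lborel"
  shows "U j \<in> weighted_L1 s" 
    and "fourier (U j) y = fourier B y * (fourier H (y /\<^sub>R real (Suc j)) - fourier H 0)"
    and "(\<lambda>j. wnorm s (U j)) \<longlonglongrightarrow> 0"
proof -
  have [measurable]: "H \<in> borel_measurable borel" using H by (simp add: weighted_L1_def)
  have [measurable]: "B \<in> borel_measurable borel"
    by (rule borel_measurable_continuous_onI[OF B(1)])
  have BL: "B \<in> weighted_L1 s"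
    by (rule weighted_L1_bound[OF _ B(2) N]) simp
  have iH: "integrable lborel H" and iB: "integrable lborel B"
    using H BL s weighted_L1_imp_integrable by auto
  let ?wH = "\<lambda>\<eta>. weight s \<eta> * norm (H \<eta>)" and ?wB = "\<lambda>\<eta>. weight s \<eta> * norm (B \<eta>)"
  have iwH: "integrable lborel ?wH" and iwB: "integrable lborel ?wB"
    using H BL by (auto simp: weighted_L1_def)
  have D: "0 \<le> D"
    using order_trans[OF norm_ge_zero B(2)[of 0]] by (simp add: zero_le_mult_iff weight_def)
  define r where "r j = inverse (real (Suc j))" for j
  have r: "0 < r j" "r j \<le> 1" for j by (auto simp: r_def field_simps)
  have r_norm: "norm (r j *\<^sub>R \<xi>) \<le> norm \<xi>" for j and \<xi> :: 'a
    using r[of j] by (auto intro: mult_left_le_one_le)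
  define \<Phi> where "\<Phi> j \<xi> \<zeta> = norm (H \<xi>) * (weight s \<zeta> * norm (B (\<zeta> - r j *\<^sub>R \<xi>) - B \<zeta>))" for j \<xi> \<zeta>
  have w_shift: "weight s \<zeta> \<le> weight s \<xi> * weight s (\<zeta> - r j *\<^sub>R \<xi>)" for j and \<xi> \<zeta> :: 'a
  proof -
    have "weight s \<zeta> \<le> weight s (r j *\<^sub>R \<xi>) * weight s (\<zeta> - r j *\<^sub>R \<xi>)"
      using weight_submult[OF s, of "r j *\<^sub>R \<xi>" "\<zeta> - r j *\<^sub>R \<xi>"] by simp
    also have "\<dots> \<le> weight s \<xi> * weight s (\<zeta> - r j *\<^sub>R \<xi>)"
      by (intro mult_right_mono weight_mono_norm s r_norm) simp
    finally show ?thesis .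
  qed
  have diff_le: "weight s \<zeta> * norm (B (\<zeta> - r j *\<^sub>R \<xi>) - B \<zeta>) \<le> weight s \<xi> * (?wB (\<zeta> - r j *\<^sub>R \<xi>) + ?wB \<zeta>)" for j \<xi> \<zeta>
  proof -
    have "weight s \<zeta> * norm (B (\<zeta> - r j *\<^sub>R \<xi>) - B \<zeta>) \<le> weight s \<zeta> * norm (B (\<zeta> - r j *\<^sub>R \<xi>)) + ?wB \<zeta>"
      by (simp add: distrib_left[symmetric] mult_left_mono norm_triangle_ineq4)
    also have "weight s \<zeta> * norm (B (\<zeta> - r j *\<^sub>R \<xi>)) \<le> weight s \<xi> * ?wB (\<zeta> - r j *\<^sub>R \<xi>)"
      using mult_right_mono[OF w_shift, of "norm (B (\<zeta> - r j *\<^sub>R \<xi>))" \<zeta> \<xi> j] by (simp add: mult.assoc)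
    also have "?wB \<zeta> \<le> weight s \<xi> * ?wB \<zeta>"
      using mult_right_mono[OF weight_ge_1[OF s, of \<xi>], of "?wB \<zeta>"] by simp
    finally show ?thesis by (simp add: distrib_left)
  qed
  have pair: "integrable (lborel \<Otimes>\<^sub>M lborel) (\<lambda>(\<xi>, \<zeta>). \<Phi> j \<xi> \<zeta>)" for j
  proof (rule Bochner_Integration.integrable_bound)
    show "integrable (lborel \<Otimes>\<^sub>M lborel) (\<lambda>x. (case x of (\<xi>, \<zeta>) \<Rightarrow> ?wH \<xi> * ?wB (\<zeta> - r j *\<^sub>R \<xi>)) + (case x of (\<xi>, \<zeta>) \<Rightarrow> ?wH \<xi> * ?wB \<zeta>))"
      by (intro Bochner_Integration.integrable_add integrable_pair_convolution integrable_pair_product iwH iwB)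
    show "AE x in lborel \<Otimes>\<^sub>M lborel. norm (case x of (\<xi>, \<zeta>) \<Rightarrow> \<Phi> j \<xi> \<zeta>)
        \<le> norm ((case x of (\<xi>, \<zeta>) \<Rightarrow> ?wH \<xi> * ?wB (\<zeta> - r j *\<^sub>R \<xi>)) + (case x of (\<xi>, \<zeta>) \<Rightarrow> ?wH \<xi> * ?wB \<zeta>))"
    proof (intro always_eventually allI, clarify)
      fix \<xi> \<zeta>
      have "\<Phi> j \<xi> \<zeta> \<le> norm (H \<xi>) * (weight s \<xi> * (?wB (\<zeta> - r j *\<^sub>R \<xi>) + ?wB \<zeta>))"
        unfolding \<Phi>_def by (intro mult_left_mono diff_le) auto
      then show "norm (\<Phi> j \<xi> \<zeta>) \<le> norm (?wH \<xi> * ?wB (\<zeta> - r j *\<^sub>R \<xi>) + ?wH \<xi> * ?wB \<zeta>)"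
        by (simp add: \<Phi>_def abs_mult algebra_simps)
    qed
    show "(\<lambda>(\<xi>, \<zeta>). \<Phi> j \<xi> \<zeta>) \<in> borel_measurable (lborel \<Otimes>\<^sub>M lborel)"
      unfolding \<Phi>_def by measurable
  qed
  have U_meas [measurable]: "U j \<in> borel_measurable borel" for j
    unfolding U_def by measurable
  have U_le: "weight s \<zeta> * norm (U j \<zeta>) \<le> (\<integral>\<xi>. \<Phi> j \<xi> \<zeta> \<partial>lborel)" for j \<zeta>
  proof -
    have "weight s \<zeta> * norm (U j \<zeta>) \<le> weight s \<zeta> * (\<integral>\<xi>. norm (H \<xi> * (B (\<zeta> - r j *\<^sub>R \<xi>) - B \<zeta>)) \<partial>lborel)"
      unfolding U_def r_def by (intro mult_left_mono integral_norm_bound) auto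
    also have "\<dots> = (\<integral>\<xi>. weight s \<zeta> * norm (H \<xi> * (B (\<zeta> - r j *\<^sub>R \<xi>) - B \<zeta>)) \<partial>lborel)"
      by simp
    also have "\<dots> = (\<integral>\<xi>. \<Phi> j \<xi> \<zeta> \<partial>lborel)"
      unfolding \<Phi>_def norm_mult by (simp add: ac_simps)
    finally show ?thesis .
  qed
  have iU: "integrable lborel (\<lambda>\<zeta>. weight s \<zeta> * norm (U j \<zeta>))" for j
  proof (rule Bochner_Integration.integrable_bound[OF lborel_pair.integrable_snd[OF pair[of j]]])
    show "AE \<zeta> in lborel. norm (weight s \<zeta> * norm (U j \<zeta>)) \<le> norm (\<integral>\<xi>. \<Phi> j \<xi> \<zeta> \<partial>lborel)"
      using U_le[THEN order_trans[OF _ abs_ge_self]] by (simp add: abs_mult)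
  qed measurable
  then show "U j \<in> weighted_L1 s"
    by (simp add: weighted_L1_def)

  define I where "I j \<xi> = (\<integral>\<zeta>. weight s \<zeta> * norm (B (\<zeta> - r j *\<^sub>R \<xi>) - B \<zeta>) \<partial>lborel)" for j \<xi>
  have wnorm_U: "wnorm s (U j) \<le> (\<integral>\<xi>. norm (H \<xi>) * I j \<xi> \<partial>lborel)" for j
  proof -
    have "wnorm s (U j) \<le> (\<integral>\<zeta>. (\<integral>\<xi>. \<Phi> j \<xi> \<zeta> \<partial>lborel) \<partial>lborel)"
      unfolding wnorm_def by (rule integral_mono[OF iU lborel_pair.integrable_snd[OF pair] U_le])
    also have "\<dots> = (\<integral>\<xi>. (\<integral>\<zeta>. \<Phi> j \<xi> \<zeta> \<partial>lborel) \<partial>lborel)"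
      by (rule lborel_pair.Fubini_integral[OF pair])
    finally show ?thesis unfolding \<Phi>_def I_def by simp
  qed
  have I_le: "norm (H \<xi>) * I j \<xi> \<le> ?wH \<xi> * (2 * wnorm s B)" for j \<xi>
  proof -
    have "I j \<xi> \<le> (\<integral>\<zeta>. weight s \<xi> * (?wB (\<zeta> - r j *\<^sub>R \<xi>) + ?wB \<zeta>) \<partial>lborel)"
      unfolding I_def
    proof (rule integral_mono'[OF _ diff_le])
      show "integrable lborel (\<lambda>\<zeta>. weight s \<xi> * (?wB (\<zeta> - r j *\<^sub>R \<xi>) + ?wB \<zeta>))"
        using lborel_integrable_translate[OF iwB, of "r j *\<^sub>R \<xi>"] iwB
        by (intro integrable_mult_right Bochner_Integration.integrable_add)
    qed simp
    also have "\<dots> = weight s \<xi> * (2 * wnorm s B)"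
      using lborel_integrable_translate[OF iwB, of "r j *\<^sub>R \<xi>"] iwB
      by (simp add: wnorm_def lborel_integral_translate[of ?wB])
    finally have "norm (H \<xi>) * I j \<xi> \<le> norm (H \<xi>) * (weight s \<xi> * (2 * wnorm s B))"
      by (intro mult_left_mono) auto
    then show ?thesis by (simp add: ac_simps)
  qed
  have I_nonneg: "0 \<le> I j \<xi>" for j \<xi>
    unfolding I_def by (intro Bochner_Integration.integral_nonneg) auto
  have I_lim: "(\<lambda>j. I j \<xi>) \<longlonglongrightarrow> 0" for \<xi>
  proof -
    have "(\<lambda>j. I j \<xi>) \<longlonglongrightarrow> (\<integral>\<zeta>. 0 \<partial>(lborel :: 'a measure))"
      unfolding I_def
    proof (rule integral_dominated_convergence[where w="\<lambda>\<zeta>. D * (weight N \<xi> + 1) * weight (s - N) \<zeta>"])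
      show "integrable lborel (\<lambda>\<zeta>::'a. D * (weight N \<xi> + 1) * weight (s - N) \<zeta>)"
        using N by (intro integrable_mult_right integrable_weight) auto
      show "AE \<zeta> in lborel. (\<lambda>j. weight s \<zeta> * norm (B (\<zeta> - r j *\<^sub>R \<xi>) - B \<zeta>)) \<longlonglongrightarrow> 0"
      proof (intro always_eventually allI)
        fix \<zeta>
        have "r \<longlonglongrightarrow> 0"
          unfolding r_def by (rule LIMSEQ_inverse_real_of_nat)
        then have "(\<lambda>j. \<zeta> - r j *\<^sub>R \<xi>) \<longlonglongrightarrow> \<zeta> - 0 *\<^sub>R \<xi>"
          by (intro tendsto_diff tendsto_scaleR tendsto_const)
        from continuous_on_tendsto_compose[OF B(1) this]
        have "(\<lambda>j. B (\<zeta> - r j *\<^sub>R \<xi>)) \<longlonglongrightarrow> B \<zeta>" by simp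
        then have "(\<lambda>j. weight s \<zeta> * norm (B (\<zeta> - r j *\<^sub>R \<xi>) - B \<zeta>)) \<longlonglongrightarrow> weight s \<zeta> * norm (B \<zeta> - B \<zeta>)"
          by (intro tendsto_intros)
        then show "(\<lambda>j. weight s \<zeta> * norm (B (\<zeta> - r j *\<^sub>R \<xi>) - B \<zeta>)) \<longlonglongrightarrow> 0" by simp
      qed
      show "AE \<zeta> in lborel. norm (weight s \<zeta> * norm (B (\<zeta> - r j *\<^sub>R \<xi>) - B \<zeta>)) \<le> D * (weight N \<xi> + 1) * weight (s - N) \<zeta>" for j
      proof (intro always_eventually allI)
        fix \<zeta>
        have N0: "0 \<le> N" using s N by (auto intro: order_trans[rotated])
        have "norm (B (\<zeta> - r j *\<^sub>R \<xi>)) \<le> D * weight (- N) (\<zeta> - r j *\<^sub>R \<xi>)"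
          by (rule B)
        also have "weight (- N) (\<zeta> - r j *\<^sub>R \<xi>) \<le> weight N (r j *\<^sub>R \<xi>) * weight (- N) \<zeta>"
          using weight_neg_add[OF N0, of \<zeta> "- (r j *\<^sub>R \<xi>)"] by simp
        also have "weight N (r j *\<^sub>R \<xi>) \<le> weight N \<xi>"
          by (rule weight_mono_norm[OF N0 r_norm])
        finally have "norm (B (\<zeta> - r j *\<^sub>R \<xi>) - B \<zeta>) \<le> D * (weight N \<xi> * weight (- N) \<zeta>) + D * weight (- N) \<zeta>"
          using B(2)[of \<zeta>] norm_triangle_ineq4[of "B (\<zeta> - r j *\<^sub>R \<xi>)" "B \<zeta>"] D
          by (simp add: mult_left_mono mult_right_mono)
        then have "weight s \<zeta> * norm (B (\<zeta> - r j *\<^sub>R \<xi>) - B \<zeta>) \<le> weight s \<zeta> * (D * (weight N \<xi> * weight (- N) \<zeta>) + D * weight (- N) \<zeta>)"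
          by (intro mult_left_mono) auto
        also have "\<dots> = D * (weight N \<xi> + 1) * weight (s - N) \<zeta>"
          using weight_add[of s "- N" \<zeta>] by (simp add: algebra_simps)
        finally show "norm (weight s \<zeta> * norm (B (\<zeta> - r j *\<^sub>R \<xi>) - B \<zeta>)) \<le> D * (weight N \<xi> + 1) * weight (s - N) \<zeta>"
          by (simp add: abs_mult)
      qed
    qed measurable
    then show ?thesis by simp
  qed
  have I_meas [measurable]: "I j \<in> borel_measurable borel" for j
    unfolding I_def by measurable
  have "(\<lambda>j. \<integral>\<xi>. norm (H \<xi>) * I j \<xi> \<partial>lborel) \<longlonglongrightarrow> (\<integral>\<xi>. 0 \<partial>(lborel :: 'a measure))"
  proof (rule integral_dominated_convergence[where w="\<lambda>\<xi>. ?wH \<xi> * (2 * wnorm s B)"])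
    show "AE \<xi> in lborel. (\<lambda>j. norm (H \<xi>) * I j \<xi>) \<longlonglongrightarrow> 0"
      using tendsto_mult[OF tendsto_const I_lim] by simp
    show "AE \<xi> in lborel. norm (norm (H \<xi>) * I j \<xi>) \<le> ?wH \<xi> * (2 * wnorm s B)" for j
      using I_le by (simp add: abs_mult I_nonneg)
    show "integrable lborel (\<lambda>\<xi>. ?wH \<xi> * (2 * wnorm s B))"
      by (rule integrable_mult_left) (rule iwH)
  qed measurable
  then have lim: "(\<lambda>j. \<integral>\<xi>. norm (H \<xi>) * I j \<xi> \<partial>lborel) \<longlonglongrightarrow> 0" by simp
  show "(\<lambda>j. wnorm s (U j)) \<longlonglongrightarrow> 0"
    by (rule tendsto_sandwich[OF _ _ tendsto_const lim]) (simp_all add: wnorm_U wnorm_nonneg)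

  show "fourier (U j) y = fourier B y * (fourier H (y /\<^sub>R real (Suc j)) - fourier H 0)"
  proof -
    have p: "integrable (lborel \<Otimes>\<^sub>M lborel) (\<lambda>(\<xi>, \<zeta>). H \<xi> * (B (\<zeta> - r j *\<^sub>R \<xi>) - B \<zeta>) * cis (\<zeta> \<bullet> y))"
    proof (rule Bochner_Integration.integrable_bound[OF pair[of j]])
      show "AE x in lborel \<Otimes>\<^sub>M lborel. norm (case x of (\<xi>, \<zeta>) \<Rightarrow> H \<xi> * (B (\<zeta> - r j *\<^sub>R \<xi>) - B \<zeta>) * cis (\<zeta> \<bullet> y))
          \<le> norm (case x of (\<xi>, \<zeta>) \<Rightarrow> \<Phi> j \<xi> \<zeta>)"
      proof (intro always_eventually allI, clarify)
        fix \<xi> \<zeta>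
        have "1 * norm (B (\<zeta> - r j *\<^sub>R \<xi>) - B \<zeta>) \<le> weight s \<zeta> * norm (B (\<zeta> - r j *\<^sub>R \<xi>) - B \<zeta>)"
          by (intro mult_right_mono weight_ge_1 s) auto
        then show "norm (H \<xi> * (B (\<zeta> - r j *\<^sub>R \<xi>) - B \<zeta>) * cis (\<zeta> \<bullet> y)) \<le> norm (\<Phi> j \<xi> \<zeta>)"
          unfolding \<Phi>_def by (simp add: norm_mult abs_mult mult_left_mono)
      qed
    qed measurable
    have "fourier (U j) y = (\<integral>\<zeta>. (\<integral>\<xi>. H \<xi> * (B (\<zeta> - r j *\<^sub>R \<xi>) - B \<zeta>) * cis (\<zeta> \<bullet> y) \<partial>lborel) \<partial>lborel)"
      unfolding fourier_def U_def r_def by simp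
    also have "\<dots> = (\<integral>\<xi>. (\<integral>\<zeta>. H \<xi> * (B (\<zeta> - r j *\<^sub>R \<xi>) - B \<zeta>) * cis (\<zeta> \<bullet> y) \<partial>lborel) \<partial>lborel)"
      by (rule lborel_pair.Fubini_integral[OF p])
    also have "\<dots> = (\<integral>\<xi>. fourier B y * (H \<xi> * cis (\<xi> \<bullet> (y /\<^sub>R real (Suc j))) - H \<xi> * cis (\<xi> \<bullet> 0)) \<partial>lborel)"
    proof (rule Bochner_Integration.integral_cong[OF refl])
      fix \<xi>
      have i: "integrable lborel (\<lambda>\<zeta>. B (\<zeta> - r j *\<^sub>R \<xi>) * cis (\<zeta> \<bullet> y))"
        by (intro integrable_mult_cis lborel_integrable_translate iB)
      have "(\<integral>\<zeta>. H \<xi> * (B (\<zeta> - r j *\<^sub>R \<xi>) - B \<zeta>) * cis (\<zeta> \<bullet> y) \<partial>lborel)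
          = H \<xi> * (fourier (\<lambda>\<zeta>. B (\<zeta> + - (r j *\<^sub>R \<xi>))) y - fourier B y)"
        unfolding fourier_def using i integrable_mult_cis[OF iB, of y]
        by (simp add: left_diff_distrib mult.assoc)
      also have "\<dots> = H \<xi> * (cis (\<xi> \<bullet> (y /\<^sub>R real (Suc j))) * fourier B y - fourier B y)"
        by (subst fourier_translate) (simp_all add: r_def)
      finally show "(\<integral>\<zeta>. H \<xi> * (B (\<zeta> - r j *\<^sub>R \<xi>) - B \<zeta>) * cis (\<zeta> \<bullet> y) \<partial>lborel)
          = fourier B y * (H \<xi> * cis (\<xi> \<bullet> (y /\<^sub>R real (Suc j))) - H \<xi> * cis (\<xi> \<bullet> 0))"
        by (simp add: algebra_simps)
    qed
    also have "\<dots> = fourier B y * (fourier H (y /\<^sub>R real (Suc j)) - fourier H 0)"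
      unfolding fourier_def[of H] using integrable_mult_cis[OF iH]
      by (simp del: inner_zero_right inner_scaleR_right)
    finally show ?thesis .
  qed
qed

text \<open>A compactly supported bump written as a transform: the bump is even, so its own transform, divided
  by the inversion constant, represents it.\<close>

lemma ex_bump_kernel:
  assumes s: "0 \<le> s"
  shows "\<exists>(B :: 'a::euclidean_space \<Rightarrow> complex) D N. continuous_on UNIV B \<and> (\<forall>\<xi>. norm (B \<xi>) \<le> D * weight (- N) \<xi>) \<and>
     s + 2 * real DIM('a) \<le> N \<and> (\<forall>x. norm x \<le> 1 \<longrightarrow> fourier B x = 1) \<and> (\<forall>x. 2 \<le> norm x \<longrightarrow> fourier B x = 0)"
proof -
  define N where "N = nat \<lceil>s\<rceil> + 2 * DIM('a)"
  have N: "s + 2 * real DIM('a) \<le> real N"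
    using real_nat_ceiling_ge[of s] by (simp add: N_def)
  obtain \<beta> :: "'a \<Rightarrow> real" and D where
    \<beta>: "\<And>x. norm x \<le> 1 \<Longrightarrow> \<beta> x = 1" "\<And>x. 2 \<le> norm x \<Longrightarrow> \<beta> x = 0" "\<And>x. \<beta> (- x) = \<beta> x"
      "continuous_on UNIV \<beta>" "integrable lborel \<beta>"
    and decay: "\<And>\<xi>. norm (fourier (\<lambda>x. complex_of_real (\<beta> x)) \<xi>) \<le> D * weight (- real N) \<xi>"
    using ex_bump_fourier_decay[where 'a='a and N=N] by metis
  define b where "b x = complex_of_real (\<beta> x)" for x
  have b_int: "integrable lborel b" unfolding b_def using \<beta> by simp
  have b_cont: "continuous_on UNIV b" unfolding b_def using \<beta> by (intro continuous_intros)
  have Fb_cont: "continuous_on UNIV (fourier b)" by (rule continuous_on_fourier[OF b_int])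
  have decay: "norm (fourier b \<xi>) \<le> D * weight (- real N) \<xi>" for \<xi>
    using decay[of \<xi>] by (simp add: b_def[abs_def])
  have Fb_int: "integrable lborel (fourier b)"
    using N s by (intro integrable_weight_bound[OF Fb_cont decay]) simp
  obtain c where c: "c \<noteq> 0" and inv: "\<And>t. fourier (fourier b) t = c * b (- t)"
    using fourier_inversion[where 'a='a] b_cont b_int Fb_int by metis
  define B where "B \<xi> = inverse c * fourier b \<xi>" for \<xi>
  have FB: "fourier B x = b x" for x
    unfolding B_def fourier_cmult inv using c \<beta>(3) by (simp add: b_def)
  have "norm (B \<xi>) \<le> (norm (inverse c) * D) * weight (- real N) \<xi>" for \<xi>
    using mult_left_mono[OF decay[of \<xi>], of "norm (inverse c)"] by (simp add: B_def norm_mult mult.assoc)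
  moreover have "continuous_on UNIV B"
    unfolding B_def by (intro continuous_intros Fb_cont)
  ultimately show ?thesis
    using N \<beta>(1,2) by (intro exI[of _ B] exI[of _ "norm (inverse c) * D"] exI[of _ "real N"]) (simp add: FB b_def)
qed

lemma norm_scaleR_inverse: "0 < r \<Longrightarrow> norm (v /\<^sub>R r) = norm v / r"
  by (simp add: divide_inverse mult.commute)

lemma fourier_algebra_bump:
  assumes s: "0 \<le> s" and r: "0 < r"
  shows "\<exists>b\<in>fourier_algebra s. (\<forall>x::'a::euclidean_space. norm (x - x0) \<le> r \<longrightarrow> b x = 1) \<and> (\<forall>x. 2 * r \<le> norm (x - x0) \<longrightarrow> b x = 0)"
proof -
  obtain B :: "'a \<Rightarrow> complex" and D N where B: "continuous_on UNIV B" "\<And>\<xi>. norm (B \<xi>) \<le> D * weight (- N) \<xi>"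
    "s + 2 * real DIM('a) \<le> N" "\<And>x. norm x \<le> 1 \<Longrightarrow> fourier B x = 1" "\<And>x. 2 \<le> norm x \<Longrightarrow> fourier B x = 0"
    using ex_bump_kernel[OF s, where 'a='a] by metis
  have "B \<in> weighted_L1 s"
    by (rule weighted_L1_bound[OF borel_measurable_continuous_onI[OF B(1)] B(2,3)])
  then have "fourier B \<in> fourier_algebra s" by (rule fourier_algebraI) simp
  then have "(\<lambda>x. fourier B ((x - x0) /\<^sub>R r)) \<in> fourier_algebra s"
    by (rule fourier_algebra_affine[OF s _ r])
  moreover have "fourier B ((x - x0) /\<^sub>R r) = 1" if "norm (x - x0) \<le> r" for x
    using that r by (intro B(4)) (subst norm_scaleR_inverse, simp_all)
  moreover have "fourier B ((x - x0) /\<^sub>R r) = 0" if "2 * r \<le> norm (x - x0)" for x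
    using that r by (intro B(5)) (subst norm_scaleR_inverse, simp_all add: pos_le_divide_eq)
  ultimately show ?thesis
    by (intro bexI[of _ "\<lambda>x. fourier B ((x - x0) /\<^sub>R r)"] conjI allI impI)
qed

text \<open>Dilating around \<open>x0\<close> makes the localized increment of \<open>h\<close> smaller in norm than the radius of
  convergence of \<open>F\<close> at \<open>h x0\<close>. The Taylor series then converges in the algebra, and undoing the
  dilation leaves the algebra invariant. The constant Taylor term is supplied by a multiple of the
  bump.\<close>

theorem wiener_levy_local:
  fixes h :: "'a::euclidean_space \<Rightarrow> complex"
  assumes s: "0 \<le> s" and h: "h \<in> fourier_algebra s" and F: "F analytic_on {h x0}"
  shows "\<exists>g\<in>fourier_algebra s. \<exists>\<delta>>0. \<forall>x. norm (x - x0) \<le> \<delta> \<longrightarrow> g x = F (h x)"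
proof -
  obtain H0 where H0: "H0 \<in> weighted_L1 s" "h = fourier H0"
    using h by (auto simp: fourier_algebra_def)
  \<comment> \<open>Modulation moves the point \<open>x0\<close> to the origin.\<close>
  define H where "H \<xi> = H0 \<xi> * cis (\<xi> \<bullet> x0)" for \<xi>
  have [measurable]: "H0 \<in> borel_measurable borel" using H0(1) by (rule weighted_L1_measurable)
  have H: "H \<in> weighted_L1 s"
    using H0(1) by (simp add: weighted_L1_def H_def[abs_def] norm_mult)
  have FH: "fourier H y = h (y + x0)" for y
    unfolding H_def fourier_modulate H0(2) ..
  obtain R where R: "0 < R" "F holomorphic_on ball (h x0) R"
    using F unfolding analytic_on_def by auto
  define a where "a m = (deriv ^^ m) F (h x0) / fact m" for m
  have a: "(\<lambda>m. a m * (z - h x0) ^ m) sums F z" if "z \<in> ball (h x0) R" for z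
    unfolding a_def by (rule holomorphic_power_series[OF R(2) that])
  obtain B :: "'a \<Rightarrow> complex" and D N where B: "continuous_on UNIV B" "\<And>\<xi>. norm (B \<xi>) \<le> D * weight (- N) \<xi>"
    "s + 2 * real DIM('a) \<le> N" "\<And>x. norm x \<le> 1 \<Longrightarrow> fourier B x = 1"
    using ex_bump_kernel[OF s, where 'a='a] by metis
  have BL: "B \<in> weighted_L1 s"
    by (rule weighted_L1_bound[OF borel_measurable_continuous_onI[OF B(1)] B(2,3)])
  define U where "U j \<zeta> = (\<integral>\<xi>. H \<xi> * (B (\<zeta> - inverse (real (Suc j)) *\<^sub>R \<xi>) - B \<zeta>) \<partial>lborel)" for j \<zeta>
  note U = weighted_translate_difference_small[OF s H B(1,2,3), folded U_def]
  have "\<forall>\<^sub>F j in sequentially. wnorm s (U j) < R"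
    using U(3) R(1) by (rule order_tendstoD(2))
  then obtain j where j: "wnorm s (U j) < R"
    by (auto simp: eventually_sequentially)
  define m where "m = real (Suc j)"
  have m: "0 < m" by (simp add: m_def)
  have summ: "summable (\<lambda>k. norm (a k) * wnorm s (U j) ^ k)"
  proof -
    \<comment> \<open>Convergence at the larger radius \<open>\<rho>\<close> gives absolute convergence at the norm of \<open>U j\<close>.\<close>
    define \<rho> where "\<rho> = (wnorm s (U j) + R) / 2"
    have \<rho>: "wnorm s (U j) < \<rho>" "\<rho> < R" "0 < \<rho>"
      using j wnorm_nonneg[of s "U j"] R(1) by (auto simp: \<rho>_def)
    have "summable (\<lambda>k. a k * complex_of_real \<rho> ^ k)"
      using a[of "h x0 + of_real \<rho>"] \<rho> by (auto simp: dist_norm sums_iff)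
    from powser_insidea[OF this, of "of_real (wnorm s (U j))"] \<rho> wnorm_nonneg[of s "U j"]
    show ?thesis by (simp add: norm_mult norm_power)
  qed
  from weighted_L1_power_series[OF s U(1) summ] obtain G where
    G: "G \<in> weighted_L1 s" "\<And>x. (\<lambda>k. a (Suc k) * fourier (U j) x ^ Suc k) sums fourier G x" by blast
  have FG: "fourier G y = F (h (x0 + y /\<^sub>R m)) - F (h x0)" if "norm y \<le> 1" for y
  proof -
    have u: "fourier (U j) y = h (x0 + y /\<^sub>R m) - h x0"
      using U(2)[of j y] B(4)[OF that] by (simp add: FH m_def add.commute)
    have "norm (h (x0 + y /\<^sub>R m) - h x0) < R"
      using norm_fourier_le_wnorm[OF U(1) s, of j y] j u by simp
    then have "h (x0 + y /\<^sub>R m) \<in> ball (h x0) R"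
      by (simp add: dist_norm norm_minus_commute)
    from a[OF this] have "(\<lambda>k. a (Suc k) * (h (x0 + y /\<^sub>R m) - h x0) ^ Suc k) sums (F (h (x0 + y /\<^sub>R m)) - a 0)"
      by (subst sums_Suc_iff[of "\<lambda>k. a k * (h (x0 + y /\<^sub>R m) - h x0) ^ k"]) simp
    moreover have "a 0 = F (h x0)" by (simp add: a_def)
    ultimately show ?thesis
      using G(2)[of y] u sums_unique2 by force
  qed
  define g where "g x = fourier G ((x - x0) /\<^sub>R inverse m) + F (h x0) * fourier B ((x - x0) /\<^sub>R inverse m)" for x
  have "g \<in> fourier_algebra s"
    unfolding g_def using m
    by (intro fourier_algebra_add fourier_algebra_cmult fourier_algebra_affine s)
      (auto intro: fourier_algebraI G(1) BL)
  moreover have "g x = F (h x)" if "norm (x - x0) \<le> inverse m" for x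
  proof -
    have "norm ((x - x0) /\<^sub>R inverse m) \<le> 1"
      using that m by (subst norm_scaleR_inverse) (simp_all add: field_simps)
    from FG[OF this] B(4)[OF this] show ?thesis
      using m by (simp add: g_def)
  qed
  ultimately show ?thesis
    using m by (intro bexI[of _ g] exI[of _ "inverse m"]) auto
qed

section \<open>Schwartz functions\<close>

lemma partials_append: "partials (ks @ ls) \<psi> = partials ks (partials ls \<psi>)"
  by (induction ks) auto

lemma schwartz_partial:
  fixes \<psi> :: "real ^ 'n \<Rightarrow> complex"
  assumes "\<psi> \<in> schwartz"
  shows "(\<lambda>x. frechet_derivative \<psi> (at x) (axis k 1)) \<in> schwartz"
  unfolding schwartz_def
proof (intro CollectI allI)
  fix ks
  have "partials ks (\<lambda>x. frechet_derivative \<psi> (at x) (axis k 1)) = partials (ks @ [k]) \<psi>"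
    by (simp add: partials_append)
  then show "partials ks (\<lambda>x. frechet_derivative \<psi> (at x) (axis k 1)) differentiable_on UNIV \<and>
     (\<forall>N. bounded (range (\<lambda>x. jbracket x ^ N *\<^sub>R partials ks (\<lambda>x. frechet_derivative \<psi> (at x) (axis k 1)) x)))"
    using assms unfolding schwartz_def mem_Collect_eq by (simp only: simp_thms)
qed

text \<open>Membership in the Schwartz space without computing iterated partial derivatives: it is enough to
  exhibit a class of rapidly decaying differentiable functions closed under partial derivatives.\<close>

lemma schwartz_coinduct:
  fixes \<psi> :: "real ^ 'n \<Rightarrow> complex"
  assumes "\<psi> \<in> S"
    and diff: "\<And>\<psi>. \<psi> \<in> S \<Longrightarrow> \<psi> differentiable_on UNIV"
    and bdd: "\<And>\<psi> N. \<psi> \<in> S \<Longrightarrow> bounded (range (\<lambda>x. jbracket x ^ N *\<^sub>R \<psi> x))"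
    and partial: "\<And>\<psi> k. \<psi> \<in> S \<Longrightarrow> (\<lambda>x. frechet_derivative \<psi> (at x) (axis k 1)) \<in> S"
  shows "\<psi> \<in> schwartz"
proof -
  have "partials ks \<psi> \<in> S" for ks
    by (induction ks) (auto simp: assms(1) intro: partial)
  then show ?thesis
    unfolding schwartz_def using diff bdd by blast
qed

lemma schwartz_has_derivative:
  fixes \<psi> :: "real ^ 'n \<Rightarrow> complex"
  assumes "\<psi> \<in> schwartz"
  shows "(\<psi> has_derivative frechet_derivative \<psi> (at x)) (at x)"
proof -
  have "partials [] \<psi> differentiable_on UNIV"
    using assms unfolding schwartz_def by blast
  then show ?thesis
    by (simp add: differentiable_on_def frechet_derivative_works)
qed

lemma schwartz_continuous: "\<psi> \<in> schwartz \<Longrightarrow> continuous_on UNIV \<psi>"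
  by (meson schwartz_has_derivative has_derivative_continuous continuous_at_imp_continuous_on)

lemma jbracket_le_norm: "jbracket x \<le> 1 + norm x"
  unfolding jbracket_def by (rule real_le_lsqrt) (simp_all add: power2_eq_square algebra_simps)

lemma norm_le_jbracket: "1 + norm x \<le> 2 * jbracket x"
proof -
  have "1 \<le> jbracket x" "norm x \<le> jbracket x"
    unfolding jbracket_def by (auto intro: real_le_rsqrt)
  then show ?thesis by simp
qed

lemma jbracket_ge_1: "1 \<le> jbracket x"
  unfolding jbracket_def by simp

lemma bounded_jbracketI:
  fixes \<psi> :: "real ^ 'n \<Rightarrow> complex"
  assumes "\<And>t. norm (\<psi> t) \<le> C * weight (- real N) t"
  shows "bounded (range (\<lambda>t. jbracket t ^ N *\<^sub>R \<psi> t))"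
  unfolding bounded_iff
proof (intro exI[of _ C] ballI, clarify)
  fix t :: "real ^ 'n"
  have "jbracket t ^ N \<le> weight (real N) t"
    unfolding weight_def using jbracket_le_norm[of t] jbracket_ge_1[of t]
    by (simp add: powr_realpow power_mono)
  then have "norm (jbracket t ^ N *\<^sub>R \<psi> t) \<le> weight (real N) t * (C * weight (- real N) t)"
    using assms[of t] jbracket_ge_1[of t] by (auto intro!: mult_mono)
  also have "\<dots> = C * (weight (real N) t * weight (- real N) t)"
    by (simp only: ac_simps)
  finally show "norm (jbracket t ^ N *\<^sub>R \<psi> t) \<le> C" by simp
qed

lemma schwartz_decay:
  fixes \<psi> :: "real ^ 'n \<Rightarrow> complex"
  assumes "\<psi> \<in> schwartz"
  shows "\<exists>C. \<forall>t. norm (\<psi> t) \<le> C * weight (- M) t"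
proof -
  define N where "N = nat \<lceil>M\<rceil>"
  have MN: "M \<le> real N" unfolding N_def by (rule real_nat_ceiling_ge)
  have "bounded (range (\<lambda>x. jbracket x ^ N *\<^sub>R partials [] \<psi> x))"
    using assms unfolding schwartz_def by blast
  then obtain C where C: "\<And>t. norm (jbracket t ^ N *\<^sub>R \<psi> t) \<le> C"
    unfolding bounded_iff by auto
  have C0: "0 \<le> C" using order_trans[OF norm_ge_zero C[of 0]] .
  have "norm (\<psi> t) \<le> (2 ^ N * C) * weight (- M) t" for t
  proof -
    have "weight (real N) t \<le> (2 * jbracket t) ^ N"
      using power_mono[OF norm_le_jbracket[of t], of N] by (simp only: weight_def powr_realpow one_plus_norm_pos) simp
    then have "weight (real N) t * norm (\<psi> t) \<le> (2 * jbracket t) ^ N * norm (\<psi> t)"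
      by (intro mult_right_mono) auto
    also have "\<dots> = 2 ^ N * norm (jbracket t ^ N *\<^sub>R \<psi> t)"
      using jbracket_ge_1[of t] by (simp add: power_mult_distrib)
    also have "\<dots> \<le> 2 ^ N * C" by (intro mult_left_mono C) auto
    finally have "weight (- real N) t * (weight (real N) t * norm (\<psi> t)) \<le> weight (- real N) t * (2 ^ N * C)"
      by (intro mult_left_mono) auto
    then have "norm (\<psi> t) \<le> weight (- real N) t * (2 ^ N * C)"
      by (simp add: mult.assoc[symmetric])
    also have "\<dots> \<le> weight (- M) t * (2 ^ N * C)"
      using MN C0 by (intro mult_right_mono weight_mono) auto
    finally show ?thesis by (simp add: mult.commute)
  qed
  then show ?thesis by blast
qed

lemma schwartz_lincomb:
  fixes \<psi> \<eta> :: "real ^ 'n \<Rightarrow> complex"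
  assumes "\<psi> \<in> schwartz" "\<eta> \<in> schwartz"
  shows "(\<lambda>t. c * \<psi> t + d * \<eta> t) \<in> schwartz"
proof (rule schwartz_coinduct[where S="{\<lambda>t. c * \<psi> t + d * \<eta> t |\<psi> \<eta>. \<psi> \<in> schwartz \<and> \<eta> \<in> schwartz}"])
  show "(\<lambda>t. c * \<psi> t + d * \<eta> t) \<in> {\<lambda>t. c * \<psi> t + d * \<eta> t |\<psi> \<eta>. \<psi> \<in> schwartz \<and> \<eta> \<in> schwartz}"
    using assms by blast
next
  fix \<theta> :: "real ^ 'n \<Rightarrow> complex" assume "\<theta> \<in> {\<lambda>t. c * \<psi> t + d * \<eta> t |\<psi> \<eta>. \<psi> \<in> schwartz \<and> \<eta> \<in> schwartz}"
  then obtain \<psi> \<eta> where \<theta>: "\<theta> = (\<lambda>t. c * \<psi> t + d * \<eta> t)" "\<psi> \<in> schwartz" "\<eta> \<in> schwartz" by blast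
  have der: "(\<theta> has_derivative (\<lambda>h. c * frechet_derivative \<psi> (at x) h + d * frechet_derivative \<eta> (at x) h)) (at x)" for x
    unfolding \<theta>(1)
    by (intro has_derivative_add has_derivative_mult_right schwartz_has_derivative \<theta>)
  then show "\<theta> differentiable_on UNIV"
    unfolding differentiable_on_def differentiable_def by blast
  have eq: "(\<lambda>x. frechet_derivative \<theta> (at x) (axis k 1))
      = (\<lambda>x. c * frechet_derivative \<psi> (at x) (axis k 1) + d * frechet_derivative \<eta> (at x) (axis k 1))" for k
    using frechet_derivative_at[OF der, symmetric] by simp
  show "(\<lambda>x. frechet_derivative \<theta> (at x) (axis k 1)) \<in> {\<lambda>t. c * \<psi> t + d * \<eta> t |\<psi> \<eta>. \<psi> \<in> schwartz \<and> \<eta> \<in> schwartz}" for k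
    unfolding eq
    by (rule CollectI, rule exI[of _ "\<lambda>x. frechet_derivative \<psi> (at x) (axis k 1)"],
        rule exI[of _ "\<lambda>x. frechet_derivative \<eta> (at x) (axis k 1)"])
      (intro conjI refl schwartz_partial \<theta>)
  show "bounded (range (\<lambda>x. jbracket x ^ N *\<^sub>R \<theta> x))" for N
  proof -
    obtain C1 C2 where C: "\<And>t. norm (\<psi> t) \<le> C1 * weight (- real N) t" "\<And>t. norm (\<eta> t) \<le> C2 * weight (- real N) t"
      using schwartz_decay \<theta>(2,3) by metis
    have "norm (\<theta> t) \<le> (norm c * C1 + norm d * C2) * weight (- real N) t" for t
    proof -
      have "norm (\<theta> t) \<le> norm c * norm (\<psi> t) + norm d * norm (\<eta> t)"
        unfolding \<theta>(1) norm_mult[symmetric] by (rule norm_triangle_ineq)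
      also have "\<dots> \<le> norm c * (C1 * weight (- real N) t) + norm d * (C2 * weight (- real N) t)"
        by (intro add_mono mult_left_mono C) auto
      finally show ?thesis by (simp add: algebra_simps)
    qed
    then show ?thesis by (rule bounded_jbracketI)
  qed
qed

text \<open>The test functions that occur in the short-time Fourier transform. The class of all of them, for
  fixed \<open>x\<close> and \<open>\<xi>\<close>, is closed under partial derivatives: differentiating the exponential only
  replaces \<open>\<psi>\<close> by a linear combination of \<open>\<psi>\<close> and its partial derivative.\<close>

lemma schwartz_time_frequency_shift:
  fixes \<psi> :: "real ^ 'n \<Rightarrow> complex"
  assumes "\<psi> \<in> schwartz"
  shows "(\<lambda>t. cnj (\<psi> (t - x)) * cis (t \<bullet> \<xi>)) \<in> schwartz"
proof (rule schwartz_coinduct[where S="{\<lambda>t. cnj (\<psi> (t - x)) * cis (t \<bullet> \<xi>) |\<psi>. \<psi> \<in> schwartz}"])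
  show "(\<lambda>t. cnj (\<psi> (t - x)) * cis (t \<bullet> \<xi>)) \<in> {\<lambda>t. cnj (\<psi> (t - x)) * cis (t \<bullet> \<xi>) |\<psi>. \<psi> \<in> schwartz}"
    using assms by blast
next
  fix \<theta> :: "real ^ 'n \<Rightarrow> complex" assume "\<theta> \<in> {\<lambda>t. cnj (\<psi> (t - x)) * cis (t \<bullet> \<xi>) |\<psi>. \<psi> \<in> schwartz}"
  then obtain \<psi> where \<theta>: "\<theta> = (\<lambda>t. cnj (\<psi> (t - x)) * cis (t \<bullet> \<xi>))" "\<psi> \<in> schwartz" by blast
  let ?D = "\<lambda>t. frechet_derivative \<psi> (at t)"
  have der: "(\<theta> has_derivative (\<lambda>h. cnj (\<psi> (t - x)) * ((h \<bullet> \<xi>) *\<^sub>R (\<i> * cis (t \<bullet> \<xi>))) + cnj (?D (t - x) h) * cis (t \<bullet> \<xi>))) (at t)" for t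
  proof -
    have "((\<lambda>t. \<psi> (t - x)) has_derivative ?D (t - x)) (at t)"
    proof (rule has_derivative_compose[OF _ schwartz_has_derivative[OF \<theta>(2)]])
      show "((\<lambda>t. t - x) has_derivative (\<lambda>h. h)) (at t)"
        by (auto intro!: derivative_eq_intros)
    qed
    then have 1: "((\<lambda>t. cnj (\<psi> (t - x))) has_derivative (\<lambda>h. cnj (?D (t - x) h))) (at t)"
      by (rule has_derivative_cnj)
    have "((\<lambda>r. cis r) has_derivative (\<lambda>h. h *\<^sub>R (\<i> * cis (t \<bullet> \<xi>)))) (at (t \<bullet> \<xi>))"
    proof -
      have "((\<lambda>z. exp (\<i> * z)) has_field_derivative exp (\<i> * of_real (t \<bullet> \<xi>)) * (\<i> * 1)) (at (of_real (t \<bullet> \<xi>)))"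
        by (intro DERIV_fun_exp DERIV_cmult DERIV_ident)
      from has_vector_derivative_real_field[OF this, of UNIV] show ?thesis
        by (simp add: cis_conv_exp[symmetric] has_vector_derivative_def mult.commute)
    qed
    from has_derivative_compose[where f="\<lambda>t. t \<bullet> \<xi>", OF bounded_linear_imp_has_derivative[OF bounded_linear_inner_left] this]
    have 2: "((\<lambda>t. cis (t \<bullet> \<xi>)) has_derivative (\<lambda>h. (h \<bullet> \<xi>) *\<^sub>R (\<i> * cis (t \<bullet> \<xi>)))) (at t)" .
    show ?thesis
      unfolding \<theta>(1) by (rule has_derivative_mult[OF 1 2])
  qed
  then show "\<theta> differentiable_on UNIV"
    unfolding differentiable_on_def differentiable_def by blast
  show "(\<lambda>t. frechet_derivative \<theta> (at t) (axis k 1)) \<in> {\<lambda>t. cnj (\<psi> (t - x)) * cis (t \<bullet> \<xi>) |\<psi>. \<psi> \<in> schwartz}" for k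
  proof -
    define \<psi>' where "\<psi>' t = 1 * ?D t (axis k 1) + (- \<i> * complex_of_real (\<xi> $ k)) * \<psi> t" for t
    have "\<psi>' \<in> schwartz"
      unfolding \<psi>'_def by (intro schwartz_lincomb schwartz_partial \<theta>)
    moreover have "frechet_derivative \<theta> (at t) (axis k 1) = cnj (\<psi>' (t - x)) * cis (t \<bullet> \<xi>)" for t
      unfolding frechet_derivative_at[OF der, symmetric] \<psi>'_def
      by (simp add: inner_axis' scaleR_conv_of_real algebra_simps)
    ultimately show ?thesis by blast
  qed
  show "bounded (range (\<lambda>t. jbracket t ^ N *\<^sub>R \<theta> t))" for N
  proof -
    obtain C where C: "\<And>t. norm (\<psi> t) \<le> C * weight (- real N) t"
      using schwartz_decay \<theta>(2) by metis
    have C0: "0 \<le> C"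
      using order_trans[OF norm_ge_zero C[of 0]] by (simp add: zero_le_mult_iff weight_def)
    have "norm (\<theta> t) \<le> (C * weight (real N) x) * weight (- real N) t" for t
    proof -
      have "norm (\<theta> t) \<le> C * weight (- real N) (t - x)"
        using C[of "t - x"] by (simp add: \<theta>(1) norm_mult)
      also have "\<dots> \<le> C * (weight (real N) x * weight (- real N) t)"
        using weight_neg_add[of "real N" t "- x"] by (intro mult_left_mono C0) simp
      finally show ?thesis by (simp add: mult.assoc)
    qed
    then show ?thesis by (rule bounded_jbracketI)
  qed
qed

text \<open>The link between the Frechet derivatives in the definition of the Schwartz space and derivatives
  along coordinate lines.\<close>

lemma schwartz_Ck_bounded_axis:
  fixes \<psi> :: "real ^ 'n \<Rightarrow> complex"
  assumes "\<psi> \<in> schwartz"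
  shows "\<exists>C. Ck_bounded N (axis k 1) (\<lambda>t. C * weight (- M) t) \<psi>"
  using assms
proof (induction N arbitrary: \<psi>)
  case 0
  then show ?case
    using schwartz_decay[OF 0, of M] schwartz_continuous[OF 0] by auto
next
  case (Suc N)
  let ?d = "\<lambda>x. frechet_derivative \<psi> (at x) (axis k 1)"
  obtain C1 where C1: "Ck_bounded N (axis k 1) (\<lambda>t. C1 * weight (- M) t) ?d"
    using Suc.IH[OF schwartz_partial[OF Suc.prems, of k]] by blast
  obtain C2 where C2: "\<And>t. norm (\<psi> t) \<le> C2 * weight (- M) t"
    using schwartz_decay[OF Suc.prems, of M] by blast
  have "Ck_bounded (Suc N) (axis k 1) (\<lambda>t. max C1 C2 * weight (- M) t) \<psi>"
    unfolding Ck_bounded.simps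
  proof (intro conjI allI exI[of _ ?d])
    show "continuous_on UNIV \<psi>" by (rule schwartz_continuous[OF Suc.prems])
    show "norm (\<psi> t) \<le> max C1 C2 * weight (- M) t" for t
      by (rule order_trans[OF C2]) (auto intro: mult_right_mono)
    show "Ck_bounded N (axis k 1) (\<lambda>t. max C1 C2 * weight (- M) t) ?d"
      by (rule Ck_bounded_mono[OF C1]) (auto intro: mult_right_mono)
    fix t :: "real ^ 'n" and r :: real
    let ?x = "t + r *\<^sub>R axis k 1"
    have D: "(\<psi> has_derivative frechet_derivative \<psi> (at ?x)) (at ?x)"
      by (rule schwartz_has_derivative[OF Suc.prems])
    have "((\<lambda>r. t + r *\<^sub>R axis k 1) has_derivative (\<lambda>h. h *\<^sub>R axis k 1)) (at r)"
      by (auto intro!: derivative_eq_intros)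
    from has_derivative_compose[OF this D]
    have "((\<lambda>r. \<psi> (t + r *\<^sub>R axis k 1)) has_derivative (\<lambda>h. frechet_derivative \<psi> (at ?x) (h *\<^sub>R axis k 1))) (at r)" .
    moreover have "frechet_derivative \<psi> (at ?x) (h *\<^sub>R axis k 1) = h *\<^sub>R ?d ?x" for h
      by (rule linear_scale[OF has_derivative_linear[OF D]])
    ultimately show "((\<lambda>r. \<psi> (t + r *\<^sub>R axis k 1)) has_vector_derivative ?d ?x) (at r)"
      by (simp add: has_vector_derivative_def)
  qed
  then show ?case by blast
qed

lemma schwartz_Ck_bounded:
  fixes \<psi> :: "real ^ 'n \<Rightarrow> complex"
  assumes "\<psi> \<in> schwartz"
  shows "\<exists>C. \<forall>e\<in>Basis. Ck_bounded N e (\<lambda>t. C * weight (- M) t) \<psi>"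
proof -
  have "\<forall>k. \<exists>C. Ck_bounded N (axis k 1) (\<lambda>t. C * weight (- M) t) \<psi>"
    by (intro allI schwartz_Ck_bounded_axis[OF assms])
  from choice[OF this] obtain C where C: "\<And>k. Ck_bounded N (axis k 1) (\<lambda>t. C k * weight (- M) t) \<psi>"
    by blast
  have "Ck_bounded N e (\<lambda>t. Max (range C) * weight (- M) t) \<psi>" if e: "e \<in> Basis" for e
  proof -
    obtain k where "e = axis k 1" using e by (auto simp: Basis_vec_def)
    then show ?thesis
      by (auto intro!: Ck_bounded_mono[OF C[of k]] mult_right_mono)
  qed
  then show ?thesis by blast
qed

lemma schwartz_bound_integrable:
  fixes \<psi> :: "real ^ 'n \<Rightarrow> complex"
  assumes "\<psi> \<in> schwartz"
  shows "integrable lborel \<psi>"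
proof -
  obtain C where "\<And>t. norm (\<psi> t) \<le> C * weight (- (2 * real DIM(real ^ 'n))) t"
    using schwartz_decay[OF assms] by metis
  then show ?thesis
    by (rule integrable_weight_bound[OF schwartz_continuous[OF assms] _ order_refl])
qed

lemma schwartz_subset_fourier_algebra:
  fixes \<psi> :: "real ^ 'n \<Rightarrow> complex"
  assumes s: "0 \<le> s" and \<psi>: "\<psi> \<in> schwartz"
  shows "\<psi> \<in> fourier_algebra s"
proof (rule fourier_algebra_if_fourier_weighted_L1[OF s])
  let ?M = "2 * real DIM(real ^ 'n)"
  define N where "N = nat \<lceil>s\<rceil> + 2 * DIM(real ^ 'n)"
  have N: "s + ?M \<le> real N"
    using real_nat_ceiling_ge[of s] by (simp add: N_def)
  obtain C where "\<And>e. e \<in> Basis \<Longrightarrow> Ck_bounded N e (\<lambda>t. C * weight (- ?M) t) \<psi>"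
    using schwartz_Ck_bounded[OF \<psi>, of N ?M] by blast
  from fourier_Ck_bounded_decay[OF this order_refl]
  show "fourier \<psi> \<in> weighted_L1 s"
    by (rule weighted_L1_bound[OF measurable_fourier[OF schwartz_bound_integrable[OF \<psi>]] _ N])
qed (use \<psi> in \<open>auto intro: schwartz_continuous schwartz_bound_integrable\<close>)

section \<open>From modulation spaces to the Fourier algebra\<close>

lemma exp_eq_cis_inner: "exp (- (\<i> * complex_of_real (t \<bullet> \<xi>))) = cis (t \<bullet> (- \<xi>))"
  by (simp add: cis_conv_exp)

text \<open>On a set of finite measure the \<open>L\<^sup>1\<close> norm is controlled by the \<open>L\<^sup>p\<close> norm \<open>N\<close>. In place of
  Hoelder's inequality this integrates the pointwise bound \<open>v \<le> N + N powr (1 - p) * v powr p\<close>, whose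
  first term suffices where \<open>v \<le> N\<close> and whose second term suffices elsewhere.\<close>

lemma nn_integral_indicator_le_ennpowr:
  fixes v :: "'a \<Rightarrow> real"
  assumes p: "1 \<le> p" and v [measurable]: "v \<in> borel_measurable M" and v0: "\<And>x. 0 \<le> v x"
    and B [measurable]: "B \<in> sets M" and fin: "emeasure M B = ennreal \<beta>" "0 \<le> \<beta>"
  shows "(\<integral>\<^sup>+x. ennreal (v x) * indicator B x \<partial>M) \<le> ennreal (1 + \<beta>) * ennpowr (\<integral>\<^sup>+x. ennreal (v x powr p) \<partial>M) (1 / p)"
proof -
  let ?A = "\<integral>\<^sup>+x. ennreal (v x powr p) \<partial>M"
  show ?thesis
  proof (cases "?A = \<infinity>")
    case True
    then show ?thesis using fin by (simp add: ennpowr_def ennreal_mult_top)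
  next
    case False
    then obtain \<alpha> where \<alpha>: "0 \<le> \<alpha>" "?A = ennreal \<alpha>" by (cases ?A) auto
    define N where "N = \<alpha> powr (1 / p)"
    have pow: "ennpowr ?A (1 / p) = ennreal N"
      using False \<alpha> by (simp add: ennpowr_def N_def)
    show ?thesis
    proof (cases "\<alpha> = 0")
      case True
      then have "?A = 0" using \<alpha> by simp
      then have "AE x in M. ennreal (v x powr p) = 0"
        by (subst (asm) nn_integral_0_iff_AE) auto
      then have "AE x in M. ennreal (v x) * indicator B x = 0"
        by eventually_elim (auto simp: ennreal_eq_0_iff)
      then have "(\<integral>\<^sup>+x. ennreal (v x) * indicator B x \<partial>M) = (\<integral>\<^sup>+x. 0 \<partial>M)"
        by (rule nn_integral_cong_AE)
      then show ?thesis by simp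
    next
      case False
      then have N: "0 < N" using \<alpha> by (simp add: N_def)
      have le: "v x \<le> N + N powr (1 - p) * v x powr p" for x
      proof (cases "v x \<le> N")
        case True
        then show ?thesis by (auto intro: order_trans)
      next
        case False
        then have "v x = v x powr (1 - p) * v x powr p"
          using N by (simp add: powr_add[symmetric])
        also have "\<dots> \<le> N powr (1 - p) * v x powr p"
          using False N p by (intro mult_right_mono powr_mono2') auto
        finally show ?thesis using N by simp
      qed
      have "(\<integral>\<^sup>+x. ennreal (v x) * indicator B x \<partial>M)
          \<le> (\<integral>\<^sup>+x. ennreal N * indicator B x + ennreal (N powr (1 - p)) * ennreal (v x powr p) \<partial>M)"
      proof (rule nn_integral_mono)
        fix x
        have "ennreal (v x) \<le> ennreal N + ennreal (N powr (1 - p)) * ennreal (v x powr p)"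
          using le[of x] N by (simp add: ennreal_mult[symmetric] ennreal_plus[symmetric] ennreal_leI del: ennreal_plus)
        then show "ennreal (v x) * indicator B x \<le> ennreal N * indicator B x + ennreal (N powr (1 - p)) * ennreal (v x powr p)"
          by (auto simp: indicator_def)
      qed
      also have "\<dots> = ennreal N * emeasure M B + ennreal (N powr (1 - p)) * ?A"
        by (simp add: nn_integral_add nn_integral_cmult)
      also have "\<dots> = ennreal (N * \<beta> + N powr (1 - p) * \<alpha>)"
        using N \<alpha> fin by (simp add: ennreal_mult[symmetric] ennreal_plus[symmetric] del: ennreal_plus)
      also have "N powr (1 - p) * \<alpha> = N"
      proof -
        have "N powr p = \<alpha>"
          using \<alpha> False p by (simp add: N_def powr_powr)
        then show ?thesis using N powr_add[of N "1 - p" p] by simp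
      qed
      also have "ennreal (N * \<beta> + N) = ennreal (1 + \<beta>) * ennpowr ?A (1 / p)"
        unfolding pow using N fin by (simp add: ennreal_mult[symmetric] algebra_simps del: ennreal_plus)
      finally show ?thesis .
    qed
  qed
qed

lemma weight_le_jbracket:
  assumes "0 \<le> s"
  shows "weight s \<xi> \<le> 2 powr s * jbracket \<xi> powr s"
  unfolding weight_def using norm_le_jbracket[of \<xi>] jbracket_ge_1[of \<xi>] assms
  by (simp add: powr_mult[symmetric] powr_mono2)

lemma jbracket_le_weight: "0 \<le> s \<Longrightarrow> jbracket \<xi> powr s \<le> weight s \<xi>"
  unfolding weight_def using jbracket_le_norm[of \<xi>] jbracket_ge_1[of \<xi>]
  by (intro powr_mono2) auto

text \<open>On a ball of translations \<open>x\<close> the mixed norm dominates the integral of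
  \<open>weight s \<xi> * norm (stft \<phi> T x \<xi>)\<close> in both variables. By Tonelli the integral in \<open>\<xi>\<close> alone is
  finite for almost every such \<open>x\<close>, in particular for some \<open>a\<close> in the nonempty open set where the
  window does not vanish at \<open>x0\<close>. As \<open>stft \<phi> T a\<close> is the transform of the windowed function,
  inversion puts that function into the algebra.\<close>

lemma modulation_space_windowed_in_fourier_algebra:
  fixes \<phi> f :: "real ^ 'n \<Rightarrow> complex"
  assumes p: "1 \<le> p" and s: "0 \<le> s" and \<phi>: "\<phi> \<in> schwartz" "\<phi> \<noteq> (\<lambda>_. 0)"
    and f: "f \<in> modulation_space \<phi> p s"
  shows "\<exists>a. \<phi> (x0 - a) \<noteq> 0 \<and> (\<lambda>t. f t * cnj (\<phi> (t - a))) \<in> fourier_algebra s"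
proof -
  from f obtain T where fc: "continuous_on UNIV f" and T: "T \<in> modulation_distributions \<phi> p s" "represents f T"
    by (auto simp: modulation_space_def)
  have [measurable]: "f \<in> borel_measurable borel" "\<phi> \<in> borel_measurable borel"
    by (intro borel_measurable_continuous_onI fc schwartz_continuous \<phi>)+
  define u where "u x t = f t * cnj (\<phi> (t - x))" for x t
  have atom: "(\<lambda>t. cnj (\<phi> (t - x)) * cis (t \<bullet> \<xi>)) \<in> schwartz" for x \<xi>
    by (rule schwartz_time_frequency_shift[OF \<phi>(1)])
  have u_int: "integrable lborel (u x)" for x
    using T(2) atom[of x 0] by (auto simp: represents_def u_def[abs_def])
  have u_cont: "continuous_on UNIV (u x)" for x
    unfolding u_def by (intro continuous_intros fc continuous_on_compose2[OF schwartz_continuous[OF \<phi>(1)]]) auto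
  have stft: "stft \<phi> T x \<xi> = fourier (u x) (- \<xi>)" for x \<xi>
    using T(2) atom[of x "- \<xi>"] unfolding stft_def exp_eq_cis_inner represents_def fourier_def u_def
    by (simp add: mult.assoc)
  define V where "V x \<xi> = norm (fourier (u x) (- \<xi>))" for x \<xi>
  have V_meas [measurable]: "(\<lambda>(x, \<xi>). V x \<xi>) \<in> borel_measurable (lborel \<Otimes>\<^sub>M lborel)"
  proof -
    let ?G = "\<lambda>z t. u (fst z) t * cis (t \<bullet> (- snd z))"
    have "continuous_on UNIV (\<lambda>y. ?G (fst y) (snd y))"
      unfolding u_def
      by (intro continuous_intros continuous_on_compose2[OF fc] continuous_on_compose2[OF schwartz_continuous[OF \<phi>(1)]]) auto
    then have "(\<lambda>y. ?G (fst y) (snd y)) \<in> borel_measurable ((lborel \<Otimes>\<^sub>M lborel) \<Otimes>\<^sub>M lborel)"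
      unfolding lborel_prod by (simp add: borel_measurable_continuous_onI)
    then have "(\<lambda>z. \<integral>t. ?G z t \<partial>lborel) \<in> borel_measurable (lborel \<Otimes>\<^sub>M lborel)"
      by (intro lborel.borel_measurable_lebesgue_integral) (simp add: case_prod_beta')
    then have "(\<lambda>z. norm (\<integral>t. ?G z t \<partial>lborel)) \<in> borel_measurable (lborel \<Otimes>\<^sub>M lborel)"
      by measurable
    then show ?thesis by (simp add: V_def fourier_def case_prod_beta')
  qed
  have jb_meas [measurable]: "(\<lambda>\<xi> :: real ^ 'n. jbracket \<xi>) \<in> borel_measurable borel"
    unfolding jbracket_def by measurable
  \<comment> \<open>The translations are confined to a ball around one that makes the window nonzero at \<open>x0\<close>.\<close>
  obtain z where z: "\<phi> (x0 - z) \<noteq> 0"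
  proof -
    obtain y where "\<phi> y \<noteq> 0" using \<phi>(2) by auto
    then show ?thesis by (intro that[of "x0 - y"]) simp
  qed
  define S where "S = {x. \<phi> (x0 - x) \<noteq> 0} \<inter> ball z 1"
  have S: "open S" "z \<in> S"
    unfolding S_def using z
    by (auto intro!: open_Int open_Collect_neq continuous_intros continuous_on_compose2[OF schwartz_continuous[OF \<phi>(1)]])
  define Q where "Q = ball z 1"
  have Q_meas [measurable]: "Q \<in> sets borel" by (simp add: Q_def)
  have V_x [measurable]: "(\<lambda>x. V x \<xi>) \<in> borel_measurable borel" for \<xi>
  proof -
    have "(\<lambda>x. (\<lambda>(x, \<xi>). V x \<xi>) (x, \<xi>)) \<in> borel_measurable lborel" by measurable
    then show ?thesis by simp
  qed
  define \<beta> where "\<beta> = measure lborel Q"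
  have \<beta>: "emeasure lborel Q = ennreal \<beta>" "0 \<le> \<beta>"
    unfolding \<beta>_def Q_def using emeasure_lborel_ball_finite[of z 1]
    by (auto intro!: emeasure_eq_ennreal_measure)
  let ?w = "\<lambda>\<xi> :: real ^ 'n. ennreal (jbracket \<xi> powr s)"
  have fin: "(\<integral>\<^sup>+\<xi>. ?w \<xi> * (\<integral>\<^sup>+x. ennreal (V x \<xi>) * indicator Q x \<partial>lborel) \<partial>lborel) < \<infinity>"
  proof -
    let ?L = "\<lambda>\<xi>. ennpowr (\<integral>\<^sup>+ x. ennreal (V x \<xi> powr p) \<partial>lborel) (1 / p)"
    have "(\<integral>\<^sup>+\<xi>. ?w \<xi> * (\<integral>\<^sup>+x. ennreal (V x \<xi>) * indicator Q x \<partial>lborel) \<partial>lborel)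
        \<le> (\<integral>\<^sup>+\<xi>. ennreal (1 + \<beta>) * (?w \<xi> * ?L \<xi>) \<partial>lborel)"
    proof (rule nn_integral_mono)
      fix \<xi> :: "real ^ 'n"
      have "(\<integral>\<^sup>+x. ennreal (V x \<xi>) * indicator Q x \<partial>lborel) \<le> ennreal (1 + \<beta>) * ?L \<xi>"
        by (intro nn_integral_indicator_le_ennpowr p \<beta>) (simp_all add: V_def[of _ \<xi>] V_x[unfolded V_def])
      then have "?w \<xi> * (\<integral>\<^sup>+x. ennreal (V x \<xi>) * indicator Q x \<partial>lborel) \<le> ?w \<xi> * (ennreal (1 + \<beta>) * ?L \<xi>)"
        by (rule mult_left_mono) simp
      then show "?w \<xi> * (\<integral>\<^sup>+x. ennreal (V x \<xi>) * indicator Q x \<partial>lborel) \<le> ennreal (1 + \<beta>) * (?w \<xi> * ?L \<xi>)"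
        by (simp only: ac_simps)
    qed
    also have "\<dots> = ennreal (1 + \<beta>) * (\<integral>\<^sup>+\<xi>. ?w \<xi> * ?L \<xi> \<partial>lborel)"
      by (rule nn_integral_cmult) (unfold ennpowr_def, measurable)
    also have "(\<integral>\<^sup>+\<xi>. ?w \<xi> * ?L \<xi> \<partial>lborel) = modulation_norm \<phi> p s T"
      unfolding modulation_norm_def stft V_def ..
    also have "ennreal (1 + \<beta>) * modulation_norm \<phi> p s T < \<infinity>"
      using T(1) by (simp add: modulation_distributions_def ennreal_mult_less_top)
    finally show ?thesis .
  qed
  have "(\<integral>\<^sup>+\<xi>. ?w \<xi> * (\<integral>\<^sup>+x. ennreal (V x \<xi>) * indicator Q x \<partial>lborel) \<partial>lborel)
      = (\<integral>\<^sup>+\<xi>. (\<integral>\<^sup>+x. ?w \<xi> * (ennreal (V x \<xi>) * indicator Q x) \<partial>lborel) \<partial>lborel)"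
    by (intro nn_integral_cong nn_integral_cmult[symmetric]) measurable
  also have "\<dots> = (\<integral>\<^sup>+x. (\<integral>\<^sup>+\<xi>. ?w \<xi> * (ennreal (V x \<xi>) * indicator Q x) \<partial>lborel) \<partial>lborel)"
    by (rule lborel_pair.Fubini') measurable
  finally have "AE x in lborel. (\<integral>\<^sup>+\<xi>. ?w \<xi> * (ennreal (V x \<xi>) * indicator Q x) \<partial>lborel) \<noteq> \<infinity>"
    using fin by (intro nn_integral_PInf_AE) auto
  from AE_lborel_meets_open[OF this S(1)] S(2) obtain a where
    a: "a \<in> S" "(\<integral>\<^sup>+\<xi>. ?w \<xi> * (ennreal (V a \<xi>) * indicator Q a) \<partial>lborel) \<noteq> \<infinity>" by blast
  then have aS: "\<phi> (x0 - a) \<noteq> 0" "a \<in> Q" by (auto simp: S_def Q_def)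
  have [measurable]: "fourier (u a) \<in> borel_measurable borel"
    by (rule measurable_fourier[OF u_int])
  have "integrable lborel (\<lambda>\<xi>. jbracket \<xi> powr s * norm (fourier (u a) (- \<xi>)))"
  proof (rule integrableI_bounded)
    have "(\<integral>\<^sup>+\<xi>. ennreal (norm (jbracket \<xi> powr s * norm (fourier (u a) (- \<xi>)))) \<partial>lborel)
        = (\<integral>\<^sup>+\<xi>. ?w \<xi> * (ennreal (V a \<xi>) * indicator Q a) \<partial>lborel)"
      using aS by (intro nn_integral_cong) (simp add: V_def abs_mult ennreal_mult)
    then show "(\<integral>\<^sup>+\<xi>. ennreal (norm (jbracket \<xi> powr s * norm (fourier (u a) (- \<xi>)))) \<partial>lborel) < \<infinity>"
      using a(2) by (simp add: less_top)
  qed measurable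
  from integrable_mult_right[OF this, of "2 powr s"]
  have "integrable lborel (\<lambda>\<xi>. weight s \<xi> * norm (fourier (u a) (- \<xi>)))"
  proof (rule Bochner_Integration.integrable_bound)
    have "weight s \<xi> * norm (fourier (u a) (- \<xi>)) \<le> 2 powr s * (jbracket \<xi> powr s * norm (fourier (u a) (- \<xi>)))" for \<xi>
      using mult_right_mono[OF weight_le_jbracket[OF s, of \<xi>], of "norm (fourier (u a) (- \<xi>))"] by (simp add: mult.assoc)
    then show "AE \<xi> in lborel. norm (weight s \<xi> * norm (fourier (u a) (- \<xi>))) \<le> norm (2 powr s * (jbracket \<xi> powr s * norm (fourier (u a) (- \<xi>))))"
      by (intro always_eventually allI) (simp add: abs_mult)
  qed measurable
  from lborel_integrable_reflect[OF this, of 0]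
  have "fourier (u a) \<in> weighted_L1 s"
    by (simp add: weighted_L1_def)
  from fourier_algebra_if_fourier_weighted_L1[OF s u_cont u_int this]
  show ?thesis
    using aS(1) by (auto simp: u_def[abs_def])
qed

text \<open>The window is removed by multiplying with a local inverse of it, which the local Wiener-Levy
  theorem for \<open>inverse\<close> provides.\<close>

lemma modulation_space_locally_in_fourier_algebra:
  fixes \<phi> f :: "real ^ 'n \<Rightarrow> complex"
  assumes p: "1 \<le> p" and s: "0 \<le> s" and \<phi>: "\<phi> \<in> schwartz" "\<phi> \<noteq> (\<lambda>_. 0)"
    and f: "f \<in> modulation_space \<phi> p s"
  shows "\<exists>k\<in>fourier_algebra s. \<exists>\<delta>>0. \<forall>x. norm (x - x0) \<le> \<delta> \<longrightarrow> k x = f x"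
proof -
  obtain a where a: "\<phi> (x0 - a) \<noteq> 0" "(\<lambda>t. f t * cnj (\<phi> (t - a))) \<in> fourier_algebra s"
    using modulation_space_windowed_in_fourier_algebra[OF assms, of x0] by blast
  define v where "v t = cnj (\<phi> (t - a))" for t
  have "v \<in> schwartz"
    using schwartz_time_frequency_shift[OF \<phi>(1), of a 0] by (simp add: v_def[abs_def])
  then have v: "v \<in> fourier_algebra s" "continuous_on UNIV v"
    using schwartz_subset_fourier_algebra[OF s] schwartz_continuous by auto
  have v0: "v x0 \<noteq> 0" using a(1) by (simp add: v_def)
  have "inverse analytic_on {v x0}"
    using v0 by (intro analytic_intros) auto
  from wiener_levy_local[OF s v(1) this] obtain w \<delta>1 where
    w: "w \<in> fourier_algebra s" "0 < \<delta>1" "\<And>x. norm (x - x0) \<le> \<delta>1 \<Longrightarrow> w x = inverse (v x)" by blast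
  have "open {x. v x \<noteq> 0}"
    using v(2) by (intro open_Collect_neq continuous_intros) auto
  then obtain \<delta>2 where \<delta>2: "0 < \<delta>2" "cball x0 \<delta>2 \<subseteq> {x. v x \<noteq> 0}"
    using v0 open_contains_cball[of "{x. v x \<noteq> 0}"] by auto
  have "(\<lambda>x. (f x * v x) * w x) \<in> fourier_algebra s"
    unfolding v_def by (rule fourier_algebra_mult[OF s a(2) w(1)])
  moreover have "(f x * v x) * w x = f x" if "norm (x - x0) \<le> min \<delta>1 \<delta>2" for x
  proof -
    have "v x \<noteq> 0" using \<delta>2 that by (auto simp: dist_norm norm_minus_commute)
    then show ?thesis using w(3)[of x] that by simp
  qed
  ultimately show ?thesis
    using w(2) \<delta>2(1) by (intro bexI[of _ "\<lambda>x. (f x * v x) * w x"] exI[of _ "min \<delta>1 \<delta>2"]) auto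
qed

section \<open>From the Fourier algebra to modulation spaces\<close>

lemma ennpowr_mono: "u \<le> v \<Longrightarrow> 0 \<le> a \<Longrightarrow> ennpowr u a \<le> ennpowr v a"
  unfolding ennpowr_def
  by (auto simp: top_unique less_top enn2real_mono intro!: ennreal_leI powr_mono2 enn2real_nonneg)

text \<open>The short-time Fourier transform of \<open>b \<cdot> fourier H\<close> is, up to reflection, the convolution of \<open>H\<close> with the transform of
  \<open>b\<close> times the shifted window. The latter decays to order \<open>N\<close> in frequency; half of the decay of
  \<open>b\<close> is traded, against the decay of the window, for decay in the translation \<open>x\<close>. This separates
  the variables.\<close>

lemma bump_times_fourier_algebra_stft_bound:
  fixes \<phi> b h :: "real ^ 'n \<Rightarrow> complex"
  defines "M \<equiv> 2 * real CARD('n)"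
  assumes s: "0 \<le> s" and N: "s + M \<le> real N"
    and b: "\<And>e. e \<in> Basis \<Longrightarrow> Ck_bounded N e (\<lambda>t. C1 * weight (- (2 * M)) t) b"
    and \<phi>: "\<phi> \<in> schwartz" and H: "H \<in> weighted_L1 s"
  obtains J where "J \<in> weighted_L1 s"
    and "\<And>x \<xi>. norm (fourier (\<lambda>t. b t * fourier H t * cnj (\<phi> (t - x))) (- \<xi>)) \<le> weight (- M) x * norm (J \<xi>)"
proof -
  have M0: "0 \<le> M" and MD: "2 * real DIM(real ^ 'n) \<le> M" by (auto simp: M_def)
  have iH: "integrable lborel H" by (rule weighted_L1_imp_integrable[OF H s])
  have [measurable]: "H \<in> borel_measurable borel" by (rule weighted_L1_measurable[OF H])
  obtain C2 where C2: "\<And>e. e \<in> Basis \<Longrightarrow> Ck_bounded N e (\<lambda>t. C2 * weight (- M) t) \<phi>"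
    using schwartz_Ck_bounded[OF \<phi>] by blast
  obtain e0 :: "real ^ 'n" where e0: "e0 \<in> Basis" using nonempty_Basis by blast
  have C0: "0 \<le> C1" "0 \<le> C2"
    using order_trans[OF norm_ge_zero Ck_bounded_imp_norm_le[OF b[OF e0], of 0]]
      order_trans[OF norm_ge_zero Ck_bounded_imp_norm_le[OF C2[OF e0], of 0]]
    by (simp_all add: weight_def)
  define w where "w x t = b t * cnj (\<phi> (t - x))" for x t
  define D where "D = (real DIM(real ^ 'n) + 1) ^ N * ((2 ^ N * (C1 * C2)) * (\<integral>(t::real ^ 'n). weight (- M) t \<partial>lborel))"
  have D0: "0 \<le> D"
    unfolding D_def using C0 by (intro mult_nonneg_nonneg Bochner_Integration.integral_nonneg) auto
  have w_Ck: "Ck_bounded N e (\<lambda>t. (2 ^ N * (C1 * C2) * weight (- M) x) * weight (- M) t) (w x)" if e: "e \<in> Basis" for e x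
    unfolding w_def
  proof (rule Ck_bounded_mono[OF Ck_bounded_mult[OF b[OF e] Ck_bounded_translate[OF Ck_bounded_cnj[OF C2[OF e]]]]])
    fix t :: "real ^ 'n"
    have "weight (- (2 * M)) t * weight (- M) (t - x) \<le> weight (- (2 * M)) t * (weight M t * weight (- M) x)"
      using weight_neg_add[OF M0, of "- x" t] by (intro mult_left_mono) auto
    also have "\<dots> = (weight (- M) t * weight (- M) x) * (weight M t * weight (- M) t)"
      using weight_add[of "- M" "- M" t] by (simp add: ac_simps)
    finally have "weight (- (2 * M)) t * weight (- M) (t - x) \<le> weight (- M) t * weight (- M) x" by simp
    then have "(2 ^ N * (C1 * C2)) * (weight (- (2 * M)) t * weight (- M) (t - x)) \<le> (2 ^ N * (C1 * C2)) * (weight (- M) t * weight (- M) x)"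
      using C0 by (intro mult_left_mono) auto
    then show "2 ^ N * ((C1 * weight (- (2 * M)) t) * (C2 * weight (- M) (t - x))) \<le> (2 ^ N * (C1 * C2) * weight (- M) x) * weight (- M) t"
      by (simp only: ac_simps)
  qed
  have Fw: "norm (fourier (w x) \<zeta>) \<le> D * weight (- M) x * weight (- real N) \<zeta>" for x \<zeta>
    using fourier_Ck_bounded_decay[OF w_Ck MD, of x \<zeta>] unfolding D_def by (simp only: ac_simps)
  have w_int: "integrable lborel (w x)" for x
    using integrable_weight_bound[OF Ck_bounded_imp_continuous[OF w_Ck[OF e0]] Ck_bounded_imp_norm_le[OF w_Ck[OF e0]] MD] .
  define A where "A \<eta> = complex_of_real (norm (H \<eta>))" for \<eta>
  define W where "W \<zeta> = complex_of_real (weight (- real N) \<zeta>)" for \<zeta> :: "real ^ 'n"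
  have A: "A \<in> weighted_L1 s"
    using H by (simp add: weighted_L1_def A_def[abs_def])
  have W_meas [measurable]: "W \<in> borel_measurable borel"
    unfolding W_def by measurable
  have W: "W \<in> weighted_L1 s"
    by (rule weighted_L1_bound[OF W_meas, of 1 "real N"]) (use N in \<open>simp_all add: W_def M_def\<close>)
  define J where "J \<xi> = complex_of_real D * convolution A W \<xi>" for \<xi>
  have "norm (fourier (\<lambda>t. b t * fourier H t * cnj (\<phi> (t - x))) (- \<xi>)) \<le> weight (- M) x * norm (J \<xi>)" for x \<xi>
  proof -
    have le: "norm (H \<eta> * fourier (w x) (\<eta> + - \<xi>)) \<le> D * weight (- M) x * (norm (H \<eta>) * weight (- real N) (\<xi> - \<eta>))" for \<eta>
      using mult_left_mono[OF Fw[of x "\<eta> + - \<xi>"], of "norm (H \<eta>)"] weight_uminus[of "- real N" "\<eta> + - \<xi>"]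
      by (simp add: norm_mult ac_simps)
    have i: "integrable lborel (\<lambda>\<eta>. norm (H \<eta>) * weight (- real N) (\<xi> - \<eta>))"
    proof (rule Bochner_Integration.integrable_bound[OF integrable_norm[OF iH]])
      show "AE \<eta> in lborel. norm (norm (H \<eta>) * weight (- real N) (\<xi> - \<eta>)) \<le> norm (norm (H \<eta>))"
        by (intro always_eventually allI) (simp add: abs_mult mult_left_le weight_le_1)
    qed measurable
    have "fourier (\<lambda>t. b t * fourier H t * cnj (\<phi> (t - x))) (- \<xi>) = (\<integral>t. fourier H t * (w x t * cis (t \<bullet> (- \<xi>))) \<partial>lborel)"
      unfolding fourier_def[of _ "- \<xi>"] w_def by (simp only: ac_simps)
    also have "\<dots> = (\<integral>\<eta>. H \<eta> * fourier (w x) (\<eta> + - \<xi>) \<partial>lborel)"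
      unfolding fourier_modulate[symmetric]
      by (rule fourier_multiplication_formula[OF iH integrable_mult_cis[OF w_int]])
    finally have eq: "fourier (\<lambda>t. b t * fourier H t * cnj (\<phi> (t - x))) (- \<xi>) = (\<integral>\<eta>. H \<eta> * fourier (w x) (\<eta> + - \<xi>) \<partial>lborel)" .
    have "norm (fourier (\<lambda>t. b t * fourier H t * cnj (\<phi> (t - x))) (- \<xi>)) \<le> (\<integral>\<eta>. norm (H \<eta> * fourier (w x) (\<eta> + - \<xi>)) \<partial>lborel)"
      unfolding eq by (rule integral_norm_bound)
    also have "\<dots> \<le> (\<integral>\<eta>. D * weight (- M) x * (norm (H \<eta>) * weight (- real N) (\<xi> - \<eta>)) \<partial>lborel)"
      by (rule integral_mono'[OF integrable_mult_right[OF i] le]) (simp add: D0)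
    also have "\<dots> = weight (- M) x * (D * (\<integral>\<eta>. norm (H \<eta>) * weight (- real N) (\<xi> - \<eta>) \<partial>lborel))"
      by simp
    also have "\<dots> \<le> weight (- M) x * norm (J \<xi>)"
    proof (rule mult_left_mono)
      have "J \<xi> = complex_of_real (D * (\<integral>\<eta>. norm (H \<eta>) * weight (- real N) (\<xi> - \<eta>) \<partial>lborel))"
        unfolding J_def convolution_def A_def W_def of_real_mult[symmetric] integral_complex_of_real ..
      then show "D * (\<integral>\<eta>. norm (H \<eta>) * weight (- real N) (\<xi> - \<eta>) \<partial>lborel) \<le> norm (J \<xi>)"
        by (simp only: norm_of_real abs_ge_self)
    qed simp
    finally show ?thesis .
  qed
  moreover have "J \<in> weighted_L1 s"
    unfolding J_def by (intro weighted_L1_cmult convolution_weighted_L1 s A W)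
  ultimately show ?thesis by (rule that[rotated])
qed

text \<open>The factor depending on \<open>x\<close> is at most one and integrable, so its \<open>p\<close>-th power is integrable as well.\<close>

lemma modulation_norm_finite_of_stft_bound:
  fixes T :: "(real ^ 'n \<Rightarrow> complex) \<Rightarrow> complex"
  assumes p: "1 \<le> p" and s: "0 \<le> s" and J: "J \<in> weighted_L1 s"
    and le: "\<And>x \<xi>. norm (stft \<phi> T x \<xi>) \<le> weight (- (2 * real CARD('n))) x * norm (J \<xi>)"
  shows "modulation_norm \<phi> p s T < \<infinity>"
proof -
  let ?W = "weight (- (2 * real CARD('n))) :: real ^ 'n \<Rightarrow> real"
  have [measurable]: "J \<in> borel_measurable borel" by (rule weighted_L1_measurable[OF J])
  have W_int: "integrable lborel ?W" by (rule integrable_weight) simp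
  define E where "E = integral\<^sup>L lborel ?W"
  have E: "0 \<le> E" unfolding E_def by (intro Bochner_Integration.integral_nonneg) simp
  have "ennpowr (\<integral>\<^sup>+x. ennreal (norm (stft \<phi> T x \<xi>) powr p) \<partial>lborel) (1 / p) \<le> ennreal (norm (J \<xi>) * E powr (1 / p))" for \<xi>
  proof -
    have "(\<integral>\<^sup>+x. ennreal (norm (stft \<phi> T x \<xi>) powr p) \<partial>lborel) \<le> (\<integral>\<^sup>+x. ennreal (norm (J \<xi>) powr p) * ennreal (?W x) \<partial>lborel)"
    proof (rule nn_integral_mono)
      fix x :: "real ^ 'n"
      have "norm (stft \<phi> T x \<xi>) powr p \<le> (?W x * norm (J \<xi>)) powr p"
        using le p by (intro powr_mono2) auto
      also have "\<dots> = ?W x powr p * norm (J \<xi>) powr p"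
        by (rule powr_mult)
      also have "\<dots> \<le> ?W x * norm (J \<xi>) powr p"
      proof (rule mult_right_mono)
        have "?W x powr p \<le> ?W x powr 1"
          using p by (intro powr_mono') (auto intro: weight_le_1)
        then show "?W x powr p \<le> ?W x" by simp
      qed simp
      finally have "norm (stft \<phi> T x \<xi>) powr p \<le> norm (J \<xi>) powr p * ?W x"
        by (simp only: mult.commute)
      then show "ennreal (norm (stft \<phi> T x \<xi>) powr p) \<le> ennreal (norm (J \<xi>) powr p) * ennreal (?W x)"
        by (simp add: ennreal_mult[symmetric] ennreal_leI)
    qed
    also have "\<dots> = ennreal (norm (J \<xi>) powr p) * (\<integral>\<^sup>+x. ennreal (?W x) \<partial>lborel)"
      by (rule nn_integral_cmult) simp
    also have "(\<integral>\<^sup>+x. ennreal (?W x) \<partial>lborel) = ennreal E"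
      unfolding E_def by (intro nn_integral_eq_integral W_int) simp
    finally have "(\<integral>\<^sup>+x. ennreal (norm (stft \<phi> T x \<xi>) powr p) \<partial>lborel) \<le> ennreal (norm (J \<xi>) powr p * E)"
      using E by (simp add: ennreal_mult)
    then have "ennpowr (\<integral>\<^sup>+x. ennreal (norm (stft \<phi> T x \<xi>) powr p) \<partial>lborel) (1 / p) \<le> ennpowr (ennreal (norm (J \<xi>) powr p * E)) (1 / p)"
      using p by (intro ennpowr_mono) auto
    also have "\<dots> = ennreal (norm (J \<xi>) * E powr (1 / p))"
      using p E by (simp add: ennpowr_def powr_mult powr_powr)
    finally show ?thesis .
  qed
  then have "modulation_norm \<phi> p s T \<le> (\<integral>\<^sup>+\<xi>. ennreal (weight s \<xi>) * ennreal (norm (J \<xi>) * E powr (1 / p)) \<partial>lborel)"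
    unfolding modulation_norm_def
    by (intro nn_integral_mono mult_mono ennreal_leI jbracket_le_weight s) auto
  also have "\<dots> = (\<integral>\<^sup>+\<xi>. ennreal (norm (weight s \<xi> * norm (J \<xi>) * E powr (1 / p))) \<partial>lborel)"
    by (intro nn_integral_cong) (simp add: ennreal_mult[symmetric] abs_mult mult.assoc)
  also have "\<dots> < \<infinity>"
  proof -
    have "integrable lborel (\<lambda>\<xi>. weight s \<xi> * norm (J \<xi>) * E powr (1 / p))"
      using J by (intro integrable_mult_left) (simp add: weighted_L1_def)
    then show ?thesis by (rule integrable_iff_bounded[THEN iffD1, THEN conjunct2])
  qed
  finally show ?thesis .
qed

lemma norm_le_schwartz_norm_0:
  fixes \<psi> :: "real ^ 'n \<Rightarrow> complex"
  assumes "\<psi> \<in> schwartz"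
  shows "norm (\<psi> t) \<le> schwartz_norm 0 \<psi>"
proof -
  have "schwartz_norm 0 \<psi> = (SUP x. norm (\<psi> x))"
    by (simp add: schwartz_norm_def)
  moreover have "bdd_above (range (\<lambda>x. norm (\<psi> x)))"
  proof -
    obtain C where "\<And>t. norm (\<psi> t) \<le> C * weight (- 0) t"
      using schwartz_decay[OF assms] by metis
    then show ?thesis by (intro bdd_aboveI2[of _ _ C]) simp
  qed
  ultimately show ?thesis
    using cSUP_upper[of t UNIV "\<lambda>x. norm (\<psi> x)"] by simp
qed

lemma integrable_mult_schwartz:
  fixes g \<psi> :: "real ^ 'n \<Rightarrow> complex"
  assumes g: "integrable lborel g" and \<psi>: "\<psi> \<in> schwartz"
  shows "integrable lborel (\<lambda>t. g t * \<psi> t)"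
    and "norm (\<integral>t. g t * \<psi> t \<partial>lborel) \<le> (\<integral>t. norm (g t) \<partial>lborel) * schwartz_norm 0 \<psi>"
proof -
  have [measurable]: "\<psi> \<in> borel_measurable borel" "g \<in> borel_measurable borel"
    using g borel_measurable_continuous_onI[OF schwartz_continuous[OF \<psi>]] by auto
  have le: "norm (g t * \<psi> t) \<le> norm (g t) * schwartz_norm 0 \<psi>" for t
    unfolding norm_mult by (intro mult_left_mono norm_le_schwartz_norm_0 \<psi>) simp
  have i: "integrable lborel (\<lambda>t. norm (g t) * schwartz_norm 0 \<psi>)"
    by (intro integrable_mult_left integrable_norm g)
  show int: "integrable lborel (\<lambda>t. g t * \<psi> t)"
    by (rule Bochner_Integration.integrable_bound[OF i])
      (simp_all add: order_trans[OF le abs_ge_self])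
  have "norm (\<integral>t. g t * \<psi> t \<partial>lborel) \<le> (\<integral>t. norm (g t * \<psi> t) \<partial>lborel)"
    by (rule integral_norm_bound)
  also have "\<dots> \<le> (\<integral>t. norm (g t) * schwartz_norm 0 \<psi> \<partial>lborel)"
    by (rule integral_mono[OF integrable_norm[OF int] i le])
  finally show "norm (\<integral>t. g t * \<psi> t \<partial>lborel) \<le> (\<integral>t. norm (g t) \<partial>lborel) * schwartz_norm 0 \<psi>"
    by simp
qed

text \<open>The witness is the product of \<open>h\<close> with a bump equal to one on the ball of radius \<open>R\<close>. Being
  integrable, it defines a tempered distribution of order zero.\<close>

lemma fourier_algebra_locally_in_modulation_space:
  fixes \<phi> h :: "real ^ 'n \<Rightarrow> complex"
  assumes p: "1 \<le> p" and s: "0 \<le> s" and \<phi>: "\<phi> \<in> schwartz"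
    and h: "h \<in> fourier_algebra s" and R: "0 < R"
  shows "\<exists>g\<in>modulation_space \<phi> p s. \<forall>x. norm x \<le> R \<longrightarrow> g x = h x"
proof -
  let ?M = "2 * real CARD('n)"
  obtain H where H: "H \<in> weighted_L1 s" "h = fourier H"
    using h by (auto simp: fourier_algebra_def)
  define N where "N = nat \<lceil>s\<rceil> + 2 * CARD('n)"
  have N: "s + ?M \<le> real N"
    using real_nat_ceiling_ge[of s] by (simp add: N_def)
  obtain \<beta> :: "real ^ 'n \<Rightarrow> real" and C where
    Ck: "\<And>e. Ck_bounded N e (\<lambda>t. C e * weight (- (2 * ?M)) t) (\<lambda>x. of_real (\<beta> x))" and
    \<beta>: "\<And>x. norm x \<le> R \<Longrightarrow> \<beta> x = 1"
    using ex_bump[OF R, of N "2 * ?M"] by blast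
  define b where "b x = complex_of_real (\<beta> x)" for x
  define C1 where "C1 = Max (C ` Basis)"
  have b: "Ck_bounded N e (\<lambda>t. C1 * weight (- (2 * ?M)) t) b" if "e \<in> Basis" for e
    using that unfolding b_def by (intro Ck_bounded_mono[OF Ck[of e]] mult_right_mono) (auto simp: C1_def)
  have b_cont: "continuous_on UNIV b"
    using Ck_bounded_imp_continuous[OF Ck] by (simp add: b_def[abs_def])
  have b_int: "integrable lborel b"
    using integrable_weight_bound[OF b_cont, of "C 0" "2 * ?M"] Ck_bounded_imp_norm_le[OF Ck[of 0]] by (simp add: b_def)
  have h_cont: "continuous_on UNIV h" by (rule continuous_on_fourier_algebra[OF s h])
  define g where "g t = b t * fourier H t" for t
  have g_cont: "continuous_on UNIV g"
    using b_cont h_cont by (simp add: g_def[abs_def] H(2) continuous_on_mult)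
  have g_int: "integrable lborel g"
  proof (rule Bochner_Integration.integrable_bound)
    show "integrable lborel (\<lambda>t. wnorm s H * norm (b t))"
      by (intro integrable_mult_right integrable_norm b_int)
    show "AE t in lborel. norm (g t) \<le> norm (wnorm s H * norm (b t))"
      using norm_fourier_le_wnorm[OF H(1) s] wnorm_nonneg[of s H]
      by (intro always_eventually allI) (simp add: g_def norm_mult mult.commute[of "wnorm s H"] mult_left_mono)
    show "g \<in> borel_measurable lborel"
      using borel_measurable_continuous_onI[OF g_cont] by simp
  qed
  define T where "T \<psi> = (\<integral>t. g t * \<psi> t \<partial>lborel)" for \<psi>
  have "represents g T"
    unfolding represents_def T_def using integrable_mult_schwartz(1)[OF g_int] by auto
  moreover have "T \<in> tempered_distributions"
    unfolding tempered_distributions_def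
  proof (intro CollectI conjI ballI allI)
    show "T (\<lambda>t. \<psi> t + \<eta> t) = T \<psi> + T \<eta>" if "\<psi> \<in> schwartz" "\<eta> \<in> schwartz" for \<psi> \<eta>
      unfolding T_def distrib_left
      by (intro Bochner_Integration.integral_add integrable_mult_schwartz g_int that)
    show "T (\<lambda>t. c * \<psi> t) = c * T \<psi>" for c \<psi>
      unfolding T_def by (simp add: mult.left_commute[of _ c])
    show "\<exists>C N. \<forall>\<psi>\<in>schwartz. norm (T \<psi>) \<le> C * schwartz_norm N \<psi>"
      unfolding T_def using integrable_mult_schwartz(2)[OF g_int] by blast
  qed
  moreover have "modulation_norm \<phi> p s T < \<infinity>"
  proof -
    obtain J where J: "J \<in> weighted_L1 s"
      "\<And>x \<xi>. norm (fourier (\<lambda>t. b t * fourier H t * cnj (\<phi> (t - x))) (- \<xi>)) \<le> weight (- ?M) x * norm (J \<xi>)"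
      using bump_times_fourier_algebra_stft_bound[OF s N b \<phi> H(1)] by blast
    have "stft \<phi> T x \<xi> = fourier (\<lambda>t. b t * fourier H t * cnj (\<phi> (t - x))) (- \<xi>)" for x \<xi>
      unfolding stft_def T_def g_def exp_eq_cis_inner fourier_def[of _ "- \<xi>"] by (simp only: mult.assoc)
    with J(2) show ?thesis
      by (intro modulation_norm_finite_of_stft_bound[OF p s J(1)]) simp
  qed
  ultimately have "g \<in> modulation_space \<phi> p s"
    using g_cont by (auto simp: modulation_space_def modulation_distributions_def)
  moreover have "g x = h x" if "norm x \<le> R" for x
    using \<beta>[OF that] by (simp add: g_def b_def H(2))
  ultimately show ?thesis by blast
qed

section \<open>Gluing and the theorem\<close>

text \<open>In place of a partition of unity the local solutions are merged one at a time: \<open>g + b \<cdot> (G - g)\<close>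
  equals \<open>\<Phi>\<close> where the bump \<open>b\<close> is one, and keeps the value \<open>\<Phi>\<close> wherever \<open>g\<close> already attains it,
  because on the support of \<open>b\<close> the local solution \<open>G\<close> also agrees with \<open>\<Phi>\<close>.\<close>

lemma fourier_algebra_glue:
  fixes K :: "'a::euclidean_space set"
  assumes s: "0 \<le> s" and K: "compact K"
    and loc: "\<And>x0. x0 \<in> K \<Longrightarrow> \<exists>g\<in>fourier_algebra s. \<exists>\<delta>>0. \<forall>x\<in>K. norm (x - x0) \<le> \<delta> \<longrightarrow> g x = \<Phi> x"
  shows "\<exists>g\<in>fourier_algebra s. \<forall>x\<in>K. g x = \<Phi> x"
proof -
  obtain G \<delta> where G: "\<And>x0. x0 \<in> K \<Longrightarrow> G x0 \<in> fourier_algebra s" and \<delta>: "\<And>x0. x0 \<in> K \<Longrightarrow> 0 < \<delta> x0"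
    and eq: "\<And>x0 x. x0 \<in> K \<Longrightarrow> x \<in> K \<Longrightarrow> norm (x - x0) \<le> \<delta> x0 \<Longrightarrow> G x0 x = \<Phi> x"
    using loc by metis
  have "K \<subseteq> (\<Union>x0\<in>K. ball x0 (\<delta> x0 / 2))"
    using \<delta> by force
  then obtain X where X: "X \<subseteq> K" "finite X" "K \<subseteq> (\<Union>x0\<in>X. ball x0 (\<delta> x0 / 2))"
    using compactE_image[OF K, of K "\<lambda>x0. ball x0 (\<delta> x0 / 2)"] by (metis open_ball)
  from X(2,1) have "\<exists>g\<in>fourier_algebra s. \<forall>x\<in>K. x \<in> (\<Union>x0\<in>X. ball x0 (\<delta> x0 / 2)) \<longrightarrow> g x = \<Phi> x"
  proof (induction X rule: finite_induct)
    case empty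
    then show ?case using fourier_algebra_zero by auto
  next
    case (insert y Y)
    then obtain g where g: "g \<in> fourier_algebra s" "\<And>x. x \<in> K \<Longrightarrow> x \<in> (\<Union>x0\<in>Y. ball x0 (\<delta> x0 / 2)) \<Longrightarrow> g x = \<Phi> x"
      by auto
    have y: "y \<in> K" using insert.prems by simp
    obtain b where b: "b \<in> fourier_algebra s" "\<And>x. norm (x - y) \<le> \<delta> y / 2 \<Longrightarrow> b x = 1"
      "\<And>x. \<delta> y \<le> norm (x - y) \<Longrightarrow> b x = 0"
      using fourier_algebra_bump[OF s, of "\<delta> y / 2" y] \<delta>[OF y] by auto
    define k where "k x = g x + b x * (G y x - g x)" for x
    have "k \<in> fourier_algebra s"
      unfolding k_def by (intro fourier_algebra_add fourier_algebra_mult fourier_algebra_diff s g b G y)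
    moreover have "k x = \<Phi> x" if x: "x \<in> K" "x \<in> (\<Union>x0\<in>insert y Y. ball x0 (\<delta> x0 / 2))" for x
    proof (cases "x \<in> ball y (\<delta> y / 2)")
      case True
      then have "norm (x - y) \<le> \<delta> y / 2" by (simp add: dist_norm norm_minus_commute)
      then show ?thesis
        using eq[OF y x(1)] b(2)[of x] \<delta>[OF y] by (simp add: k_def)
    next
      case False
      then have "g x = \<Phi> x" using g(2) x by auto
      then show ?thesis
        using eq[OF y x(1)] b(3)[of x] by (cases "norm (x - y) \<le> \<delta> y") (auto simp: k_def)
    qed
    ultimately show ?case by blast
  qed
  then show ?thesis using X(3) by blast
qed

theorem theorem5p1:
  fixes p s :: real
    and \<phi> f :: "real ^ 'n \<Rightarrow> complex"
    and F :: "complex \<Rightarrow> complex"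
    and K :: "(real ^ 'n) set"
    and U :: "complex set"
  assumes "1 \<le> p" and "0 \<le> s"
    and "\<phi> \<in> schwartz" and "\<phi> \<noteq> (\<lambda>_. 0)"
    and "f \<in> modulation_space \<phi> p s"
    and "compact K"
    and "open U" and "f ` K \<subseteq> U" and "F analytic_on U"
  shows "\<exists>g\<in>modulation_space \<phi> p s. \<forall>x\<in>K. g x = F (f x)"
proof -
  have "\<exists>g\<in>fourier_algebra s. \<exists>\<delta>>0. \<forall>x\<in>K. norm (x - x0) \<le> \<delta> \<longrightarrow> g x = F (f x)" if x0: "x0 \<in> K" for x0
  proof -
    obtain k \<delta>1 where k: "k \<in> fourier_algebra s" "0 < \<delta>1" "\<And>x. norm (x - x0) \<le> \<delta>1 \<Longrightarrow> k x = f x"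
      using modulation_space_locally_in_fourier_algebra[OF assms(1-5), of x0] by blast
    have "F analytic_on {k x0}"
      using analytic_on_subset[OF assms(9), of "{k x0}"] assms(8) x0 k(2) k(3)[of x0] by auto
    from wiener_levy_local[OF assms(2) k(1) this] obtain g \<delta>2 where
      g: "g \<in> fourier_algebra s" "0 < \<delta>2" "\<And>x. norm (x - x0) \<le> \<delta>2 \<Longrightarrow> g x = F (k x)" by blast
    show ?thesis
      using g k by (intro bexI[of _ g] exI[of _ "min \<delta>1 \<delta>2"]) auto
  qed
  from fourier_algebra_glue[OF assms(2,6) this] obtain h where
    h: "h \<in> fourier_algebra s" "\<And>x. x \<in> K \<Longrightarrow> h x = F (f x)" by blast
  obtain R where R: "0 < R" "\<And>x. x \<in> K \<Longrightarrow> norm x \<le> R"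
    using compact_imp_bounded[OF assms(6)] by (auto simp: bounded_pos)
  obtain g where "g \<in> modulation_space \<phi> p s" "\<And>x. norm x \<le> R \<Longrightarrow> g x = h x"
    using fourier_algebra_locally_in_modulation_space[OF assms(1-3) h(1) R(1)] by blast
  with h(2) R(2) show ?thesis
    by (intro bexI[of _ g]) simp_all
qed

end
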